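(* Let $M$ be an $n$-dimensional smooth manifold with a linear connection $\widetilde{\nabla}$. Let $(A_i)_{i=1,\dots,n^2}$ be a basis of $\mathfrak{gl}(n,\mathbb{R})$ and $(\xi_j)_{j=1,\dots,n}$ a basis of $\mathbb{R}^n$, so that the fields $A_i^*$ and $B_j=B(\xi_j)$ form a frame on $L(M)$ composed exclusively of fundamental and standard horizontal fields. For any linear connection $\nabla$ on $L(M)$, divide the coefficients of $\nabla$ with respect to this frame into four sets, determined respectively by the expressions, where $X$ ranges over all fields of the frame, (1) $h(\nabla_XB_j)$; (2) $v(\nabla_XB_j)$; (3) $h(\nabla_XA_i^* )$; (4) $v(\nabla_XA_i^* )$. Then: (i) The first set of coefficients is given by $h(\nabla_{B_i}B_j)=0$ for all $i,j$ and $h(\nabla_{A_i^*}B_j)=\Gamma^k_{ij}B_k$ for all $i,j$, where the constants $\Gamma^k_{ij}$ are determined by $A_i\xi_j=\Gamma^k_{ij}\xi_k$ (summation over $k$), if and only if $\nabla$ satisfies the special condition for a lift of $\widetilde{\nabla}$. (ii) The coefficients of the second set are all equal to zero if and only if $\nabla$ satisfies condition (a); the coefficients of the third set are all equal to zero if and only if $\nabla$ satisfies condition (b); the coefficients of the fourth set are all equal to zero if and only if $\nabla$ satisfies condition (c).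
   Context: $\pi:L(M)\to M$ is the frame bundle; a frame $u$ is regarded as a linear isomorphism $u:\mathbb{R}^n\to T_{\pi(u)}(M)$. $\omega$ is the $\mathfrak{gl}(n,\mathbb{R})$-valued connection form on $L(M)$ of $\widetilde{\nabla}$ and $\theta(X)=u^{-1}(\pi_*X)$, $X\in T_u(L(M))$, is the canonical form. Horizontal vectors are those in $\ker\omega$, vertical vectors those in $\ker\pi_*$; $h$ and $v$ denote horizontal and vertical components. For $A\in\mathfrak{gl}(n,\mathbb{R})$, $A^*$ is the fundamental (vertical) field on $L(M)$ with $\omega(A^* )=A$; for $\xi\in\mathbb{R}^n$, $B(\xi)$ is the standard horizontal field, i.e. the horizontal field with $\theta(B(\xi))=\xi$. $Y^h$ is the horizontal lift of a field $Y$ on $M$. Special condition for a lift of $\widetilde{\nabla}$: $\pi_*(\nabla_ZY^h)=\widetilde{\nabla}_{\pi_*(Z)}Y$ for every $Z\in T(L(M))$ and every vector field $Y$ on $M$. Conditions on a linear connection $\nabla$ on $L(M)$: (a) the parallel transport of $\nabla$ along curves in $L(M)$ preserves horizontality of vectors; (b) the parallel transport of $\nabla$ preserves verticality of vectors; (c) $\omega(\nabla_XA^* )=0$ for every vector $X\in T(L(M))$ and every fundamental field $A^*$. *)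

theory Defs
  imports "HOL-Analysis.Analysis"
begin

section \<open>Smooth manifolds\<close>

text \<open>For open \<open>S\<close> in a Euclidean space. Since all directional derivatives are required to be
  continuous, this is the usual notion of a \<open>C\<close>-\<open>k\<close> map.\<close>

primrec Ck_on :: "nat \<Rightarrow> 'a::euclidean_space set \<Rightarrow> ('a \<Rightarrow> 'b::euclidean_space) \<Rightarrow> bool" where
  "Ck_on 0 S f \<longleftrightarrow> continuous_on S f"
| "Ck_on (Suc k) S f \<longleftrightarrow> (\<forall>x\<in>S. f differentiable (at x)) \<and>
     (\<forall>v. Ck_on k S (\<lambda>x. frechet_derivative f (at x) v))"

definition smooth_on :: "'a::euclidean_space set \<Rightarrow> ('a \<Rightarrow> 'b::euclidean_space) \<Rightarrow> bool" where
  "smooth_on S f \<longleftrightarrow> (\<forall>k. Ck_on k S f)"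

text \<open>A chart is a domain together with a coordinate map whose values outside the domain are
  irrelevant. Atlases need not be maximal. The model space may be any Euclidean space, so that
  the frame bundle of an \<open>n\<close>-manifold can be modelled on \<open>(real^'n) \<times> (real^'n^'n)\<close>.\<close>

type_synonym ('p, 'e) chart = "'p set \<times> ('p \<Rightarrow> 'e)"
type_synonym ('p, 'e) atlas = "('p, 'e) chart set"

abbreviation cdom :: "('p, 'e) chart \<Rightarrow> 'p set" where "cdom \<equiv> fst"
abbreviation coord :: "('p, 'e) chart \<Rightarrow> 'p \<Rightarrow> 'e" where "coord \<equiv> snd"

definition cinv :: "('p, 'e) chart \<Rightarrow> 'e \<Rightarrow> 'p" where
  "cinv c = inv_into (cdom c) (coord c)"

definition points :: "('p, 'e) atlas \<Rightarrow> 'p set" where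
  "points M = (\<Union>c\<in>M. cdom c)"

definition smooth_atlas :: "('p, 'e::euclidean_space) atlas \<Rightarrow> bool" where
  "smooth_atlas M \<longleftrightarrow>
     (\<forall>c\<in>M. inj_on (coord c) (cdom c) \<and> open (coord c ` cdom c)) \<and>
     (\<forall>c\<in>M. \<forall>d\<in>M. open (coord c ` (cdom c \<inter> cdom d)) \<and>
        smooth_on (coord c ` (cdom c \<inter> cdom d)) (coord d \<circ> cinv c))"

definition mtop :: "('p, 'e::euclidean_space) atlas \<Rightarrow> 'p topology" where
  "mtop M = topology (\<lambda>W. W \<subseteq> points M \<and> (\<forall>c\<in>M. open (coord c ` (W \<inter> cdom c))))"

lemma openin_mtop:
  assumes "smooth_atlas M"
  shows "openin (mtop M) W \<longleftrightarrow> W \<subseteq> points M \<and> (\<forall>c\<in>M. open (coord c ` (W \<inter> cdom c)))"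
proof -
  let ?P = "\<lambda>W. W \<subseteq> points M \<and> (\<forall>c\<in>M. open (coord c ` (W \<inter> cdom c)))"
  have "istopology ?P"
    unfolding istopology_def
  proof (intro conjI allI impI)
    fix S T assume S: "?P S" and T: "?P T"
    show "S \<inter> T \<subseteq> points M" using S by blast
    show "\<forall>c\<in>M. open (coord c ` (S \<inter> T \<inter> cdom c))"
    proof
      fix c assume c: "c \<in> M"
      then have inj: "inj_on (coord c) (cdom c)" using assms by (simp add: smooth_atlas_def)
      have "coord c ` (S \<inter> T \<inter> cdom c) = coord c ` ((S \<inter> cdom c) \<inter> (T \<inter> cdom c))"
        by (rule arg_cong[where f = "image (coord c)"]) blast
      also have "\<dots> = coord c ` (S \<inter> cdom c) \<inter> coord c ` (T \<inter> cdom c)"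
        by (rule inj_on_image_Int[OF inj]) auto
      finally show "open (coord c ` (S \<inter> T \<inter> cdom c))" using S T c by auto
    qed
  next
    fix \<K> assume K: "\<forall>K\<in>\<K>. ?P K"
    show "\<Union>\<K> \<subseteq> points M" using K by blast
    show "\<forall>c\<in>M. open (coord c ` (\<Union>\<K> \<inter> cdom c))"
    proof
      fix c assume "c \<in> M"
      moreover have "coord c ` (\<Union>\<K> \<inter> cdom c) = (\<Union>K\<in>\<K>. coord c ` (K \<inter> cdom c))" by blast
      ultimately show "open (coord c ` (\<Union>\<K> \<inter> cdom c))" using K by auto
    qed
  qed
  then show ?thesis by (simp add: mtop_def)
qed

lemma topspace_mtop:
  assumes "smooth_atlas M"
  shows "topspace (mtop M) = points M"
proof -
  have "openin (mtop M) (points M)"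
    using assms unfolding openin_mtop[OF assms]
  proof (intro conjI ballI)
    fix c assume c: "c \<in> M"
    then have "points M \<inter> cdom c = cdom c" by (auto simp: points_def)
    then show "open (coord c ` (points M \<inter> cdom c))" using c assms by (simp add: smooth_atlas_def)
  qed simp
  then show ?thesis
    using openin_mtop[OF assms] by (metis openin_subset openin_topspace subset_antisym)
qed

definition smooth_manifold :: "('p, 'e::euclidean_space) atlas \<Rightarrow> bool" where
  "smooth_manifold M \<longleftrightarrow>
     smooth_atlas M \<and> Hausdorff_space (mtop M) \<and> second_countable (mtop M)"

definition std_atlas :: "('e, 'e) atlas" where
  "std_atlas = {(UNIV, id)}"

definition smooth_map_on ::
  "('p, 'e::euclidean_space) atlas \<Rightarrow> 'p set \<Rightarrow> ('q, 'f::euclidean_space) atlas \<Rightarrow> ('p \<Rightarrow> 'q) \<Rightarrow> bool"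
where
  "smooth_map_on M U N F \<longleftrightarrow> openin (mtop M) U \<and> F ` U \<subseteq> points N \<and>
     (\<forall>c\<in>M. \<forall>d\<in>N. open (coord c ` (U \<inter> cdom c \<inter> F -` cdom d)) \<and>
        smooth_on (coord c ` (U \<inter> cdom c \<inter> F -` cdom d)) (coord d \<circ> F \<circ> cinv c))"


section \<open>Tangent vectors\<close>

text \<open>A tangent vector at \<open>p\<close> is the family of its coordinate vectors in the charts around \<open>p\<close>,
  transforming by the derivative of the change of coordinates. It is set to \<open>0\<close> on everything
  that is not a chart around \<open>p\<close>, so that the linear structure of the tangent space is pointwise.
  Base points are not recorded in the vectors and are passed separately.\<close>

type_synonym ('p, 'e) tvec = "('p, 'e) chart \<Rightarrow> 'e"
type_synonym ('p, 'e) vfield = "'p \<Rightarrow> ('p, 'e) tvec"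

definition tzero :: "('p, 'e::euclidean_space) tvec" where "tzero = (\<lambda>c. 0)"
definition tadd :: "('p, 'e::euclidean_space) tvec \<Rightarrow> ('p, 'e) tvec \<Rightarrow> ('p, 'e) tvec" where
  "tadd v w = (\<lambda>c. v c + w c)"
definition tdiff :: "('p, 'e::euclidean_space) tvec \<Rightarrow> ('p, 'e) tvec \<Rightarrow> ('p, 'e) tvec" where
  "tdiff v w = (\<lambda>c. v c - w c)"
definition tscale :: "real \<Rightarrow> ('p, 'e::euclidean_space) tvec \<Rightarrow> ('p, 'e) tvec" where
  "tscale r v = (\<lambda>c. r *\<^sub>R v c)"
definition tsum :: "'i set \<Rightarrow> ('i \<Rightarrow> real) \<Rightarrow> ('i \<Rightarrow> ('p, 'e::euclidean_space) tvec) \<Rightarrow> ('p, 'e) tvec" where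
  "tsum I f E = (\<lambda>c. \<Sum>i\<in>I. f i *\<^sub>R E i c)"

definition tspace :: "('p, 'e::euclidean_space) atlas \<Rightarrow> 'p \<Rightarrow> ('p, 'e) tvec set" where
  "tspace M p = {v.
     (\<forall>c. \<not> (c \<in> M \<and> p \<in> cdom c) \<longrightarrow> v c = 0) \<and>
     (\<forall>c\<in>M. \<forall>d\<in>M. p \<in> cdom c \<inter> cdom d \<longrightarrow>
        v d = frechet_derivative (coord d \<circ> cinv c) (at (coord c p)) (v c))}"

text \<open>The choice of the chart is immaterial for tangent vectors.\<close>

definition chart_at :: "('p, 'e) atlas \<Rightarrow> 'p \<Rightarrow> ('p, 'e) chart" where
  "chart_at M p = (SOME c. c \<in> M \<and> p \<in> cdom c)"

definition deriv_along ::
  "('p, 'e::euclidean_space) atlas \<Rightarrow> 'p \<Rightarrow> ('p, 'e) tvec \<Rightarrow> ('p \<Rightarrow> 'b::euclidean_space) \<Rightarrow> 'b" where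
  "deriv_along M p v f = (let c = chart_at M p in
     frechet_derivative (f \<circ> cinv c) (at (coord c p)) (v c))"

definition pushforward ::
  "('p, 'e::euclidean_space) atlas \<Rightarrow> ('q, 'f::euclidean_space) atlas \<Rightarrow> ('p \<Rightarrow> 'q) \<Rightarrow> 'p \<Rightarrow>
   ('p, 'e) tvec \<Rightarrow> ('q, 'f) tvec" where
  "pushforward M N F p v = (\<lambda>d.
     if d \<in> N \<and> F p \<in> cdom d then deriv_along M p v (coord d \<circ> F) else 0)"

definition smooth_vfield_on :: "('p, 'e::euclidean_space) atlas \<Rightarrow> 'p set \<Rightarrow> ('p, 'e) vfield \<Rightarrow> bool" where
  "smooth_vfield_on M U X \<longleftrightarrow> openin (mtop M) U \<and> (\<forall>p\<in>U. X p \<in> tspace M p) \<and>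
     (\<forall>c\<in>M. smooth_on (coord c ` (U \<inter> cdom c)) (\<lambda>x. X (cinv c x) c))"


section \<open>Linear connections and parallel transport\<close>

text \<open>\<open>D p v Y\<close> is the covariant derivative at \<open>p\<close> of the local field \<open>Y\<close> in the direction of the
  vector \<open>v\<close> at \<open>p\<close>. Homogeneity over the reals in \<open>Y\<close> is the case of constant \<open>f\<close>.\<close>

type_synonym ('p, 'e) conn = "'p \<Rightarrow> ('p, 'e) tvec \<Rightarrow> ('p, 'e) vfield \<Rightarrow> ('p, 'e) tvec"

definition linear_connection :: "('p, 'e::euclidean_space) atlas \<Rightarrow> ('p, 'e) conn \<Rightarrow> bool" where
  "linear_connection M D \<longleftrightarrow>
     (\<forall>U Y. smooth_vfield_on M U Y \<longrightarrow>
        (\<forall>p\<in>U. \<forall>v\<in>tspace M p. D p v Y \<in> tspace M p) \<and>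
        (\<forall>p\<in>U. \<forall>v\<in>tspace M p. \<forall>w\<in>tspace M p. D p (tadd v w) Y = tadd (D p v Y) (D p w Y)) \<and>
        (\<forall>p\<in>U. \<forall>v\<in>tspace M p. \<forall>r. D p (tscale r v) Y = tscale r (D p v Y)) \<and>
        (\<forall>Z. smooth_vfield_on M U Z \<longrightarrow> (\<forall>p\<in>U. \<forall>v\<in>tspace M p.
           D p v (\<lambda>q. tadd (Y q) (Z q)) = tadd (D p v Y) (D p v Z))) \<and>
        (\<forall>f::'p \<Rightarrow> real. smooth_map_on M U std_atlas f \<longrightarrow> (\<forall>p\<in>U. \<forall>v\<in>tspace M p.
           D p v (\<lambda>q. tscale (f q) (Y q)) =
             tadd (tscale (deriv_along M p v f) (Y p)) (tscale (f p) (D p v Y)))) \<and>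
        (\<forall>Z. smooth_vfield_on M U Z \<longrightarrow> (\<forall>q\<in>U. Y q = Z q) \<longrightarrow>
           (\<forall>p\<in>U. \<forall>v\<in>tspace M p. D p v Y = D p v Z)) \<and>
        (\<forall>X. smooth_vfield_on M U X \<longrightarrow> smooth_vfield_on M U (\<lambda>p. D p (X p) Y)))"

text \<open>The field on the domain of \<open>c\<close> whose components in the chart \<open>c\<close> are the constants \<open>x\<close>.\<close>

definition const_field :: "('p, 'e::euclidean_space) atlas \<Rightarrow> ('p, 'e) chart \<Rightarrow> 'e \<Rightarrow> ('p, 'e) vfield" where
  "const_field M c x = (\<lambda>p d. if d \<in> M \<and> p \<in> cdom c \<inter> cdom d
     then frechet_derivative (coord d \<circ> cinv c) (at (coord c p)) x else 0)"

definition smooth_curve_on :: "('p, 'e::euclidean_space) atlas \<Rightarrow> real set \<Rightarrow> (real \<Rightarrow> 'p) \<Rightarrow> bool" where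
  "smooth_curve_on M J \<gamma> \<longleftrightarrow> open J \<and> is_interval J \<and> smooth_map_on std_atlas J M \<gamma>"

definition velocity :: "('p, 'e::euclidean_space) atlas \<Rightarrow> (real \<Rightarrow> 'p) \<Rightarrow> real \<Rightarrow> ('p, 'e) tvec" where
  "velocity M \<gamma> t = (\<lambda>c. if c \<in> M \<and> \<gamma> t \<in> cdom c
     then vector_derivative (coord c \<circ> \<gamma>) (at t) else 0)"

text \<open>The equation says \<open>dV^k/dt + \<Gamma>^k_ij (d\<gamma>^i/dt) V^j = 0\<close> in the chart \<open>c\<close>: the last term
  is the covariant derivative of the constant-coefficient field with value \<open>V t\<close>.\<close>

definition parallel_along ::
  "('p, 'e::euclidean_space) atlas \<Rightarrow> ('p, 'e) conn \<Rightarrow> real set \<Rightarrow> (real \<Rightarrow> 'p) \<Rightarrow>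
   (real \<Rightarrow> ('p, 'e) tvec) \<Rightarrow> bool" where
  "parallel_along M D J \<gamma> V \<longleftrightarrow> (\<forall>t\<in>J. V t \<in> tspace M (\<gamma> t) \<and>
     (\<forall>c\<in>M. \<gamma> t \<in> cdom c \<longrightarrow> (\<lambda>s. V s c) differentiable (at t) \<and>
        vector_derivative (\<lambda>s. V s c) (at t)
          + D (\<gamma> t) (velocity M \<gamma> t) (const_field M c (V t c)) c = 0))"

definition parallel_transport ::
  "('p, 'e::euclidean_space) atlas \<Rightarrow> ('p, 'e) conn \<Rightarrow> real set \<Rightarrow> (real \<Rightarrow> 'p) \<Rightarrow> real \<Rightarrow> real \<Rightarrow>
   ('p, 'e) tvec \<Rightarrow> ('p, 'e) tvec \<Rightarrow> bool" where
  "parallel_transport M D J \<gamma> s t v w \<longleftrightarrow>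
     s \<in> J \<and> t \<in> J \<and> (\<exists>V. parallel_along M D J \<gamma> V \<and> V s = v \<and> V t = w)"

definition transport_preserves ::
  "('p, 'e::euclidean_space) atlas \<Rightarrow> ('p, 'e) conn \<Rightarrow> ('p \<Rightarrow> ('p, 'e) tvec set) \<Rightarrow> bool" where
  "transport_preserves M D S \<longleftrightarrow> (\<forall>J \<gamma> s t v w. smooth_curve_on M J \<gamma> \<longrightarrow>
     parallel_transport M D J \<gamma> s t v w \<longrightarrow> v \<in> S (\<gamma> s) \<longrightarrow> w \<in> S (\<gamma> t))"

definition is_frame ::
  "('p, 'e::euclidean_space) atlas \<Rightarrow> 'i set \<Rightarrow> ('i \<Rightarrow> ('p, 'e) vfield) \<Rightarrow> bool" where
  "is_frame M I E \<longleftrightarrow> finite I \<and> (\<forall>i\<in>I. smooth_vfield_on M (points M) (E i)) \<and>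
     (\<forall>p\<in>points M. \<forall>w\<in>tspace M p.
        \<exists>!f. (\<forall>i. i \<notin> I \<longrightarrow> f i = 0) \<and> w = tsum I f (\<lambda>i. E i p))"

definition frame_coeff ::
  "'i set \<Rightarrow> ('i \<Rightarrow> ('p, 'e::euclidean_space) vfield) \<Rightarrow> 'p \<Rightarrow> ('p, 'e) tvec \<Rightarrow> 'i \<Rightarrow> real" where
  "frame_coeff I E p w = (THE f. (\<forall>i. i \<notin> I \<longrightarrow> f i = 0) \<and> w = tsum I f (\<lambda>i. E i p))"


section \<open>The frame bundle\<close>

text \<open>A frame at \<open>p\<close> is a pair \<open>(p, u)\<close> with \<open>u\<close> a linear isomorphism from \<open>real^'n\<close> to the tangent
  space at \<open>p\<close>; the projection \<open>\<pi>\<close> is \<open>fst\<close>.\<close>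

type_synonym ('p, 'n) frame = "'p \<times> (real^'n \<Rightarrow> ('p, real^'n) tvec)"
type_synonym 'n fmodel = "(real^'n) \<times> (real^'n^'n)"
type_synonym ('p, 'n) ltvec = "(('p, 'n) frame, 'n fmodel) tvec"
type_synonym ('p, 'n) gl_form = "('p, 'n) frame \<Rightarrow> ('p, 'n) ltvec \<Rightarrow> real^'n^'n"

definition frames :: "('p, real^'n) atlas \<Rightarrow> ('p, 'n) frame set" where
  "frames M = {(p, u). p \<in> points M \<and> (\<forall>c. linear (\<lambda>\<xi>. u \<xi> c)) \<and> bij_betw u UNIV (tspace M p)}"

text \<open>Coordinates of \<open>(p, u)\<close>: the coordinates of \<open>p\<close>, and the matrix whose columns are the
  components of the vectors of the frame.\<close>

definition frame_chart ::
  "('p, real^'n) atlas \<Rightarrow> ('p, real^'n) chart \<Rightarrow> (('p, 'n) frame, 'n fmodel) chart" where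
  "frame_chart M c =
     ({w \<in> frames M. fst w \<in> cdom c}, \<lambda>w. (coord c (fst w), matrix (\<lambda>\<xi>. snd w \<xi> c)))"

definition frame_bundle ::
  "('p, real^'n) atlas \<Rightarrow> (('p, 'n) frame, 'n fmodel) atlas" where
  "frame_bundle M = frame_chart M ` M"

definition proj :: "('p, real^'n) atlas \<Rightarrow> ('p, 'n) frame \<Rightarrow> ('p, 'n) ltvec \<Rightarrow> ('p, real^'n) tvec" where
  "proj M = pushforward (frame_bundle M) M fst"

definition right_act :: "real^'n^'n \<Rightarrow> ('p, 'n) frame \<Rightarrow> ('p, 'n) frame" where
  "right_act g w = (fst w, \<lambda>\<xi>. snd w (g *v \<xi>))"

text \<open>The fundamental field of \<open>A\<close> at \<open>u\<close> is the image of \<open>A\<close> under the differential at the identity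
  of the orbit map sending \<open>g\<close> to \<open>u g\<close>.\<close>

definition fundamental ::
  "('p, real^'n) atlas \<Rightarrow> real^'n^'n \<Rightarrow> (('p, 'n) frame, 'n fmodel) vfield" where
  "fundamental M A = (\<lambda>u d. if d \<in> frame_bundle M \<and> u \<in> cdom d
     then frechet_derivative (\<lambda>g. coord d (right_act g u)) (at (mat 1)) A else 0)"

definition canonical_form :: "('p, real^'n) atlas \<Rightarrow> ('p, 'n) frame \<Rightarrow> ('p, 'n) ltvec \<Rightarrow> real^'n" where
  "canonical_form M u X = inv (snd u) (proj M u X)"

definition horizontal :: "('p, real^'n) atlas \<Rightarrow> ('p, 'n) gl_form \<Rightarrow> ('p, 'n) frame \<Rightarrow> ('p, 'n) ltvec set" where
  "horizontal M \<omega> u = {X \<in> tspace (frame_bundle M) u. \<omega> u X = 0}"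

definition vertical :: "('p, real^'n) atlas \<Rightarrow> ('p, 'n) frame \<Rightarrow> ('p, 'n) ltvec set" where
  "vertical M u = {X \<in> tspace (frame_bundle M) u. proj M u X = tzero}"

text \<open>The last clause ties the form to the covariant derivative: for a field \<open>Y\<close> on an open set,
  the function sending a frame \<open>w\<close> to the components of \<open>Y\<close> in \<open>w\<close> has, in a horizontal direction
  \<open>Z\<close>, as derivative the components of the covariant derivative of \<open>Y\<close> along the projection
  of \<open>Z\<close>.\<close>

definition is_connection_form ::
  "('p, real^'n) atlas \<Rightarrow> ('p, real^'n) conn \<Rightarrow> ('p, 'n) gl_form \<Rightarrow> bool" where
  "is_connection_form M D \<omega> \<longleftrightarrow> (let L = frame_bundle M in
     (\<forall>u\<in>frames M. \<forall>X\<in>tspace L u. \<forall>Z\<in>tspace L u. \<omega> u (tadd X Z) = \<omega> u X + \<omega> u Z) \<and>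
     (\<forall>u\<in>frames M. \<forall>X\<in>tspace L u. \<forall>r. \<omega> u (tscale r X) = r *\<^sub>R \<omega> u X) \<and>
     (\<forall>U X. smooth_vfield_on L U X \<longrightarrow> smooth_map_on L U std_atlas (\<lambda>u. \<omega> u (X u))) \<and>
     (\<forall>u\<in>frames M. \<forall>A. \<omega> u (fundamental M A u) = A) \<and>
     (\<forall>u\<in>frames M. \<forall>X\<in>tspace L u. \<forall>g. invertible g \<longrightarrow>
        \<omega> (right_act g u) (pushforward L L (right_act g) u X) = matrix_inv g ** \<omega> u X ** g) \<and>
     (\<forall>u\<in>frames M. \<forall>Z\<in>horizontal M \<omega> u. \<forall>U Y. smooth_vfield_on M U Y \<longrightarrow> fst u \<in> U \<longrightarrow>
        D (fst u) (proj M u Z) Y =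
          snd u (deriv_along L u Z (\<lambda>w. inv (snd w) (Y (fst w))))))"

definition hor :: "('p, real^'n) atlas \<Rightarrow> ('p, 'n) gl_form \<Rightarrow> ('p, 'n) frame \<Rightarrow> ('p, 'n) ltvec \<Rightarrow> ('p, 'n) ltvec" where
  "hor M \<omega> u X = (THE Y. Y \<in> horizontal M \<omega> u \<and> tdiff X Y \<in> vertical M u)"

definition ver :: "('p, real^'n) atlas \<Rightarrow> ('p, 'n) gl_form \<Rightarrow> ('p, 'n) frame \<Rightarrow> ('p, 'n) ltvec \<Rightarrow> ('p, 'n) ltvec" where
  "ver M \<omega> u X = tdiff X (hor M \<omega> u X)"

definition std_horizontal ::
  "('p, real^'n) atlas \<Rightarrow> ('p, 'n) gl_form \<Rightarrow> real^'n \<Rightarrow> (('p, 'n) frame, 'n fmodel) vfield" where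
  "std_horizontal M \<omega> \<xi> = (\<lambda>u. THE X. X \<in> horizontal M \<omega> u \<and> canonical_form M u X = \<xi>)"

definition hlift ::
  "('p, real^'n) atlas \<Rightarrow> ('p, 'n) gl_form \<Rightarrow> ('p, real^'n) vfield \<Rightarrow>
   (('p, 'n) frame, 'n fmodel) vfield" where
  "hlift M \<omega> Y = (\<lambda>u. THE X. X \<in> horizontal M \<omega> u \<and> proj M u X = Y (fst u))"


section \<open>Lifts of a linear connection\<close>

definition special_lift_condition ::
  "('p, real^'n) atlas \<Rightarrow> ('p, real^'n) conn \<Rightarrow> ('p, 'n) gl_form \<Rightarrow>
   (('p, 'n) frame, 'n fmodel) conn \<Rightarrow> bool" where
  "special_lift_condition M Dt \<omega> D \<longleftrightarrow>
     (\<forall>Y. smooth_vfield_on M (points M) Y \<longrightarrow>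
        (\<forall>u\<in>frames M. \<forall>Z\<in>tspace (frame_bundle M) u.
           proj M u (D u Z (hlift M \<omega> Y)) = Dt (fst u) (proj M u Z) Y))"

definition condition_a ::
  "('p, real^'n) atlas \<Rightarrow> ('p, 'n) gl_form \<Rightarrow> (('p, 'n) frame, 'n fmodel) conn \<Rightarrow> bool" where
  "condition_a M \<omega> D \<longleftrightarrow> transport_preserves (frame_bundle M) D (horizontal M \<omega>)"

definition condition_b ::
  "('p, real^'n) atlas \<Rightarrow> (('p, 'n) frame, 'n fmodel) conn \<Rightarrow> bool" where
  "condition_b M D \<longleftrightarrow> transport_preserves (frame_bundle M) D (vertical M)"

definition condition_c ::
  "('p, real^'n) atlas \<Rightarrow> ('p, 'n) gl_form \<Rightarrow> (('p, 'n) frame, 'n fmodel) conn \<Rightarrow> bool" where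
  "condition_c M \<omega> D \<longleftrightarrow> (\<forall>u\<in>frames M. \<forall>X\<in>tspace (frame_bundle M) u. \<forall>A.
     \<omega> u (D u X (fundamental M A)) = 0)"

definition basis_family :: "nat \<Rightarrow> (nat \<Rightarrow> 'v::real_vector) \<Rightarrow> bool" where
  "basis_family m a \<longleftrightarrow> inj_on a {1..m} \<and> independent (a ` {1..m}) \<and> span (a ` {1..m}) = UNIV"

text \<open>The frame on the frame bundle: \<open>Inl i\<close> indexes the fundamental field of \<open>A i\<close>, and \<open>Inr j\<close> the
  standard horizontal field of \<open>\<xi> j\<close>.\<close>

definition lindex :: "'n::finite itself \<Rightarrow> (nat + nat) set" where
  "lindex _ = {1..CARD('n)^2} <+> {1..CARD('n)}"

definition lframe ::
  "('p, real^'n) atlas \<Rightarrow> ('p, 'n) gl_form \<Rightarrow> (nat \<Rightarrow> real^'n^'n) \<Rightarrow> (nat \<Rightarrow> real^'n) \<Rightarrow>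
   nat + nat \<Rightarrow> (('p, 'n) frame, 'n fmodel) vfield" where
  "lframe M \<omega> A \<xi> a = (case a of Inl i \<Rightarrow> fundamental M (A i) | Inr j \<Rightarrow> std_horizontal M \<omega> (\<xi> j))"

text \<open>With \<open>E\<close> the frame above and \<open>P\<close> the horizontal or vertical component, these are the
  components with respect to \<open>E\<close> of \<open>P (\<nabla>\<^sub>X E\<^sub>b)\<close> for \<open>X = E\<^sub>a\<close>. Taking \<open>P = h, v\<close> and \<open>b\<close> of the form
  \<open>Inr j\<close> or \<open>Inl i\<close> gives the four sets of coefficients; the components \<open>c\<close> of the wrong type,
  which are identically zero, are included.\<close>

definition conn_coeff ::
  "('p, real^'n) atlas \<Rightarrow> ('p, 'n) gl_form \<Rightarrow> (nat \<Rightarrow> real^'n^'n) \<Rightarrow> (nat \<Rightarrow> real^'n) \<Rightarrow>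
   (('p, 'n) frame, 'n fmodel) conn \<Rightarrow>
   (('p, 'n) frame \<Rightarrow> ('p, 'n) ltvec \<Rightarrow> ('p, 'n) ltvec) \<Rightarrow>
   nat + nat \<Rightarrow> nat + nat \<Rightarrow> nat + nat \<Rightarrow> ('p, 'n) frame \<Rightarrow> real" where
  "conn_coeff M \<omega> A \<xi> D P b a c u =
     frame_coeff (lindex TYPE('n)) (lframe M \<omega> A \<xi>) u
       (P u (D u (lframe M \<omega> A \<xi> a u) (lframe M \<omega> A \<xi> b))) c"

definition coeffs_vanish ::
  "('p, real^'n) atlas \<Rightarrow> ('p, 'n) gl_form \<Rightarrow> (nat \<Rightarrow> real^'n^'n) \<Rightarrow> (nat \<Rightarrow> real^'n) \<Rightarrow>
   (('p, 'n) frame, 'n fmodel) conn \<Rightarrow>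
   (('p, 'n) frame \<Rightarrow> ('p, 'n) ltvec \<Rightarrow> ('p, 'n) ltvec) \<Rightarrow> (nat + nat) set \<Rightarrow> bool" where
  "coeffs_vanish M \<omega> A \<xi> D P K \<longleftrightarrow>
     (\<forall>b\<in>K. \<forall>a\<in>lindex TYPE('n). \<forall>c\<in>lindex TYPE('n). \<forall>u\<in>frames M.
        conn_coeff M \<omega> A \<xi> D P b a c u = 0)"

end

theory Submission
  imports Defs
begin

text \<open>The frame bundle is parallelizable. The connection form \<open>\<omega>\<close> and the canonical form \<open>\<theta>\<close> together
  identify every tangent space \<open>T\<^sub>u L(M)\<close> with the fixed vector space \<open>F = gl(n) \<times> \<real>\<^sup>n\<close>; the inverse
  sends \<open>(A, x)\<close> to \<open>A\<^sup>* + B(x)\<close>. Under this identification the frame of the theorem is a basis of \<open>F\<close>,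
  \<open>h\<close> and \<open>v\<close> are the projections to the two factors, and \<open>\<nabla>\<close> becomes \<open>\<nabla>\<^sub>X f = X(f) + \<Lambda>(X) f\<close> for
  functions \<open>f\<close> with values in \<open>F\<close>, where \<open>\<Lambda>(X)\<close> is an endomorphism of \<open>F\<close> depending linearly on \<open>X\<close>.
  The four sets of coefficients are the four blocks of \<open>\<Lambda>\<close>.

  Conditions (a) and (b). Along a curve \<open>\<gamma>\<close>, a parallel field is a solution of the linear equation
  \<open>f' = - \<Lambda>(\<gamma>') f\<close>. Let \<open>W\<close> be the kernel of a projection \<open>P\<close> of \<open>F\<close>. Parallel transport preserves \<open>W\<close> along
  all curves exactly if every \<open>\<Lambda>(X)\<close> maps \<open>W\<close> to itself (\<open>transport_preserves_iff\<close>). If \<open>W\<close> is preserved,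
  take a curve with initial velocity \<open>X\<close>, a local solution with \<open>f(0) = w\<close> in \<open>W\<close>, and differentiate
  \<open>P f = 0\<close> at \<open>0\<close>. If \<open>\<Lambda>(X) W \<subseteq> W\<close>, then \<open>P f\<close> satisfies a homogeneous linear equation by itself, and it
  vanishes identically if it vanishes at one time. Horizontality is \<open>W = 0 \<times> \<real>\<^sup>n\<close>, so condition (a) says
  \<open>\<omega>(\<nabla>\<^sub>X B(x)) = 0\<close>; verticality is \<open>W = gl(n) \<times> 0\<close>, so condition (b) says \<open>\<theta>(\<nabla>\<^sub>X A\<^sup>*) = 0\<close>. Since \<open>\<Lambda>\<close> is
  bilinear, these statements, as well as condition (c), can be tested on the frame.

  The special condition. A field \<open>Y\<close> on \<open>M\<close> is the same as the function \<open>f(u) = u\<^sup>-\<^sup>1 Y\<close> on the frame bundle,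
  and its horizontal lift is \<open>B(f)\<close>. By the Leibniz rule \<open>\<theta>(\<nabla>\<^sub>Z Y\<^sup>h) = Z(f) + \<theta>(\<nabla>\<^sub>Z B(x))\<close> with
  \<open>x = f(u)\<close> (\<open>canonical_form_conn_hlift\<close>). On the other hand the given connection of \<open>M\<close>, read in the frame
  \<open>u\<close> in the direction \<open>\<pi>\<^sub>*Z\<close>, is \<open>Z(f) + \<omega>(Z) x\<close> (\<open>base_connection_components\<close>): for horizontal \<open>Z\<close> this
  is how \<open>\<omega>\<close> belongs to that connection, and for \<open>Z = A\<^sup>*\<close> both terms cancel because \<open>f(ug) = g\<^sup>-\<^sup>1 f(u)\<close>.
  The derivatives of \<open>f\<close> drop out, so the special condition says \<open>\<theta>(\<nabla>\<^sub>Z B(x)) = \<omega>(Z) x\<close> for all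
  values \<open>x = f(u)\<close>. Every \<open>x\<close> is such a value: a tangent vector of a Hausdorff manifold extends to a
  global field by means of a bump function (\<open>ex_global_smooth_vfield\<close>). For \<open>Z = B\<^sub>i\<close> and \<open>Z = A\<^sub>i\<^sup>*\<close> these
  are the coefficients of part (i).\<close>

section \<open>Smooth maps between Euclidean spaces\<close>

lemma frechet_derivative_cong_open:
  assumes "open S" "x \<in> S" "\<And>y. y \<in> S \<Longrightarrow> f y = g y"
  shows "frechet_derivative f (at x) = frechet_derivative g (at x)"
proof -
  have "(f has_derivative f') (at x) \<longleftrightarrow> (g has_derivative f') (at x)" for f'
    using has_derivative_transform_within_open[OF _ assms(1,2)] assms(3) by metis
  then show ?thesis by (simp add: frechet_derivative_def)
qed

lemma differentiable_cong_open:
  assumes "open S" "x \<in> S" "\<And>y. y \<in> S \<Longrightarrow> f y = g y" "f differentiable (at x)"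
  shows "g differentiable (at x)"
  using has_derivative_transform_within_open[OF _ assms(1,2), of f _ UNIV g] assms(3,4)
  unfolding differentiable_def by blast

lemma frechet_derivative_eqI: "(f has_derivative f') (at x) \<Longrightarrow> frechet_derivative f (at x) = f'"
  using frechet_derivative_at by metis

lemma Ck_on_cong:
  assumes "open S" "\<And>x. x \<in> S \<Longrightarrow> f x = g x" "Ck_on k S f"
  shows "Ck_on k S g"
  using assms(2,3)
proof (induction k arbitrary: f g)
  case 0
  then show ?case using continuous_on_cong[OF refl, of S f g] by auto
next
  case (Suc k)
  have "g differentiable (at x)" if "x \<in> S" for x
    using differentiable_cong_open[OF assms(1) that, of f g] Suc.prems that by auto
  moreover have "Ck_on k S (\<lambda>x. frechet_derivative g (at x) v)" for v
    by (rule Suc.IH[of "\<lambda>x. frechet_derivative f (at x) v"])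
      (use Suc.prems frechet_derivative_cong_open[OF assms(1), of _ f g] in auto)
  ultimately show ?case by simp
qed

lemma Ck_on_subset: "Ck_on k S f \<Longrightarrow> T \<subseteq> S \<Longrightarrow> Ck_on k T f"
  by (induction k arbitrary: f) (auto intro: continuous_on_subset)

lemma Ck_on_SucD: "Ck_on (Suc k) S f \<Longrightarrow> Ck_on k S f"
proof (induction k arbitrary: f)
  case 0
  then show ?case
    by (auto intro!: continuous_at_imp_continuous_on differentiable_imp_continuous_within)
next
  case (Suc k)
  then show ?case by simp
qed

lemma Ck_on_SucI:
  assumes "open S" "\<And>x. x \<in> S \<Longrightarrow> (f has_derivative f' x) (at x)" "\<And>v. Ck_on k S (\<lambda>x. f' x v)"
  shows "Ck_on (Suc k) S f"
proof -
  have "frechet_derivative f (at x) = f' x" if "x \<in> S" for x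
    by (rule frechet_derivative_eqI) (use assms that in auto)
  then have "Ck_on k S (\<lambda>x. frechet_derivative f (at x) v)" for v
    by (intro Ck_on_cong[OF assms(1) _ assms(3)]) auto
  then show ?thesis using assms(2) by (auto simp: differentiable_def)
qed

lemma Ck_on_Suc_has_derivative:
  "Ck_on (Suc k) S f \<Longrightarrow> x \<in> S \<Longrightarrow> (f has_derivative frechet_derivative f (at x)) (at x)"
  by (simp add: frechet_derivative_works)

lemma Ck_on_locally:
  assumes "\<And>x. x \<in> S \<Longrightarrow> \<exists>T. open T \<and> x \<in> T \<and> Ck_on k T f"
  shows "Ck_on k S f"
  using assms
proof (induction k arbitrary: f)
  case 0
  have "isCont f x" if "x \<in> S" for x
    using 0[OF that] by (auto simp: continuous_on_eq_continuous_at)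
  then show ?case by (auto intro: continuous_at_imp_continuous_on)
next
  case (Suc k)
  have "Ck_on k S (\<lambda>x. frechet_derivative f (at x) v)" for v
    by (rule Suc.IH) (use Suc.prems in fastforce)
  then show ?case using Suc.prems by fastforce
qed

lemma Ck_on_const: "Ck_on k S (\<lambda>x. c)"
  by (induction k arbitrary: c) simp_all

lemma Ck_on_bounded_linear_self:
  assumes "bounded_linear L"
  shows "Ck_on k S L"
proof (cases k)
  case 0
  then show ?thesis using assms by (simp add: linear_continuous_on)
next
  case (Suc k')
  have "frechet_derivative L (at x) = L" for x
    using frechet_derivative_eqI bounded_linear_imp_has_derivative[OF assms] by metis
  moreover have "L differentiable (at x)" for x
    using assms bounded_linear_imp_differentiable by blast
  ultimately show ?thesis using Suc by (simp add: Ck_on_const)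
qed

lemma Ck_on_bounded_linear:
  assumes "open S" "bounded_linear L" "Ck_on k S f"
  shows "Ck_on k S (\<lambda>x. L (f x))"
  using assms(3)
proof (induction k arbitrary: f)
  case 0
  then show ?case using assms by (auto intro: bounded_linear.continuous_on)
next
  case (Suc k)
  show ?case
    by (rule Ck_on_SucI[OF assms(1), where f' = "\<lambda>x v. L (frechet_derivative f (at x) v)"])
      (use Suc in \<open>auto intro!: bounded_linear.has_derivative[OF assms(2)]
          simp: frechet_derivative_works\<close>)
qed

lemma Ck_on_add:
  assumes "open S" "Ck_on k S f" "Ck_on k S g"
  shows "Ck_on k S (\<lambda>x. f x + g x)"
  using assms(2,3)
proof (induction k arbitrary: f g)
  case 0
  then show ?case by (auto intro: continuous_on_add)
next
  case (Suc k)
  show ?case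
    by (rule Ck_on_SucI[OF assms(1), where
          f' = "\<lambda>x v. frechet_derivative f (at x) v + frechet_derivative g (at x) v"])
      (use Suc in \<open>auto intro!: has_derivative_add simp: frechet_derivative_works\<close>)
qed

lemma Ck_on_sum:
  assumes "open S" "\<And>i. i \<in> I \<Longrightarrow> Ck_on k S (f i)"
  shows "Ck_on k S (\<lambda>x. \<Sum>i\<in>I. f i x)"
  using assms(2)
  by (induction I rule: infinite_finite_induct) (auto intro: Ck_on_const Ck_on_add[OF assms(1)])

lemma Ck_on_bilinear:
  assumes "bounded_bilinear B" "open S" "Ck_on k S f" "Ck_on k S g"
  shows "Ck_on k S (\<lambda>x. B (f x) (g x))"
  using assms(3,4)
proof (induction k arbitrary: f g)
  case 0
  then show ?case using bounded_bilinear.continuous_on[OF assms(1)] by auto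
next
  case (Suc k)
  show ?case
  proof (rule Ck_on_SucI[OF assms(2), where
        f' = "\<lambda>x v. B (f x) (frechet_derivative g (at x) v) + B (frechet_derivative f (at x) v) (g x)"])
    fix x assume "x \<in> S"
    then show "((\<lambda>x. B (f x) (g x)) has_derivative (\<lambda>v. B (f x) (frechet_derivative g (at x) v) +
        B (frechet_derivative f (at x) v) (g x))) (at x)"
      using Suc.prems by (intro bounded_bilinear.FDERIV[OF assms(1)] Ck_on_Suc_has_derivative) auto
  next
    fix v
    have "Ck_on k S f" "Ck_on k S g" using Suc.prems by (auto intro: Ck_on_SucD)
    then show "Ck_on k S (\<lambda>x. B (f x) (frechet_derivative g (at x) v) +
        B (frechet_derivative f (at x) v) (g x))"
      using Suc.prems by (intro Ck_on_add[OF assms(2)] Suc.IH) auto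
  qed
qed

lemma linear_basis_expansion:
  fixes L :: "'a::euclidean_space \<Rightarrow> 'b::real_vector"
  assumes "linear L"
  shows "L v = (\<Sum>b\<in>Basis. (v \<bullet> b) *\<^sub>R L b)"
proof -
  have "L v = L (\<Sum>b\<in>Basis. (v \<bullet> b) *\<^sub>R b)" by (simp only: euclidean_representation)
  also have "\<dots> = (\<Sum>b\<in>Basis. (v \<bullet> b) *\<^sub>R L b)"
    by (simp only: linear_sum[OF assms] linear_scale[OF assms])
  finally show ?thesis .
qed

text \<open>The chain rule gives the derivative \<open>v \<mapsto> Dg(f x)(Df(x) v)\<close>. It is expanded over a basis of the
  middle space because the induction hypothesis covers only derivatives of \<open>g\<close> in fixed directions.\<close>

lemma Ck_on_compose:
  assumes "open S" "open T" "f ` S \<subseteq> T" "Ck_on k S f" "Ck_on k T g"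
  shows "Ck_on k S (\<lambda>x. g (f x))"
  using assms(4,5)
proof (induction k arbitrary: g)
  case 0
  then show ?case using assms(3) by (auto intro: continuous_on_compose2)
next
  case (Suc k)
  show ?case
  proof (rule Ck_on_SucI[OF assms(1), where f' = "\<lambda>x v. \<Sum>b\<in>Basis.
        (frechet_derivative f (at x) v \<bullet> b) *\<^sub>R frechet_derivative g (at (f x)) b"])
    fix x assume x: "x \<in> S"
    have g: "(g has_derivative frechet_derivative g (at (f x))) (at (f x))"
      by (rule Ck_on_Suc_has_derivative[OF Suc.prems(2)]) (use x assms(3) in auto)
    have "(g \<circ> f has_derivative frechet_derivative g (at (f x)) \<circ> frechet_derivative f (at x)) (at x)"
      by (rule diff_chain_at[OF Ck_on_Suc_has_derivative[OF Suc.prems(1) x] g])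
    then show "((\<lambda>x. g (f x)) has_derivative (\<lambda>v. \<Sum>b\<in>Basis.
        (frechet_derivative f (at x) v \<bullet> b) *\<^sub>R frechet_derivative g (at (f x)) b)) (at x)"
      unfolding o_def by (subst linear_basis_expansion[OF has_derivative_linear[OF g], symmetric])
  next
    fix v
    have f: "Ck_on k S f" using Suc.prems by (auto intro: Ck_on_SucD)
    show "Ck_on k S (\<lambda>x. \<Sum>b\<in>Basis.
        (frechet_derivative f (at x) v \<bullet> b) *\<^sub>R frechet_derivative g (at (f x)) b)"
      using Suc.prems
      by (intro Ck_on_sum[OF assms(1)] Ck_on_bilinear[OF bounded_bilinear_scaleR assms(1)]
          Suc.IH[OF f] Ck_on_bounded_linear[OF assms(1) bounded_linear_inner_left]) auto
  qed
qed

lemma smooth_on_cong: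
  "open S \<Longrightarrow> (\<And>x. x \<in> S \<Longrightarrow> f x = g x) \<Longrightarrow> smooth_on S f \<Longrightarrow> smooth_on S g"
  unfolding smooth_on_def using Ck_on_cong by blast

lemma smooth_on_subset: "smooth_on S f \<Longrightarrow> T \<subseteq> S \<Longrightarrow> smooth_on T f"
  unfolding smooth_on_def using Ck_on_subset by blast

lemma smooth_on_locally:
  assumes "\<And>x. x \<in> S \<Longrightarrow> \<exists>T. open T \<and> x \<in> T \<and> smooth_on T f"
  shows "smooth_on S f"
  unfolding smooth_on_def
proof
  fix k
  show "Ck_on k S f" by (rule Ck_on_locally) (use assms in \<open>auto simp: smooth_on_def\<close>)
qed

lemma smooth_on_const: "smooth_on S (\<lambda>x. c)"
  by (simp add: smooth_on_def Ck_on_const)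

lemma smooth_on_bounded_linear_self: "bounded_linear L \<Longrightarrow> smooth_on S L"
  by (simp add: smooth_on_def Ck_on_bounded_linear_self)

lemma smooth_on_bounded_linear:
  "open S \<Longrightarrow> bounded_linear L \<Longrightarrow> smooth_on S f \<Longrightarrow> smooth_on S (\<lambda>x. L (f x))"
  by (simp add: smooth_on_def Ck_on_bounded_linear)

lemma smooth_on_add:
  "open S \<Longrightarrow> smooth_on S f \<Longrightarrow> smooth_on S g \<Longrightarrow> smooth_on S (\<lambda>x. f x + g x)"
  by (simp add: smooth_on_def Ck_on_add)

lemma smooth_on_sum:
  "open S \<Longrightarrow> (\<And>i. i \<in> I \<Longrightarrow> smooth_on S (f i)) \<Longrightarrow> smooth_on S (\<lambda>x. \<Sum>i\<in>I. f i x)"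
  by (simp add: smooth_on_def Ck_on_sum)

lemma smooth_on_bilinear:
  "bounded_bilinear B \<Longrightarrow> open S \<Longrightarrow> smooth_on S f \<Longrightarrow> smooth_on S g \<Longrightarrow>
    smooth_on S (\<lambda>x. B (f x) (g x))"
  by (simp add: smooth_on_def Ck_on_bilinear)

lemmas smooth_on_scaleR = smooth_on_bilinear[OF bounded_bilinear_scaleR]

lemma smooth_on_compose:
  "smooth_on T g \<Longrightarrow> smooth_on S f \<Longrightarrow> open S \<Longrightarrow> open T \<Longrightarrow> f ` S \<subseteq> T \<Longrightarrow>
    smooth_on S (\<lambda>x. g (f x))"
  by (simp add: smooth_on_def Ck_on_compose)

lemma smooth_on_has_derivative:
  assumes "smooth_on S f" "x \<in> S"
  shows "(f has_derivative frechet_derivative f (at x)) (at x)"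
  using assms Ck_on_Suc_has_derivative unfolding smooth_on_def by blast

lemma smooth_on_differentiable: "smooth_on S f \<Longrightarrow> x \<in> S \<Longrightarrow> f differentiable (at x)"
  using smooth_on_has_derivative differentiable_def by blast

lemma smooth_on_frechet_derivative:
  "smooth_on S f \<Longrightarrow> smooth_on S (\<lambda>x. frechet_derivative f (at x) v)"
  unfolding smooth_on_def using Ck_on.simps(2) by blast

lemma smooth_on_continuous_on: "smooth_on S f \<Longrightarrow> continuous_on S f"
  unfolding smooth_on_def using Ck_on.simps(1) by blast

lemma smooth_on_componentwise:
  fixes f :: "'a::euclidean_space \<Rightarrow> 'b::euclidean_space"
  assumes "open S" "\<And>b. b \<in> Basis \<Longrightarrow> smooth_on S (\<lambda>x. f x \<bullet> b)"
  shows "smooth_on S f"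
proof -
  have "smooth_on S (\<lambda>x. \<Sum>b\<in>Basis. (f x \<bullet> b) *\<^sub>R b)"
    by (intro smooth_on_sum smooth_on_bounded_linear[OF _ bounded_linear_scaleR_left] assms)
  then show ?thesis by (simp add: euclidean_representation)
qed

lemma smooth_on_Pair:
  assumes "open S" "smooth_on S f" "smooth_on S g"
  shows "smooth_on S (\<lambda>x. (f x, g x))"
proof -
  have "smooth_on S (\<lambda>x. (f x, 0) + (0, g x))"
    by (intro smooth_on_add[OF assms(1)]
        smooth_on_bounded_linear[OF assms(1) _ assms(2), where L = "\<lambda>y. (y, 0)"]
        smooth_on_bounded_linear[OF assms(1) _ assms(3), where L = "\<lambda>y. (0, y)"]
        bounded_linear_Pair bounded_linear_ident bounded_linear_zero)
  then show ?thesis by simp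
qed

subsection \<open>Bump functions\<close>

text \<open>The functions \<open>P(1/t) exp(-1/t)\<close> with an arbitrary polynomial \<open>P\<close>: unlike \<open>exp(-1/t)\<close> alone, this
  family is closed under differentiation.\<close>

definition exp_tail :: "real poly \<Rightarrow> real \<Rightarrow> real" where
  "exp_tail P t = (if t > 0 then poly P (inverse t) * exp (- inverse t) else 0)"

lemma exp_tail_tendsto_0: "(exp_tail P \<longlongrightarrow> 0) (at 0)"
proof -
  have "((\<lambda>s. poly P s * exp (- s)) \<longlongrightarrow> 0) at_top"
  proof (induction P)
    case 0
    then show ?case by simp
  next
    case (pCons a P)
    have *: "((\<lambda>s. coeff Q k * (s ^ k / exp s)) \<longlongrightarrow> 0) at_top" for Q :: "real poly" and k
      by (rule tendsto_mult_right_zero[OF tendsto_power_div_exp_0])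
    have "((\<lambda>s. \<Sum>k\<le>degree (pCons a P). coeff (pCons a P) k * (s ^ k / exp s)) \<longlongrightarrow> 0) at_top"
      by (rule tendsto_null_sum) (rule *)
    moreover have "poly (pCons a P) s * exp (- s) =
        (\<Sum>k\<le>degree (pCons a P). coeff (pCons a P) k * (s ^ k / exp s))" for s
      by (subst poly_altdef) (simp add: exp_minus sum_distrib_right divide_inverse mult.assoc
          del: degree_pCons_eq_if)
    ultimately show ?case by simp
  qed
  then have "((\<lambda>t. poly P (inverse t) * exp (- inverse t)) \<longlongrightarrow> 0) (at_right 0)"
    by (rule filterlim_compose[OF _ filterlim_inverse_at_top_right])
  then have "(exp_tail P \<longlongrightarrow> 0) (at_right 0)"
    by (rule Lim_transform_eventually)
      (auto simp: exp_tail_def eventually_at_filter)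
  moreover have "(exp_tail P \<longlongrightarrow> 0) (at_left 0)"
    by (rule tendsto_eventually) (auto simp: exp_tail_def eventually_at_filter)
  ultimately show ?thesis by (simp add: filterlim_split_at_real)
qed

text \<open>For \<open>t > 0\<close> and \<open>s = 1/t\<close> the derivative of \<open>P(s) e\<^sup>-\<^sup>s\<close> is \<open>s\<^sup>2 (P(s) - P'(s)) e\<^sup>-\<^sup>s\<close>. At \<open>0\<close> the
  difference quotient is again a member of the family, with polynomial \<open>X P\<close>, and tends to \<open>0\<close>.\<close>

lemma exp_tail_has_derivative:
  "(exp_tail P has_real_derivative exp_tail ([:0, 0, 1:] * (P - pderiv P)) t) (at t)"
proof -
  consider "t > 0" | "t < 0" | "t = 0" by linarith
  then show ?thesis
  proof cases
    case 1
    have "((\<lambda>t. poly P (inverse t) * exp (- inverse t)) has_real_derivative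
        exp_tail ([:0, 0, 1:] * (P - pderiv P)) t) (at t)"
      using 1 by (auto intro!: derivative_eq_intros DERIV_chain2[OF poly_DERIV]
          simp: exp_tail_def algebra_simps power2_eq_square)
    then show ?thesis
      by (rule has_field_derivative_transform_within_open[where S = "{0<..}"])
        (use 1 in \<open>auto simp: exp_tail_def\<close>)
  next
    case 2
    have "((\<lambda>t. 0) has_real_derivative exp_tail ([:0, 0, 1:] * (P - pderiv P)) t) (at t)"
      using 2 by (simp add: exp_tail_def)
    then show ?thesis
      by (rule has_field_derivative_transform_within_open[where S = "{..<0}"])
        (use 2 in \<open>auto simp: exp_tail_def\<close>)
  next
    case 3
    have "(exp_tail P y - exp_tail P 0) / (y - 0) = exp_tail (pCons 0 P) y" for y
      by (auto simp: exp_tail_def field_simps)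
    then have "((\<lambda>y. (exp_tail P y - exp_tail P 0) / (y - 0)) \<longlongrightarrow> 0) (at 0)"
      by (simp only: exp_tail_tendsto_0)
    moreover have "exp_tail ([:0, 0, 1:] * (P - pderiv P)) 0 = 0" by (simp add: exp_tail_def)
    ultimately show ?thesis using 3 by (simp add: has_field_derivative_iff)
  qed
qed

lemma smooth_on_exp_tail: "smooth_on UNIV (exp_tail P)"
proof -
  have "Ck_on k UNIV (exp_tail P)" for k
  proof (induction k arbitrary: P)
    case 0
    show ?case
      using DERIV_isCont[OF exp_tail_has_derivative[of P]]
      by (auto intro!: continuous_at_imp_continuous_on simp del: mult_pCons_left)
  next
    case (Suc k)
    show ?case
      by (rule Ck_on_SucI[where f' = "\<lambda>x v. v * exp_tail ([:0, 0, 1:] * (P - pderiv P)) x"])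
        (use exp_tail_has_derivative Suc
          Ck_on_bounded_linear[OF _ bounded_linear_mult_right] in
         \<open>auto simp: has_field_derivative_def mult.commute[of _ "exp_tail _ _"] 
            intro: Ck_on_bounded_linear[OF _ bounded_linear_mult_left]\<close>)
  qed
  then show ?thesis by (simp add: smooth_on_def)
qed

lemma smooth_bump:
  fixes a :: "'a::euclidean_space"
  assumes "r > 0"
  obtains \<beta> :: "'a \<Rightarrow> real" where "smooth_on UNIV \<beta>" "\<beta> a = 1" "\<And>x. x \<notin> ball a r \<Longrightarrow> \<beta> x = 0"
proof
  define C where "C = exp_tail 1 (r\<^sup>2)"
  have C: "C \<noteq> 0" using assms by (simp add: C_def exp_tail_def)
  define \<beta> where "\<beta> x = (1 / C) *\<^sub>R exp_tail 1 (r\<^sup>2 + - ((x - a) \<bullet> (x - a)))" for x :: 'a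
  have d: "smooth_on UNIV (\<lambda>x. x + - a)"
    by (intro smooth_on_add smooth_on_const smooth_on_bounded_linear_self bounded_linear_ident) simp
  have "smooth_on UNIV (\<lambda>x. r\<^sup>2 + - ((x + - a) \<bullet> (x + - a)))"
    by (intro smooth_on_add smooth_on_const
        smooth_on_bounded_linear[OF _ bounded_linear_minus[OF bounded_linear_ident]]
        smooth_on_bilinear[OF bounded_bilinear_inner] d) simp_all
  then have "smooth_on UNIV (\<lambda>x. r\<^sup>2 + - ((x - a) \<bullet> (x - a)))" by simp
  from smooth_on_compose[OF smooth_on_exp_tail this]
  have "smooth_on UNIV (\<lambda>x. exp_tail 1 (r\<^sup>2 + - ((x - a) \<bullet> (x - a))))" by simp
  then show "smooth_on UNIV \<beta>"
    unfolding \<beta>_def by (intro smooth_on_bounded_linear[OF _ bounded_linear_scaleR_right]) simp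
  show "\<beta> a = 1" using C by (simp add: \<beta>_def C_def)
  fix x assume "x \<notin> ball a r"
  then have "r \<le> norm (x - a)" by (simp add: dist_norm norm_minus_commute)
  then have "r\<^sup>2 \<le> (norm (x - a))\<^sup>2" using assms by (intro power_mono) auto
  then show "\<beta> x = 0" by (simp add: \<beta>_def exp_tail_def power2_norm_eq_inner)
qed

section \<open>Charts and tangent vectors\<close>

locale manifold_atlas =
  fixes M :: "('p, 'e::euclidean_space) atlas"
  assumes atlas: "smooth_atlas M"
begin

lemma inj_coord: "c \<in> M \<Longrightarrow> inj_on (coord c) (cdom c)"
  using atlas by (simp add: smooth_atlas_def)

lemma cinv_coord [simp]: "c \<in> M \<Longrightarrow> p \<in> cdom c \<Longrightarrow> cinv c (coord c p) = p"
  by (simp add: cinv_def inj_coord)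

lemma coord_cinv: "x \<in> coord c ` cdom c \<Longrightarrow> coord c (cinv c x) = x"
  by (simp add: cinv_def f_inv_into_f)

lemma cinv_in: "x \<in> coord c ` cdom c \<Longrightarrow> cinv c x \<in> cdom c"
  by (simp add: cinv_def inv_into_into)

lemma open_coord_overlap: "c \<in> M \<Longrightarrow> d \<in> M \<Longrightarrow> open (coord c ` (cdom c \<inter> cdom d))"
  using atlas by (simp add: smooth_atlas_def)

lemma open_coord_dom: "c \<in> M \<Longrightarrow> open (coord c ` cdom c)"
  using atlas by (simp add: smooth_atlas_def)

lemma smooth_transition:
  "c \<in> M \<Longrightarrow> d \<in> M \<Longrightarrow> smooth_on (coord c ` (cdom c \<inter> cdom d)) (coord d \<circ> cinv c)"
  using atlas by (simp add: smooth_atlas_def)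

lemma cdom_subset_points: "c \<in> M \<Longrightarrow> cdom c \<subseteq> points M"
  by (auto simp: points_def)

abbreviation jac :: "('p, 'e) chart \<Rightarrow> ('p, 'e) chart \<Rightarrow> 'p \<Rightarrow> 'e \<Rightarrow> 'e" where
  "jac c d p \<equiv> frechet_derivative (coord d \<circ> cinv c) (at (coord c p))"

lemma jac_has_derivative:
  assumes "c \<in> M" "d \<in> M" "p \<in> cdom c" "p \<in> cdom d"
  shows "(coord d \<circ> cinv c has_derivative jac c d p) (at (coord c p))"
  using smooth_on_has_derivative[OF smooth_transition[OF assms(1,2)]] assms(3,4) by auto

lemma jac_linear:
  "c \<in> M \<Longrightarrow> d \<in> M \<Longrightarrow> p \<in> cdom c \<Longrightarrow> p \<in> cdom d \<Longrightarrow> linear (jac c d p)"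
  using jac_has_derivative has_derivative_linear by blast

lemma jac_self: "c \<in> M \<Longrightarrow> p \<in> cdom c \<Longrightarrow> jac c c p v = v"
proof -
  assume c: "c \<in> M" "p \<in> cdom c"
  have "jac c c p = frechet_derivative (\<lambda>x. x) (at (coord c p))"
    by (rule frechet_derivative_cong_open[OF open_coord_dom[OF c(1)]]) (use c in auto)
  then show ?thesis by simp
qed

lemma has_derivative_change_chart:
  fixes f :: "'p \<Rightarrow> 'b::real_normed_vector"
  assumes "c \<in> M" "d \<in> M" "p \<in> cdom c" "p \<in> cdom d"
    and f: "(f \<circ> cinv d has_derivative f') (at (coord d p))"
  shows "(f \<circ> cinv c has_derivative f' \<circ> jac c d p) (at (coord c p))"
proof -
  have "((f \<circ> cinv d) \<circ> (coord d \<circ> cinv c) has_derivative f' \<circ> jac c d p) (at (coord c p))"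
    by (rule diff_chain_at[OF jac_has_derivative]) (use assms in auto)
  then show ?thesis
    by (rule has_derivative_transform_within_open[OF _ open_coord_overlap[OF assms(1,2)]])
      (use assms in auto)
qed

text \<open>By the chain rule the derivatives of the changes of coordinates compose. So the compatibility
  condition in the definition of a tangent vector is consistent: components may be prescribed freely
  in one chart, and they determine those in all other charts.\<close>

lemma jac_cocycle:
  assumes "c \<in> M" "d \<in> M" "e \<in> M" "p \<in> cdom c" "p \<in> cdom d" "p \<in> cdom e"
  shows "jac d e p (jac c d p v) = jac c e p v"
  using frechet_derivative_eqI[OF has_derivative_change_chart[OF assms(1,2,4,5) jac_has_derivative[OF assms(2,3,5,6)]]]
  by simp

lemma tspace_chart:
  "v \<in> tspace M p \<Longrightarrow> c \<in> M \<Longrightarrow> d \<in> M \<Longrightarrow> p \<in> cdom c \<Longrightarrow> p \<in> cdom d \<Longrightarrow> v d = jac c d p (v c)"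
  unfolding tspace_def by blast

lemma tspaceI:
  assumes "\<And>c. \<not> (c \<in> M \<and> p \<in> cdom c) \<Longrightarrow> v c = 0"
    "\<And>c d. c \<in> M \<Longrightarrow> d \<in> M \<Longrightarrow> p \<in> cdom c \<Longrightarrow> p \<in> cdom d \<Longrightarrow> v d = jac c d p (v c)"
  shows "v \<in> tspace M p"
  unfolding tspace_def using assms by blast

lemma tspace_outside: "v \<in> tspace M p \<Longrightarrow> \<not> (c \<in> M \<and> p \<in> cdom c) \<Longrightarrow> v c = 0"
  unfolding tspace_def by blast

lemma tspace_eqI:
  assumes "v \<in> tspace M p" "w \<in> tspace M p" "c \<in> M" "p \<in> cdom c" "v c = w c"
  shows "v = w"
proof
  fix d
  show "v d = w d"
  proof (cases "d \<in> M \<and> p \<in> cdom d")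
    case True
    then show ?thesis using tspace_chart[of _ p c d] assms by metis
  next
    case False
    then show ?thesis using tspace_outside assms by metis
  qed
qed

lemma const_field_in_tspace:
  assumes "c \<in> M" "p \<in> cdom c"
  shows "const_field M c x p \<in> tspace M p"
  unfolding tspace_def const_field_def using assms jac_cocycle[of c _ _ p x] by auto

lemma const_field_chart: "c \<in> M \<Longrightarrow> p \<in> cdom c \<Longrightarrow> const_field M c x p c = x"
  using jac_self by (simp add: const_field_def)

lemma const_field_unique:
  assumes "v \<in> tspace M p" "c \<in> M" "p \<in> cdom c"
  shows "const_field M c (v c) p = v"
  by (rule tspace_eqI[of _ p _ c]) (use assms const_field_in_tspace const_field_chart in auto)

lemma const_field_linear:
  assumes "c \<in> M" "p \<in> cdom c"
  shows "linear (\<lambda>x. const_field M c x p d)"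
proof (cases "d \<in> M \<and> p \<in> cdom d")
  case True
  then show ?thesis using assms jac_linear[of c d p] by (simp add: const_field_def)
next
  case False
  then have "(\<lambda>x. const_field M c x p d) = (\<lambda>x. 0)" by (auto simp: const_field_def)
  then show ?thesis using linear_zero by simp
qed

lemma tzero_in_tspace: "tzero \<in> tspace M p"
  by (rule tspaceI) (simp_all add: tzero_def linear_0[OF jac_linear])

lemma tadd_in_tspace:
  assumes "v \<in> tspace M p" "w \<in> tspace M p"
  shows "tadd v w \<in> tspace M p"
proof (rule tspaceI)
  show "tadd v w c = 0" if "\<not> (c \<in> M \<and> p \<in> cdom c)" for c
    using tspace_outside[OF assms(1) that] tspace_outside[OF assms(2) that] by (simp add: tadd_def)
  fix c d assume cd: "c \<in> M" "d \<in> M" "p \<in> cdom c" "p \<in> cdom d"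
  have "jac c d p (tadd v w c) = jac c d p (v c) + jac c d p (w c)"
    by (simp only: tadd_def linear_add[OF jac_linear[OF cd]])
  then show "tadd v w d = jac c d p (tadd v w c)"
    using tspace_chart[OF assms(1) cd] tspace_chart[OF assms(2) cd] by (simp only: tadd_def)
qed

lemma tscale_in_tspace:
  assumes "v \<in> tspace M p"
  shows "tscale r v \<in> tspace M p"
proof (rule tspaceI)
  show "tscale r v c = 0" if "\<not> (c \<in> M \<and> p \<in> cdom c)" for c
    using tspace_outside[OF assms that] by (simp add: tscale_def)
  fix c d assume cd: "c \<in> M" "d \<in> M" "p \<in> cdom c" "p \<in> cdom d"
  have "jac c d p (tscale r v c) = r *\<^sub>R jac c d p (v c)"
    by (simp only: tscale_def linear_scale[OF jac_linear[OF cd]])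
  then show "tscale r v d = jac c d p (tscale r v c)"
    using tspace_chart[OF assms cd] by (simp only: tscale_def)
qed

lemma tdiff_in_tspace:
  assumes "v \<in> tspace M p" "w \<in> tspace M p"
  shows "tdiff v w \<in> tspace M p"
proof -
  have "tdiff v w = tadd v (tscale (- 1) w)" by (simp add: tdiff_def tadd_def tscale_def)
  then show ?thesis using assms tadd_in_tspace tscale_in_tspace by simp
qed

lemma tsum_empty: "tsum {} f E = tzero"
  by (simp add: tsum_def tzero_def)

lemma tsum_insert: "finite I \<Longrightarrow> i \<notin> I \<Longrightarrow> tsum (insert i I) f E = tadd (tscale (f i) (E i)) (tsum I f E)"
  by (simp add: tsum_def tadd_def tscale_def)

lemma tsum_in_tspace:
  assumes "finite I" "\<And>i. i \<in> I \<Longrightarrow> E i \<in> tspace M p"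
  shows "tsum I f E \<in> tspace M p"
  using assms
  by (induction I rule: finite_induct)
    (auto simp: tsum_empty tsum_insert intro: tzero_in_tspace tadd_in_tspace tscale_in_tspace)

lemma chart_at: "p \<in> points M \<Longrightarrow> chart_at M p \<in> M \<and> p \<in> cdom (chart_at M p)"
  unfolding chart_at_def by (rule someI_ex) (auto simp: points_def)

text \<open>Directional derivatives are defined by an arbitrarily chosen chart; by the chain rule every chart
  around the point gives the same value.\<close>

lemma deriv_along_chart:
  fixes f :: "'p \<Rightarrow> 'b::euclidean_space"
  assumes "c \<in> M" "p \<in> cdom c" "v \<in> tspace M p"
    and f: "(f \<circ> cinv c has_derivative f') (at (coord c p))"
  shows "deriv_along M p v f = f' (v c)"
proof -
  let ?d = "chart_at M p"
  have d: "?d \<in> M" "p \<in> cdom ?d" using chart_at assms cdom_subset_points by blast+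
  have "deriv_along M p v f = (f' \<circ> jac ?d c p) (v ?d)"
    unfolding deriv_along_def Let_def
    by (rule arg_cong[where f = "\<lambda>h. h (v ?d)"], rule frechet_derivative_eqI)
      (rule has_derivative_change_chart[OF d(1) assms(1) d(2) assms(2) f])
  then show ?thesis using tspace_chart[OF assms(3) d(1) assms(1) d(2) assms(2)] by simp
qed


section \<open>Smooth functions and vector fields\<close>

lemma openin_coord: "openin (mtop M) U \<Longrightarrow> c \<in> M \<Longrightarrow> open (coord c ` (U \<inter> cdom c))"
  using openin_mtop[OF atlas] by blast

lemma openin_cdom: "c \<in> M \<Longrightarrow> openin (mtop M) (cdom c)"
  using openin_mtop[OF atlas] open_coord_overlap cdom_subset_points by (simp add: Int_commute)

lemma openin_points: "openin (mtop M) (points M)"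
  using topspace_mtop[OF atlas] by (metis openin_topspace)

lemma openin_subset_points: "openin (mtop M) U \<Longrightarrow> U \<subseteq> points M"
  using openin_mtop[OF atlas] by blast

lemma smooth_fun_iff:
  fixes f :: "'p \<Rightarrow> 'b::euclidean_space"
  shows "smooth_map_on M U std_atlas f \<longleftrightarrow> openin (mtop M) U \<and>
    (\<forall>c\<in>M. smooth_on (coord c ` (U \<inter> cdom c)) (\<lambda>x. f (cinv c x)))"
  unfolding smooth_map_on_def std_atlas_def points_def
  using openin_coord[of U] by (auto simp: o_def)

text \<open>Smoothness may be tested in one chart covering the set, because the changes of coordinates are
  smooth.\<close>

lemma smooth_fun_from_chart:
  fixes f :: "'p \<Rightarrow> 'b::euclidean_space"
  assumes "c \<in> M" "U \<subseteq> cdom c" "openin (mtop M) U" "smooth_on (coord c ` U) (\<lambda>x. f (cinv c x))"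
  shows "smooth_map_on M U std_atlas f"
  unfolding smooth_fun_iff
proof (intro conjI ballI assms(3))
  fix d assume d: "d \<in> M"
  have U: "open (coord c ` U)" using openin_coord[OF assms(3,1)] assms(2) by (simp add: inf.absorb1)
  show "smooth_on (coord d ` (U \<inter> cdom d)) (\<lambda>x. f (cinv d x))"
  proof (rule smooth_on_cong[OF openin_coord[OF assms(3) d]])
    show "smooth_on (coord d ` (U \<inter> cdom d)) (\<lambda>x. f (cinv c ((coord c \<circ> cinv d) x)))"
      by (rule smooth_on_compose[OF assms(4)
            smooth_on_subset[OF smooth_transition[OF d assms(1)]] openin_coord[OF assms(3) d] U])
        (use assms d in auto)
  qed (use assms d in auto)
qed

lemma smooth_vfieldD:
  assumes "smooth_vfield_on M U X"
  shows "openin (mtop M) U" "p \<in> U \<Longrightarrow> X p \<in> tspace M p"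
    "c \<in> M \<Longrightarrow> smooth_on (coord c ` (U \<inter> cdom c)) (\<lambda>x. X (cinv c x) c)"
  using assms by (auto simp: smooth_vfield_on_def)

lemma smooth_vfield_subset:
  assumes "smooth_vfield_on M U X" "openin (mtop M) V" "V \<subseteq> U"
  shows "smooth_vfield_on M V X"
  unfolding smooth_vfield_on_def
proof (intro conjI ballI)
  show "X p \<in> tspace M p" if "p \<in> V" for p
    using smooth_vfieldD(2)[OF assms(1)] that assms(3) by auto
  show "smooth_on (coord c ` (V \<inter> cdom c)) (\<lambda>x. X (cinv c x) c)" if "c \<in> M" for c
    by (rule smooth_on_subset[OF smooth_vfieldD(3)[OF assms(1) that]]) (use assms(3) in auto)
qed (rule assms(2))

lemma smooth_vfield_cong:
  assumes "smooth_vfield_on M U X" "\<And>p. p \<in> U \<Longrightarrow> X p = Y p"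
  shows "smooth_vfield_on M U Y"
  unfolding smooth_vfield_on_def
proof (intro conjI ballI)
  show "openin (mtop M) U" using smooth_vfieldD(1)[OF assms(1)] .
  show "Y p \<in> tspace M p" if "p \<in> U" for p using smooth_vfieldD(2)[OF assms(1) that] assms(2)[OF that] by simp
  show "smooth_on (coord c ` (U \<inter> cdom c)) (\<lambda>x. Y (cinv c x) c)" if "c \<in> M" for c
    by (rule smooth_on_cong[OF openin_coord[OF smooth_vfieldD(1)[OF assms(1)] that]
        _ smooth_vfieldD(3)[OF assms(1) that]]) (use assms(2) that in auto)
qed

lemma smooth_vfield_tzero: "openin (mtop M) U \<Longrightarrow> smooth_vfield_on M U (\<lambda>p. tzero)"
  unfolding smooth_vfield_on_def using tzero_in_tspace by (simp add: tzero_def smooth_on_const)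

lemma smooth_vfield_tadd:
  assumes "smooth_vfield_on M U X" "smooth_vfield_on M U Y"
  shows "smooth_vfield_on M U (\<lambda>p. tadd (X p) (Y p))"
  unfolding smooth_vfield_on_def
proof (intro conjI ballI)
  show U: "openin (mtop M) U" using smooth_vfieldD(1)[OF assms(2)] .
  show "tadd (X p) (Y p) \<in> tspace M p" if "p \<in> U" for p
    using tadd_in_tspace[OF smooth_vfieldD(2)[OF assms(1) that] smooth_vfieldD(2)[OF assms(2) that]] .
  show "smooth_on (coord c ` (U \<inter> cdom c)) (\<lambda>x. tadd (X (cinv c x)) (Y (cinv c x)) c)"
    if "c \<in> M" for c
    unfolding tadd_def
    by (rule smooth_on_add[OF openin_coord[OF U that] smooth_vfieldD(3)[OF assms(1) that]
          smooth_vfieldD(3)[OF assms(2) that]])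
qed

lemma smooth_vfield_tscale:
  fixes f :: "'p \<Rightarrow> real"
  assumes "smooth_map_on M U std_atlas f" "smooth_vfield_on M U X"
  shows "smooth_vfield_on M U (\<lambda>p. tscale (f p) (X p))"
  unfolding smooth_vfield_on_def
proof (intro conjI ballI)
  show U: "openin (mtop M) U" using smooth_vfieldD(1)[OF assms(2)] .
  show "tscale (f p) (X p) \<in> tspace M p" if "p \<in> U" for p
    using tscale_in_tspace smooth_vfieldD(2)[OF assms(2) that] .
  show "smooth_on (coord c ` (U \<inter> cdom c)) (\<lambda>x. tscale (f (cinv c x)) (X (cinv c x)) c)"
    if "c \<in> M" for c
    unfolding tscale_def
    by (rule smooth_on_scaleR[OF openin_coord[OF U that] _ smooth_vfieldD(3)[OF assms(2) that]])
      (use assms(1) that in \<open>auto simp: smooth_fun_iff\<close>)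
qed

lemma smooth_vfield_tsum:
  fixes f :: "'i \<Rightarrow> 'p \<Rightarrow> real"
  assumes "finite I" "openin (mtop M) U" "\<And>i. i \<in> I \<Longrightarrow> smooth_map_on M U std_atlas (f i)"
    "\<And>i. i \<in> I \<Longrightarrow> smooth_vfield_on M U (X i)"
  shows "smooth_vfield_on M U (\<lambda>p. tsum I (\<lambda>i. f i p) (\<lambda>i. X i p))"
  using assms(1,3,4)
  by (induction I rule: finite_induct)
    (auto simp: tsum_empty tsum_insert intro!: smooth_vfield_tzero[OF assms(2)]
      smooth_vfield_tadd smooth_vfield_tscale)

lemma smooth_vfield_const_field:
  assumes "c \<in> M"
  shows "smooth_vfield_on M (cdom c) (const_field M c v)"
  unfolding smooth_vfield_on_def
proof (intro conjI ballI openin_cdom const_field_in_tspace assms)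
  fix d assume d: "d \<in> M"
  let ?S = "coord d ` (cdom c \<inter> cdom d)"
  have S: "open ?S" using openin_coord[OF openin_cdom[OF assms] d] .
  have T: "open (coord c ` (cdom c \<inter> cdom d))" using open_coord_overlap[OF assms d] .
  show "smooth_on ?S (\<lambda>x. const_field M c v (cinv d x) d)"
  proof (rule smooth_on_cong[OF S])
    show "smooth_on ?S (\<lambda>x. frechet_derivative (coord d \<circ> cinv c) (at ((coord c \<circ> cinv d) x)) v)"
      by (rule smooth_on_compose[OF smooth_on_frechet_derivative[OF smooth_transition[OF assms d]]
            smooth_on_subset[OF smooth_transition[OF d assms]] S T])
        (use assms d in auto)
  qed (use assms d in \<open>auto simp: const_field_def\<close>)
qed

text \<open>The field with constant components in a chart is multiplied by a bump function and extended by
  zero. The support of the bump function is compact, hence closed because the manifold is Hausdorff,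
  so the chart domain and the complement of the support form an open cover, and the field is smooth
  on both.\<close>

lemma ex_global_smooth_vfield:
  assumes "Hausdorff_space (mtop M)" "p \<in> points M" "v \<in> tspace M p"
  shows "\<exists>Y. smooth_vfield_on M (points M) Y \<and> Y p = v"
proof -
  obtain c where c: "c \<in> M" "p \<in> cdom c" using assms(2) by (auto simp: points_def)
  obtain r where r: "r > 0" "cball (coord c p) r \<subseteq> coord c ` cdom c"
    using open_coord_dom[OF c(1)] c(2) open_contains_cball by blast
  define K where "K = cinv c ` cball (coord c p) r"
  have "continuous_map (top_of_set (coord c ` cdom c)) (mtop M) (cinv c)"
    unfolding continuous_map
  proof (intro conjI allI impI)
    show "cinv c ` topspace (top_of_set (coord c ` cdom c)) \<subseteq> topspace (mtop M)"
      using cdom_subset_points[OF c(1)] c(1) by (auto simp: topspace_mtop[OF atlas])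
    fix W assume W: "openin (mtop M) W"
    have "{x \<in> topspace (top_of_set (coord c ` cdom c)). cinv c x \<in> W} = coord c ` (W \<inter> cdom c)"
      using c by auto
    then show "openin (top_of_set (coord c ` cdom c)) {x \<in> topspace (top_of_set (coord c ` cdom c)). cinv c x \<in> W}"
      using openin_coord[OF W c(1)] by (auto intro: openin_subset_trans open_openin open_subset)
  qed
  moreover have "compactin (top_of_set (coord c ` cdom c)) (cball (coord c p) r)"
    using r by (simp add: compactin_subtopology)
  ultimately have "compactin (mtop M) K" unfolding K_def by (rule image_compactin[rotated])
  then have "closedin (mtop M) K" using compactin_imp_closedin[OF assms(1)] by blast
  then have oK: "openin (mtop M) (points M - K)"
    using topspace_mtop[OF atlas] by (metis closedin_def)
  obtain \<beta> :: "'e \<Rightarrow> real" where \<beta>: "smooth_on UNIV \<beta>" "\<beta> (coord c p) = 1" "\<And>x. x \<notin> ball (coord c p) r \<Longrightarrow> \<beta> x = 0"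
    using smooth_bump[OF r(1)] by blast
  define Y where "Y q = (if q \<in> cdom c then tscale (\<beta> (coord c q)) (const_field M c (v c) q) else tzero)" for q
  have "smooth_map_on M (cdom c) std_atlas (\<lambda>q. \<beta> (coord c q))"
  proof (rule smooth_fun_from_chart[OF c(1) subset_refl openin_cdom[OF c(1)]])
    show "smooth_on (coord c ` cdom c) (\<lambda>x. \<beta> (coord c (cinv c x)))"
      by (rule smooth_on_cong[OF open_coord_dom[OF c(1)] _ smooth_on_subset[OF \<beta>(1) subset_UNIV]])
        (use c(1) in auto)
  qed
  from smooth_vfield_tscale[OF this smooth_vfield_const_field[OF c(1)]]
  have Y1: "smooth_vfield_on M (cdom c) Y" by (rule smooth_vfield_cong) (simp add: Y_def)
  have "Y q = tzero" if "q \<in> points M - K" for q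
  proof (cases "q \<in> cdom c")
    case True
    have "cinv c (coord c q) \<in> K" if "coord c q \<in> ball (coord c p) r"
      unfolding K_def by (rule imageI) (use that in auto)
    then have "coord c q \<notin> ball (coord c p) r" using that c(1) True by auto
    then show ?thesis using \<beta>(3) by (simp add: Y_def tscale_def tzero_def)
  qed (simp add: Y_def)
  then have Y2: "smooth_vfield_on M (points M - K) Y"
    by (intro smooth_vfield_cong[OF smooth_vfield_tzero[OF oK]]) auto
  \<comment> \<open>The two open sets on which smoothness is known.\<close>
  have cover: "q \<in> cdom c \<or> q \<in> points M - K" if "q \<in> points M" for q
    using that r c unfolding K_def by auto
  have "smooth_vfield_on M (points M) Y"
    unfolding smooth_vfield_on_def
  proof (intro conjI ballI openin_points)
    show "Y q \<in> tspace M q" if "q \<in> points M" for q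
      using cover[OF that] smooth_vfieldD(2)[OF Y1] smooth_vfieldD(2)[OF Y2] by blast
    fix d assume d: "d \<in> M"
    show "smooth_on (coord d ` (points M \<inter> cdom d)) (\<lambda>x. Y (cinv d x) d)"
    proof (rule smooth_on_locally)
      fix x assume "x \<in> coord d ` (points M \<inter> cdom d)"
      then consider "x \<in> coord d ` (cdom c \<inter> cdom d)" | "x \<in> coord d ` ((points M - K) \<inter> cdom d)"
        using cover by blast
      then show "\<exists>T. open T \<and> x \<in> T \<and> smooth_on T (\<lambda>x. Y (cinv d x) d)"
        using openin_coord[OF openin_cdom[OF c(1)] d] openin_coord[OF oK d]
          smooth_vfieldD(3)[OF Y1 d] smooth_vfieldD(3)[OF Y2 d] by metis
    qed
  qed
  moreover have "Y p = v"
    using c \<beta>(2) const_field_unique[OF assms(3) c] by (simp add: Y_def tscale_def)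
  ultimately show ?thesis by blast
qed

end

section \<open>Linear connections\<close>

context manifold_atlas
begin

lemma deriv_along_const:
  assumes "p \<in> points M" "v \<in> tspace M p"
  shows "deriv_along M p v (\<lambda>q. r) = 0"
proof -
  obtain c where c: "c \<in> M" "p \<in> cdom c" using assms(1) by (auto simp: points_def)
  show ?thesis by (rule deriv_along_chart[OF c assms(2)]) (simp add: o_def)
qed

lemma smooth_fun_const:
  "openin (mtop M) U \<Longrightarrow> smooth_map_on M U std_atlas (\<lambda>q. r)"
  by (simp add: smooth_fun_iff smooth_on_const)

lemma smooth_vfield_component:
  assumes "smooth_vfield_on M U Y" "c \<in> M"
  shows "smooth_map_on M (U \<inter> cdom c) std_atlas (\<lambda>q. Y q c \<bullet> b)"
proof (rule smooth_fun_from_chart[OF assms(2)])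
  show U: "openin (mtop M) (U \<inter> cdom c)"
    using smooth_vfieldD(1)[OF assms(1)] openin_cdom[OF assms(2)] by blast
  show "smooth_on (coord c ` (U \<inter> cdom c)) (\<lambda>x. Y (cinv c x) c \<bullet> b)"
    by (rule smooth_on_bounded_linear[OF _ bounded_linear_inner_left smooth_vfieldD(3)[OF assms]])
      (rule openin_coord[OF smooth_vfieldD(1)[OF assms(1)] assms(2)])
qed simp

text \<open>The constant fields of a chart are its coordinate frame, so fields can be differentiated
  componentwise.\<close>

lemma tspace_expansion:
  assumes "v \<in> tspace M p" "c \<in> M" "p \<in> cdom c"
  shows "v = tsum Basis (\<lambda>b. v c \<bullet> b) (\<lambda>b. const_field M c b p)"
proof
  fix d
  have "v d = const_field M c (v c) p d" using const_field_unique[OF assms] by simp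
  also have "\<dots> = (\<Sum>b\<in>Basis. (v c \<bullet> b) *\<^sub>R const_field M c b p d)"
    by (rule linear_basis_expansion[OF const_field_linear[OF assms(2,3)]])
  finally show "v d = tsum Basis (\<lambda>b. v c \<bullet> b) (\<lambda>b. const_field M c b p) d"
    by (simp add: tsum_def)
qed

end

locale manifold_connection = manifold_atlas M for M :: "('p, 'e::euclidean_space) atlas" +
  fixes D :: "('p, 'e) conn"
  assumes connection: "linear_connection M D"
begin

lemmas connection_rules = connection[unfolded linear_connection_def, rule_format]

lemma conn_in_tspace:
  "smooth_vfield_on M U Y \<Longrightarrow> p \<in> U \<Longrightarrow> v \<in> tspace M p \<Longrightarrow> D p v Y \<in> tspace M p"
  by (rule connection_rules[THEN conjunct1, rule_format])

lemma conn_tadd_vector: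
  "smooth_vfield_on M U Y \<Longrightarrow> p \<in> U \<Longrightarrow> v \<in> tspace M p \<Longrightarrow> w \<in> tspace M p \<Longrightarrow>
    D p (tadd v w) Y = tadd (D p v Y) (D p w Y)"
  by (rule connection_rules[THEN conjunct2, THEN conjunct1, rule_format])

lemma conn_tscale_vector:
  "smooth_vfield_on M U Y \<Longrightarrow> p \<in> U \<Longrightarrow> v \<in> tspace M p \<Longrightarrow> D p (tscale r v) Y = tscale r (D p v Y)"
  by (rule connection_rules[THEN conjunct2, THEN conjunct2, THEN conjunct1, rule_format])

lemma conn_tadd:
  "smooth_vfield_on M U Y \<Longrightarrow> smooth_vfield_on M U Z \<Longrightarrow> p \<in> U \<Longrightarrow> v \<in> tspace M p \<Longrightarrow>
    D p v (\<lambda>q. tadd (Y q) (Z q)) = tadd (D p v Y) (D p v Z)"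
  by (rule connection_rules[THEN conjunct2, THEN conjunct2, THEN conjunct2, THEN conjunct1, rule_format])

lemma conn_tscale:
  fixes f :: "'p \<Rightarrow> real"
  shows "smooth_vfield_on M U Y \<Longrightarrow> smooth_map_on M U std_atlas f \<Longrightarrow> p \<in> U \<Longrightarrow> v \<in> tspace M p \<Longrightarrow>
    D p v (\<lambda>q. tscale (f q) (Y q)) = tadd (tscale (deriv_along M p v f) (Y p)) (tscale (f p) (D p v Y))"
  by (rule connection_rules[THEN conjunct2, THEN conjunct2, THEN conjunct2, THEN conjunct2, THEN conjunct1, rule_format])

lemma conn_cong:
  "smooth_vfield_on M U Y \<Longrightarrow> smooth_vfield_on M U Z \<Longrightarrow> (\<And>q. q \<in> U \<Longrightarrow> Y q = Z q) \<Longrightarrow> p \<in> U \<Longrightarrow>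
    v \<in> tspace M p \<Longrightarrow> D p v Y = D p v Z"
  by (rule connection_rules[THEN conjunct2, THEN conjunct2, THEN conjunct2, THEN conjunct2, THEN conjunct2, THEN conjunct1, rule_format])

lemma conn_smooth:
  "smooth_vfield_on M U Y \<Longrightarrow> smooth_vfield_on M U X \<Longrightarrow> smooth_vfield_on M U (\<lambda>p. D p (X p) Y)"
  by (rule connection_rules[THEN conjunct2, THEN conjunct2, THEN conjunct2, THEN conjunct2, THEN conjunct2, THEN conjunct2, rule_format])

lemma conn_scale_const:
  assumes "smooth_vfield_on M U Y" "p \<in> U" "v \<in> tspace M p"
  shows "D p v (\<lambda>q. tscale r (Y q)) = tscale r (D p v Y)"
proof -
  have U: "openin (mtop M) U" using smooth_vfieldD(1)[OF assms(1)] .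
  have "p \<in> points M" using openin_subset_points[OF U] assms(2) by auto
  then show ?thesis
    using conn_tscale[OF assms(1) smooth_fun_const[OF U, of r] assms(2,3)]
    by (simp add: deriv_along_const[OF _ assms(3)] tadd_def tscale_def)
qed

lemma conn_tzero:
  assumes "openin (mtop M) U" "p \<in> U" "v \<in> tspace M p"
  shows "D p v (\<lambda>q. tzero) = tzero"
  using conn_scale_const[OF smooth_vfield_tzero[OF assms(1)] assms(2,3), of 0]
  by (simp add: tscale_def tzero_def)

lemma conn_vector_zero:
  assumes "smooth_vfield_on M U Y" "p \<in> U"
  shows "D p tzero Y = tzero"
  using conn_tscale_vector[OF assms tzero_in_tspace, of 0] by (simp add: tscale_def tzero_def)

lemma conn_tsum_vector:
  assumes "finite I" "smooth_vfield_on M U Y" "p \<in> U" "\<And>i. i \<in> I \<Longrightarrow> E i \<in> tspace M p"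
  shows "D p (tsum I f E) Y = tsum I f (\<lambda>i. D p (E i) Y)"
  using assms(1,4)
  by (induction I rule: finite_induct)
    (simp_all add: tsum_empty tsum_insert conn_vector_zero[OF assms(2,3)] conn_tadd_vector[OF assms(2,3)]
      conn_tscale_vector[OF assms(2,3)] tscale_in_tspace tsum_in_tspace)

lemma conn_tsum:
  fixes f :: "'i \<Rightarrow> 'p \<Rightarrow> real"
  assumes "finite I" "openin (mtop M) U" "p \<in> U" "v \<in> tspace M p"
    "\<And>i. i \<in> I \<Longrightarrow> smooth_map_on M U std_atlas (f i)" "\<And>i. i \<in> I \<Longrightarrow> smooth_vfield_on M U (Y i)"
  shows "D p v (\<lambda>q. tsum I (\<lambda>i. f i q) (\<lambda>i. Y i q)) =
    tadd (tsum I (\<lambda>i. deriv_along M p v (f i)) (\<lambda>i. Y i p)) (tsum I (\<lambda>i. f i p) (\<lambda>i. D p v (Y i)))"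
  using assms(1,5,6)
proof (induction I rule: finite_induct)
  case empty
  show ?case using conn_tzero[OF assms(2-4)] by (simp add: tsum_empty) (simp add: tzero_def tadd_def)
next
  case (insert i I)
  have f: "smooth_map_on M U std_atlas (f i)" and Y: "smooth_vfield_on M U (Y i)"
    using insert.prems by auto
  have S: "smooth_vfield_on M U (\<lambda>q. tsum I (\<lambda>i. f i q) (\<lambda>i. Y i q))"
    by (rule smooth_vfield_tsum) (use insert assms in auto)
  have IH: "D p v (\<lambda>q. tsum I (\<lambda>i. f i q) (\<lambda>i. Y i q)) =
    tadd (tsum I (\<lambda>i. deriv_along M p v (f i)) (\<lambda>i. Y i p)) (tsum I (\<lambda>i. f i p) (\<lambda>i. D p v (Y i)))"
    using insert by auto
  show ?case
    unfolding tsum_insert[OF insert.hyps]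
      conn_tadd[OF smooth_vfield_tscale[OF f Y] S assms(3,4)] conn_tscale[OF Y f assms(3,4)] IH
    by (simp add: tadd_def add_ac)
qed

lemma conn_const_field_linear:
  assumes "c \<in> M" "p \<in> cdom c" "v \<in> tspace M p"
  shows "linear (\<lambda>x. D p v (const_field M c x) c)"
proof (rule linearI)
  note S = smooth_vfield_const_field[OF assms(1)]
  fix x y r
  have "D p v (const_field M c (x + y)) = D p v (\<lambda>q. tadd (const_field M c x q) (const_field M c y q))"
    by (rule conn_cong[OF S smooth_vfield_tadd[OF S S] _ assms(2,3)])
      (simp add: fun_eq_iff tadd_def linear_add[OF const_field_linear[OF assms(1)]])
  then show "D p v (const_field M c (x + y)) c = D p v (const_field M c x) c + D p v (const_field M c y) c"
    using conn_tadd[OF S S assms(2,3)] by (simp add: tadd_def)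
  have "D p v (const_field M c (r *\<^sub>R x)) = D p v (\<lambda>q. tscale r (const_field M c x q))"
    by (rule conn_cong[OF S smooth_vfield_tscale[OF smooth_fun_const[OF openin_cdom[OF assms(1)]] S] _ assms(2,3)])
      (simp add: fun_eq_iff tscale_def linear_scale[OF const_field_linear[OF assms(1)]])
  then show "D p v (const_field M c (r *\<^sub>R x)) c = r *\<^sub>R D p v (const_field M c x) c"
    using conn_scale_const[OF S assms(2,3)] by (simp add: tscale_def)
qed

text \<open>Applying the Leibniz rule to the expansion of \<open>Y\<close> in the constant fields of the chart gives the
  formula \<open>\<nabla>\<^sub>v Y = v(Y) + \<Gamma>(v, Y)\<close>. The last summand is the Christoffel term in the form in which it
  occurs in the equation of parallel transport.\<close>

lemma conn_in_chart:
  assumes "smooth_vfield_on M U Y" "p \<in> U" "c \<in> M" "p \<in> cdom c" "v \<in> tspace M p"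
  shows "D p v Y c = frechet_derivative (\<lambda>x. Y (cinv c x) c) (at (coord c p)) (v c)
    + D p v (const_field M c (Y p c)) c"
proof -
  let ?W = "U \<inter> cdom c"
  let ?E = "\<lambda>b q. const_field M c b q"
  have W: "openin (mtop M) ?W" "p \<in> ?W"
    using smooth_vfieldD(1)[OF assms(1)] openin_cdom[OF assms(3)] assms(2,4) by auto
  have E: "smooth_vfield_on M ?W (?E b)" for b
    by (rule smooth_vfield_subset[OF smooth_vfield_const_field[OF assms(3)] W(1)]) simp
  note f = smooth_vfield_component[OF assms(1,3)]
  have Y': "smooth_vfield_on M ?W Y" by (rule smooth_vfield_subset[OF assms(1) W(1)]) simp
  have "D p v Y = D p v (\<lambda>q. tsum Basis (\<lambda>b. Y q c \<bullet> b) (\<lambda>b. ?E b q))"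
    by (rule conn_cong[OF Y' smooth_vfield_tsum[OF finite_Basis W(1) f E] _ W(2) assms(5)],
        rule tspace_expansion) (use assms smooth_vfieldD(2)[OF assms(1)] in auto)
  also have "\<dots> = tadd (tsum Basis (\<lambda>b. deriv_along M p v (\<lambda>q. Y q c \<bullet> b)) (\<lambda>b. ?E b p))
      (tsum Basis (\<lambda>b. Y p c \<bullet> b) (\<lambda>b. D p v (?E b)))"
    by (rule conn_tsum[OF finite_Basis W assms(5) f E])
  finally have "D p v Y c = (\<Sum>b\<in>Basis. deriv_along M p v (\<lambda>q. Y q c \<bullet> b) *\<^sub>R b)
      + (\<Sum>b\<in>Basis. (Y p c \<bullet> b) *\<^sub>R D p v (?E b) c)"
    using const_field_chart[OF assms(3,4)] by (simp add: tadd_def tsum_def)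
  also have "(\<Sum>b\<in>Basis. (Y p c \<bullet> b) *\<^sub>R D p v (?E b) c) = D p v (const_field M c (Y p c)) c"
    using linear_basis_expansion[OF conn_const_field_linear[OF assms(3-5)], of "Y p c"] by simp
  also have "(\<Sum>b\<in>Basis. deriv_along M p v (\<lambda>q. Y q c \<bullet> b) *\<^sub>R b) =
      frechet_derivative (\<lambda>x. Y (cinv c x) c) (at (coord c p)) (v c)" (is "_ = ?g (v c)")
  proof -
    have "((\<lambda>x. Y (cinv c x) c) has_derivative ?g) (at (coord c p))"
      by (rule smooth_on_has_derivative[OF smooth_vfieldD(3)[OF assms(1,3)]]) (use assms in auto)
    then have "(((\<lambda>q. Y q c \<bullet> b) \<circ> cinv c) has_derivative (\<lambda>h. ?g h \<bullet> b)) (at (coord c p))" for b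
      unfolding o_def by (rule has_derivative_inner_left)
    then have "deriv_along M p v (\<lambda>q. Y q c \<bullet> b) = ?g (v c) \<bullet> b" for b
      by (rule deriv_along_chart[OF assms(3-5)])
    then show ?thesis by (simp add: euclidean_representation)
  qed
  finally show ?thesis .
qed

end

section \<open>Linear differential equations\<close>

lemma linear_family_bounded:
  fixes G :: "'a::metric_space \<Rightarrow> 'b::euclidean_space \<Rightarrow> 'c::real_normed_vector"
  assumes "compact C" "\<And>t. t \<in> C \<Longrightarrow> linear (G t)" "\<And>y. continuous_on C (\<lambda>t. G t y)"
  obtains K where "K > 0" "\<And>t y. t \<in> C \<Longrightarrow> norm (G t y) \<le> K * norm y"
proof -
  have "\<exists>B. \<forall>t\<in>C. norm (G t b) \<le> B" for b
    using compact_imp_bounded[OF compact_continuous_image[OF assms(3)[of b] assms(1)]]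
    by (auto simp: bounded_iff)
  then obtain B where B: "\<And>b t. t \<in> C \<Longrightarrow> norm (G t b) \<le> B b" by metis
  define K where "K = (\<Sum>b\<in>Basis. \<bar>B b\<bar>) + 1"
  have K: "K > 0" unfolding K_def by (simp add: sum_nonneg add_nonneg_pos)
  moreover have "norm (G t y) \<le> K * norm y" if t: "t \<in> C" for t y
  proof -
    have "norm (G t y) = norm (\<Sum>b\<in>Basis. (y \<bullet> b) *\<^sub>R G t b)"
      using linear_basis_expansion[OF assms(2)[OF t], of y] by simp
    also have "\<dots> \<le> (\<Sum>b\<in>Basis. \<bar>y \<bullet> b\<bar> * norm (G t b))"
      by (rule order_trans[OF norm_sum]) simp
    also have "\<dots> \<le> (\<Sum>b\<in>Basis. norm y * \<bar>B b\<bar>)"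
    proof (rule sum_mono, rule mult_mono)
      fix b :: 'b assume "b \<in> Basis"
      then show "\<bar>y \<bullet> b\<bar> \<le> norm y" by (rule Basis_le_norm)
      show "norm (G t b) \<le> \<bar>B b\<bar>" using B[OF t, of b] by linarith
    qed auto
    also have "\<dots> = norm y * (\<Sum>b\<in>Basis. \<bar>B b\<bar>)" by (simp add: sum_distrib_left)
    also have "\<dots> \<le> K * norm y" by (simp add: K_def algebra_simps)
    finally show ?thesis .
  qed
  ultimately show ?thesis using that by blast
qed

text \<open>Continuity is assumed for fixed arguments only; linearity in the argument makes it joint.\<close>

lemma linear_family_continuous_apply:
  fixes G :: "'a::metric_space \<Rightarrow> 'b::euclidean_space \<Rightarrow> 'c::real_normed_vector"
  assumes "\<And>t. t \<in> C \<Longrightarrow> linear (G t)" "\<And>y. continuous_on C (\<lambda>t. G t y)" "continuous_on C \<phi>"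
  shows "continuous_on C (\<lambda>t. G t (\<phi> t))"
proof -
  have "continuous_on C (\<lambda>t. \<Sum>b\<in>Basis. (\<phi> t \<bullet> b) *\<^sub>R G t b)"
    by (intro continuous_intros assms)
  then show ?thesis
    by (rule continuous_on_eq) (use linear_basis_expansion[OF assms(1)] in metis)
qed

text \<open>The function \<open>|g(\<tau>)|\<^sup>2 e\<^sup>-\<^sup>2\<^sup>K\<^sup>\<tau>\<close> has nonpositive derivative, vanishes at \<open>s\<close> and is nonnegative.\<close>

lemma norm_derivative_bound_imp_zero_right:
  fixes g :: "real \<Rightarrow> 'a::real_inner"
  assumes "s \<le> t" "\<And>\<tau>. \<tau> \<in> {s..t} \<Longrightarrow> (g has_vector_derivative g' \<tau>) (at \<tau>)"
    "\<And>\<tau>. \<tau> \<in> {s..t} \<Longrightarrow> norm (g' \<tau>) \<le> K * norm (g \<tau>)" "g s = 0"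
  shows "g t = 0"
proof -
  let ?h = "\<lambda>\<tau>. (g \<tau> \<bullet> g \<tau>) * exp (- 2 * K * \<tau>)"
  have "\<exists>y. (?h has_real_derivative y) (at \<tau>) \<and> y \<le> 0" if \<tau>: "s \<le> \<tau>" "\<tau> \<le> t" for \<tau>
  proof (intro exI conjI)
    have g: "(g has_derivative (\<lambda>h. h *\<^sub>R g' \<tau>)) (at \<tau>)"
      using assms(2)[of \<tau>] \<tau> by (simp add: has_vector_derivative_def)
    have "((\<lambda>\<tau>. g \<tau> \<bullet> g \<tau>) has_real_derivative 2 * (g \<tau> \<bullet> g' \<tau>)) (at \<tau>)"
      unfolding has_field_derivative_def
      by (rule has_derivative_eq_rhs[OF has_derivative_inner[OF g g]])
        (auto simp: inner_commute algebra_simps)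
    then show "(?h has_real_derivative 2 * (g \<tau> \<bullet> g' \<tau>) * exp (- 2 * K * \<tau>)
        + (g \<tau> \<bullet> g \<tau>) * (exp (- 2 * K * \<tau>) * (- 2 * K))) (at \<tau>)"
      by (auto intro!: derivative_eq_intros)
    have "g \<tau> \<bullet> g' \<tau> \<le> norm (g \<tau>) * norm (g' \<tau>)" by (rule norm_cauchy_schwarz)
    also have "\<dots> \<le> norm (g \<tau>) * (K * norm (g \<tau>))"
      using assms(3)[of \<tau>] \<tau> by (intro mult_left_mono) auto
    also have "\<dots> = K * (g \<tau> \<bullet> g \<tau>)" by (simp add: power2_norm_eq_inner[symmetric] power2_eq_square)
    finally have "(g \<tau> \<bullet> g' \<tau> - K * (g \<tau> \<bullet> g \<tau>)) * (2 * exp (- 2 * K * \<tau>)) \<le> 0"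
      by (intro mult_nonpos_nonneg) auto
    then show "2 * (g \<tau> \<bullet> g' \<tau>) * exp (- 2 * K * \<tau>)
        + (g \<tau> \<bullet> g \<tau>) * (exp (- 2 * K * \<tau>) * (- 2 * K)) \<le> 0"
      by (simp add: algebra_simps)
  qed
  from DERIV_nonpos_imp_nonincreasing[OF assms(1) this] have "?h t \<le> ?h s" by blast
  then have "(g t \<bullet> g t) * exp (- 2 * K * t) \<le> 0" using assms(4) by simp
  then have "g t \<bullet> g t \<le> 0" by (simp add: mult_le_0_iff not_le)
  then show ?thesis using inner_gt_zero_iff[of "g t"] by linarith
qed

text \<open>Uniqueness for linear equations, in both time directions.\<close>

lemma norm_derivative_bound_imp_zero:
  fixes g :: "real \<Rightarrow> 'a::real_inner"
  assumes "\<And>\<tau>. \<tau> \<in> closed_segment s t \<Longrightarrow> (g has_vector_derivative g' \<tau>) (at \<tau>)"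
    "\<And>\<tau>. \<tau> \<in> closed_segment s t \<Longrightarrow> norm (g' \<tau>) \<le> K * norm (g \<tau>)" "g s = 0"
  shows "g t = 0"
proof (cases "s \<le> t")
  case True
  then show ?thesis
    using assms norm_derivative_bound_imp_zero_right[OF True, of g g' K]
    by (auto simp: closed_segment_eq_real_ivl)
next
  case False
  have "(\<lambda>\<tau>. g (- \<tau>)) (- t) = 0"
  proof (rule norm_derivative_bound_imp_zero_right[of "- s" "- t" _ "\<lambda>\<tau>. - g' (- \<tau>)" K])
    fix \<tau> assume "\<tau> \<in> {- s..- t}"
    then have \<tau>: "- \<tau> \<in> closed_segment s t" using False by (auto simp: closed_segment_eq_real_ivl)
    have "((g \<circ> uminus) has_vector_derivative (- 1) *\<^sub>R g' (- \<tau>)) (at \<tau>)"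
      by (rule vector_diff_chain_at) (auto intro!: derivative_eq_intros assms(1) \<tau>)
    then show "((\<lambda>\<tau>. g (- \<tau>)) has_vector_derivative - g' (- \<tau>)) (at \<tau>)" by (simp add: o_def)
    show "norm (- g' (- \<tau>)) \<le> K * norm (g (- \<tau>))" using assms(2)[OF \<tau>] by simp
  qed (use False assms(3) in auto)
  then show ?thesis by simp
qed

text \<open>Picard iteration. The contraction principle is applied to bounded continuous functions on the whole
  real line, which form a complete space; for this the time variable of the integral is clamped to
  the interval of radius \<open>\<delta>\<close> around \<open>a\<close>. A solution on an open interval on both sides of \<open>a\<close> is needed,
  since it will be differentiated at \<open>a\<close>; this is why the integrals start at the left end point and
  the value at \<open>a\<close> is subtracted.\<close>

lemma linear_ode_local_solution:
  fixes G :: "real \<Rightarrow> 'a::euclidean_space \<Rightarrow> 'a"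
  assumes "open J" "a \<in> J" "\<And>t. t \<in> J \<Longrightarrow> linear (G t)" "\<And>y. continuous_on J (\<lambda>t. G t y)"
  obtains \<delta> f where "\<delta> > 0" "{a - \<delta><..<a + \<delta>} \<subseteq> J" "f a = \<eta>"
    "\<And>t. t \<in> {a - \<delta><..<a + \<delta>} \<Longrightarrow> (f has_vector_derivative G t (f t)) (at t)"
proof -
  obtain r where r: "r > 0" "cball a r \<subseteq> J" using assms(1,2) open_contains_cball by blast
  have cr: "continuous_on (cball a r) (\<lambda>t. G t y)" for y
    using assms(4) r(2) continuous_on_subset by blast
  obtain K where K: "K > 0" "\<And>t y. t \<in> cball a r \<Longrightarrow> norm (G t y) \<le> K * norm y"
    by (rule linear_family_bounded[OF compact_cball[of a r], of G]) (use assms r cr in auto)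
  \<comment> \<open>Each of the two integrals below then changes by at most a quarter of the distance of the arguments.\<close>
  define \<delta> where "\<delta> = min r (1 / (8 * K))"
  have \<delta>: "\<delta> > 0" "\<delta> \<le> r" "\<delta> * K \<le> 1 / 8"
    using r K by (auto simp: \<delta>_def min_def field_simps)
  let ?I = "{a - \<delta>..a + \<delta>}"
  have I: "?I \<subseteq> cball a r" using \<delta> by (auto simp: dist_real_def)
  have IJ: "?I \<subseteq> J" using I r by blast
  define cl where "cl t = max (a - \<delta>) (min (a + \<delta>) t)" for t :: real
  have cl: "cl t \<in> ?I" for t using \<delta>(1) by (auto simp: cl_def)
  define int where "int \<phi> t = integral {a - \<delta>..t} (\<lambda>s. G s (\<phi> s))" for \<phi> t
  have contG: "continuous_on ?I (\<lambda>s. G s (\<phi> s))" if "continuous_on UNIV \<phi>" for \<phi>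
    by (rule linear_family_continuous_apply)
      (use assms IJ that in \<open>auto intro: continuous_on_subset\<close>)
  have int_deriv: "(int \<phi> has_vector_derivative G t (\<phi> t)) (at t within ?I)"
    if "continuous_on UNIV \<phi>" "t \<in> ?I" for \<phi> t
    unfolding int_def by (rule integral_has_vector_derivative[OF contG[OF that(1)] that(2)])
  have int_cont: "continuous_on ?I (int \<phi>)" if "continuous_on UNIV \<phi>" for \<phi>
    using int_deriv[OF that] by (intro continuous_on_vector_derivative)
  have int_diff: "norm (int \<phi> t - int \<psi> t) \<le> (1 / 4) * e"
    if "continuous_on UNIV \<phi>" "continuous_on UNIV \<psi>" "\<And>s. norm (\<phi> s - \<psi> s) \<le> e" "t \<in> ?I" for \<phi> \<psi> t e
  proof -
    have sub: "{a - \<delta>..t} \<subseteq> ?I" using that(4) by auto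
    have io: "(\<lambda>s. G s (\<phi> s)) integrable_on {a - \<delta>..t}" "(\<lambda>s. G s (\<psi> s)) integrable_on {a - \<delta>..t}"
      using contG[OF that(1)] contG[OF that(2)] sub
      by (auto intro!: integrable_continuous_interval elim: continuous_on_subset)
    have e: "0 \<le> e" using that(3)[of 0] norm_ge_zero order_trans by blast
    have "norm (int \<phi> t - int \<psi> t) = norm (integral {a - \<delta>..t} (\<lambda>s. G s (\<phi> s) - G s (\<psi> s)))"
      unfolding int_def by (subst integral_diff[OF io]) simp
    also have "\<dots> \<le> K * e * (t - (a - \<delta>))"
    proof (rule integral_bound)
      show "continuous_on {a - \<delta>..t} (\<lambda>s. G s (\<phi> s) - G s (\<psi> s))"
        using contG[OF that(1)] contG[OF that(2)] sub
        by (auto intro!: continuous_on_diff elim: continuous_on_subset)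
      fix s assume "s \<in> {a - \<delta>..t}"
      then have s: "s \<in> ?I" using sub by blast
      have "norm (G s (\<phi> s) - G s (\<psi> s)) = norm (G s (\<phi> s - \<psi> s))"
        using s IJ by (subst linear_diff[OF assms(3)]) auto
      also have "\<dots> \<le> K * norm (\<phi> s - \<psi> s)" using s I by (intro K) auto
      also have "\<dots> \<le> K * e" using that(3) K by (intro mult_left_mono) auto
      finally show "norm (G s (\<phi> s) - G s (\<psi> s)) \<le> K * e" .
    qed (use that(4) in auto)
    also have "\<dots> \<le> K * e * (2 * \<delta>)" using that(4) K e by (intro mult_left_mono) auto
    also have "\<dots> = (\<delta> * K) * (2 * e)" by simp
    also have "\<dots> \<le> (1 / 8) * (2 * e)" using \<delta>(3) e by (intro mult_right_mono) auto
    finally show ?thesis by simp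
  qed
  define T where "T \<phi> t = \<eta> + (int \<phi> (cl t) - int \<phi> a)" for \<phi> t
  have aI: "a \<in> ?I" using \<delta> by auto
  have T_bcont: "T \<phi> \<in> bcontfun" if "continuous_on UNIV \<phi>" for \<phi>
  proof -
    have "continuous_on UNIV cl" unfolding cl_def by (intro continuous_intros)
    then have 1: "continuous_on UNIV (\<lambda>t. int \<phi> (cl t))"
      by (rule continuous_on_compose2[OF int_cont[OF that]]) (use cl in auto)
    have "bounded (int \<phi> ` ?I)"
      by (intro compact_imp_bounded compact_continuous_image int_cont that) simp
    then obtain B where "\<And>t. t \<in> ?I \<Longrightarrow> norm (int \<phi> t) \<le> B" unfolding bounded_iff by blast
    then have "norm (T \<phi> t) \<le> norm \<eta> + (B + B)" for t
      unfolding T_def using cl aI by (meson add_mono norm_triangle_ineq norm_triangle_ineq4 order_refl order_trans)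
    then have "bounded (range (T \<phi>))" by (auto simp: bounded_iff)
    moreover have "continuous_on UNIV (T \<phi>)" unfolding T_def by (intro continuous_intros 1)
    ultimately show ?thesis by (simp add: bcontfun_def)
  qed
  define TT where "TT \<phi> = Bcontfun (T (apply_bcontfun \<phi>))" for \<phi> :: "real \<Rightarrow>\<^sub>C 'a"
  have c: "continuous_on UNIV (apply_bcontfun \<phi>)" for \<phi> :: "real \<Rightarrow>\<^sub>C 'a"
    using apply_bcontfun[of \<phi>] by (simp add: bcontfun_def)
  have TT: "apply_bcontfun (TT \<phi>) = T (apply_bcontfun \<phi>)" for \<phi>
    unfolding TT_def by (rule Bcontfun_inverse[OF T_bcont[OF c]])
  have "dist (TT \<phi>) (TT \<psi>) \<le> (1 / 2) * dist \<phi> \<psi>" for \<phi> \<psi>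
  proof (rule dist_bound)
    fix t
    have b: "norm (\<phi> s - \<psi> s) \<le> dist \<phi> \<psi>" for s
      using dist_bounded[of \<phi> s \<psi>] by (simp add: dist_norm)
    have "dist (TT \<phi> t) (TT \<psi> t) = norm ((int \<phi> (cl t) - int \<psi> (cl t)) - (int \<phi> a - int \<psi> a))"
      by (simp add: TT T_def dist_norm algebra_simps)
    also have "\<dots> \<le> (1 / 4) * dist \<phi> \<psi> + (1 / 4) * dist \<phi> \<psi>"
      by (intro order_trans[OF norm_triangle_ineq4] add_mono int_diff c b cl aI)
    finally show "dist (TT \<phi> t) (TT \<psi> t) \<le> (1 / 2) * dist \<phi> \<psi>" by simp
  qed
  then have "\<exists>!\<phi>. TT \<phi> = \<phi>" by (intro banach_fix_type[of "1 / 2"]) auto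
  then obtain \<phi> where \<phi>: "TT \<phi> = \<phi>" by blast
  have fp: "\<phi> t = \<eta> + (int \<phi> (cl t) - int \<phi> a)" for t
    using TT[of \<phi>] unfolding \<phi> T_def by (rule fun_cong)
  have clI: "cl t = t" if "t \<in> ?I" for t using that by (auto simp: cl_def)
  show ?thesis
  proof
    show "\<delta> > 0" by fact
    show "{a - \<delta><..<a + \<delta>} \<subseteq> J" using IJ by force
    show "\<phi> a = \<eta>" using fp[of a] clI[OF aI] by simp
    fix t assume t: "t \<in> {a - \<delta><..<a + \<delta>}"
    have "(int \<phi> has_vector_derivative G t (\<phi> t)) (at t within {a - \<delta><..<a + \<delta>})"
      by (rule has_vector_derivative_within_subset[OF int_deriv[OF c]]) (use t in auto)
    then have "(int \<phi> has_vector_derivative G t (\<phi> t)) (at t)"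
      by (simp only: at_within_open[OF t open_greaterThanLessThan])
    then have "((\<lambda>t. \<eta> + (int \<phi> t - int \<phi> a)) has_vector_derivative G t (\<phi> t)) (at t)"
      by (auto intro!: derivative_eq_intros)
    then show "(\<phi> has_vector_derivative G t (\<phi> t)) (at t)"
    proof (rule has_vector_derivative_transform_within_open[OF _ open_greaterThanLessThan t])
      fix s assume "s \<in> {a - \<delta><..<a + \<delta>}"
      then have "cl s = s" by (intro clI) auto
      then show "\<eta> + (int \<phi> s - int \<phi> a) = \<phi> s" using fp[of s] by simp
    qed
  qed
qed

section \<open>Parallel transport on a parallelizable manifold\<close>

lemma smooth_atlas_std: "smooth_atlas std_atlas"
  by (simp add: smooth_atlas_def std_atlas_def cinv_def smooth_on_bounded_linear_self[OF bounded_linear_ident, folded id_def])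

lemma openin_mtop_std: "openin (mtop std_atlas) J \<longleftrightarrow> open J"
  by (simp add: openin_mtop[OF smooth_atlas_std]) (simp add: std_atlas_def points_def)

lemma smooth_curve_on_iff:
  fixes L :: "('q, 'e::euclidean_space) atlas"
  shows "smooth_curve_on L J \<gamma> \<longleftrightarrow> open J \<and> is_interval J \<and> \<gamma> ` J \<subseteq> points L \<and>
    (\<forall>d\<in>L. open (J \<inter> \<gamma> -` cdom d) \<and> smooth_on (J \<inter> \<gamma> -` cdom d) (coord d \<circ> \<gamma>))"
  unfolding smooth_curve_on_def smooth_map_on_def openin_mtop_std
  by (auto simp: std_atlas_def cinv_def)

lemma smooth_curve_subset:
  assumes "smooth_curve_on L J \<gamma>" "open J'" "is_interval J'" "J' \<subseteq> J"
  shows "smooth_curve_on L J' \<gamma>"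
  unfolding smooth_curve_on_iff
proof (intro conjI ballI assms(2,3))
  show "\<gamma> ` J' \<subseteq> points L" using assms(1,4) unfolding smooth_curve_on_iff by blast
  fix d assume d: "d \<in> L"
  have eq: "J' \<inter> \<gamma> -` cdom d = J' \<inter> (J \<inter> \<gamma> -` cdom d)" using assms(4) by blast
  show "open (J' \<inter> \<gamma> -` cdom d)"
    unfolding eq using assms(1,2) d unfolding smooth_curve_on_iff by blast
  have "smooth_on (J \<inter> \<gamma> -` cdom d) (coord d \<circ> \<gamma>)"
    using assms(1) d unfolding smooth_curve_on_iff by blast
  then show "smooth_on (J' \<inter> \<gamma> -` cdom d) (coord d \<circ> \<gamma>)"
    by (rule smooth_on_subset) (use assms(4) in auto)
qed

context manifold_atlas
begin

lemma smooth_curve_point: "smooth_curve_on M J \<gamma> \<Longrightarrow> t \<in> J \<Longrightarrow> \<gamma> t \<in> points M"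
  unfolding smooth_curve_on_iff by blast

lemma smooth_curve_chart:
  assumes "smooth_curve_on M J \<gamma>" "c \<in> M"
  shows "open (J \<inter> \<gamma> -` cdom c)" "smooth_on (J \<inter> \<gamma> -` cdom c) (coord c \<circ> \<gamma>)"
  using assms unfolding smooth_curve_on_iff by blast+

lemma velocity_has_vector_derivative:
  assumes "smooth_curve_on M J \<gamma>" "c \<in> M" "t \<in> J" "\<gamma> t \<in> cdom c"
  shows "(coord c \<circ> \<gamma> has_vector_derivative velocity M \<gamma> t c) (at t)"
proof -
  have "coord c \<circ> \<gamma> differentiable (at t)"
    using smooth_on_differentiable[OF smooth_curve_chart(2)[OF assms(1,2)]] assms(3,4) by auto
  then show ?thesis using assms(2,4) by (simp add: velocity_def vector_derivative_works[symmetric])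
qed

text \<open>The chain rule for the change of coordinates is the transformation law of tangent vectors.\<close>

lemma velocity_in_tspace:
  assumes "smooth_curve_on M J \<gamma>" "t \<in> J"
  shows "velocity M \<gamma> t \<in> tspace M (\<gamma> t)"
proof (rule tspaceI)
  show "velocity M \<gamma> t c = 0" if "\<not> (c \<in> M \<and> \<gamma> t \<in> cdom c)" for c
    using that by (auto simp: velocity_def)
  fix c d assume cd: "c \<in> M" "d \<in> M" "\<gamma> t \<in> cdom c" "\<gamma> t \<in> cdom d"
  note J = jac_linear[OF cd]
  have "((coord d \<circ> cinv c) \<circ> (coord c \<circ> \<gamma>) has_derivative
      jac c d (\<gamma> t) \<circ> (\<lambda>h. h *\<^sub>R velocity M \<gamma> t c)) (at t)"
    by (rule diff_chain_at)
      (use velocity_has_vector_derivative[OF assms(1) cd(1) assms(2) cd(3)] jac_has_derivative[OF cd]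
        in \<open>auto simp: has_vector_derivative_def\<close>)
  moreover have "jac c d (\<gamma> t) \<circ> (\<lambda>h. h *\<^sub>R velocity M \<gamma> t c) =
      (\<lambda>h. h *\<^sub>R jac c d (\<gamma> t) (velocity M \<gamma> t c))"
    by (rule ext) (simp only: comp_apply linear_scale[OF J])
  ultimately have "((coord d \<circ> cinv c) \<circ> (coord c \<circ> \<gamma>) has_vector_derivative
      jac c d (\<gamma> t) (velocity M \<gamma> t c)) (at t)"
    by (simp only: has_vector_derivative_def)
  then have "(coord d \<circ> \<gamma> has_vector_derivative jac c d (\<gamma> t) (velocity M \<gamma> t c)) (at t)"
    by (rule has_vector_derivative_transform_within_open[OF _ smooth_curve_chart(1)[OF assms(1) cd(1)]])
      (use assms cd in auto)
  then show "velocity M \<gamma> t d = jac c d (\<gamma> t) (velocity M \<gamma> t c)"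
    using velocity_has_vector_derivative[OF assms(1) cd(2) assms(2) cd(4)] vector_derivative_unique_at
    by blast
qed

text \<open>A straight line in a chart, on a time interval so short that it stays in the chart.\<close>

lemma ex_smooth_curve:
  assumes "p \<in> points M" "v \<in> tspace M p"
  obtains J \<gamma> where "smooth_curve_on M J \<gamma>" "0 \<in> J" "\<gamma> 0 = p" "velocity M \<gamma> 0 = v"
proof -
  obtain c where c: "c \<in> M" "p \<in> cdom c" using assms(1) by (auto simp: points_def)
  define l where "l t = coord c p + t *\<^sub>R v c" for t :: real
  have l_deriv: "(l has_vector_derivative v c) (at t)" for t
    unfolding l_def by (auto intro!: derivative_eq_intros)
  have l_cont: "continuous_on UNIV l" unfolding l_def by (intro continuous_intros)
  have "open (l -` (coord c ` cdom c))"
    using open_vimage[OF open_coord_dom[OF c(1)] l_cont] .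
  moreover have "0 \<in> l -` (coord c ` cdom c)" using c by (simp add: l_def)
  ultimately obtain r where r: "r > 0" "ball 0 r \<subseteq> l -` (coord c ` cdom c)"
    using openE by metis
  define \<gamma> where "\<gamma> t = cinv c (l t)" for t
  have in_c: "\<gamma> t \<in> cdom c" "coord c (\<gamma> t) = l t" if "t \<in> ball 0 r" for t
  proof -
    have "l t \<in> coord c ` cdom c" using that r(2) by blast
    then show "\<gamma> t \<in> cdom c" "coord c (\<gamma> t) = l t"
      unfolding \<gamma>_def by (rule cinv_in, rule coord_cinv)
  qed
  have curve: "smooth_curve_on M (ball 0 r) \<gamma>"
    unfolding smooth_curve_on_iff
  proof (intro conjI ballI)
    show "is_interval (ball (0::real) r)" by (simp add: ball_eq_greaterThanLessThan)
    show "\<gamma> ` ball 0 r \<subseteq> points M" using in_c cdom_subset_points[OF c(1)] by blast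
    fix d assume d: "d \<in> M"
    let ?T = "coord c ` (cdom c \<inter> cdom d)"
    have T: "open ?T" using open_coord_overlap[OF c(1) d] .
    have eq: "ball 0 r \<inter> \<gamma> -` cdom d = ball 0 r \<inter> l -` ?T"
    proof -
      have "\<gamma> t \<in> cdom d \<longleftrightarrow> l t \<in> ?T" if "t \<in> ball 0 r" for t
        using in_c[OF that] c(1) inj_onD[OF inj_coord[OF c(1)]] by (auto simp: \<gamma>_def) (metis IntI imageI)
      then show ?thesis by blast
    qed
    show op: "open (ball 0 r \<inter> \<gamma> -` cdom d)"
      unfolding eq using open_vimage[OF T l_cont] by blast
    have "smooth_on (ball 0 r \<inter> \<gamma> -` cdom d) l"
      unfolding l_def
      by (intro smooth_on_add smooth_on_const op smooth_on_subset[OF smooth_on_bounded_linear_self subset_UNIV]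
          bounded_linear_scaleR_left)
    from smooth_on_compose[OF smooth_transition[OF c(1) d] this op T]
    show "smooth_on (ball 0 r \<inter> \<gamma> -` cdom d) (coord d \<circ> \<gamma>)"
      unfolding eq by (auto simp: \<gamma>_def o_def)
  qed simp
  have 0: "0 \<in> ball 0 r" using r by simp
  have \<gamma>0: "\<gamma> 0 = p" using c by (simp add: \<gamma>_def l_def)
  have "(coord c \<circ> \<gamma> has_vector_derivative v c) (at 0)"
    by (rule has_vector_derivative_transform_within_open[OF l_deriv open_ball 0]) (use in_c in auto)
  then have "velocity M \<gamma> 0 c = v c"
    using velocity_has_vector_derivative[OF curve c(1) 0] c(2) \<gamma>0 vector_derivative_unique_at by metis
  then have "velocity M \<gamma> 0 = v"
    using tspace_eqI[OF velocity_in_tspace[OF curve 0] _ c(1)] assms(2) c(2) \<gamma>0 by auto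
  then show ?thesis using that curve 0 \<gamma>0 by blast
qed

end

lemma transport_preserves_cong:
  assumes "manifold_atlas L" "\<And>u. u \<in> points L \<Longrightarrow> S u = S' u"
  shows "transport_preserves L D S \<longleftrightarrow> transport_preserves L D S'"
proof -
  have "S (\<gamma> s) = S' (\<gamma> s)" if "smooth_curve_on L J \<gamma>" "s \<in> J" for J \<gamma> s
    using assms(2)[OF manifold_atlas.smooth_curve_point[OF assms(1) that]] .
  then show ?thesis
    unfolding transport_preserves_def parallel_transport_def by blast
qed

text \<open>\<open>\<Psi>\<close> is a global trivialization of the tangent bundle by a vector space: it turns a constant into a
  field, and \<open>\<Phi>\<close> returns the constant from the value of the field at a point.\<close>

locale parallelization = manifold_connection L D
  for L :: "('q, 'e::euclidean_space) atlas" and D +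
  fixes \<Psi> :: "'f::euclidean_space \<Rightarrow> ('q, 'e) vfield" and \<Phi> :: "'q \<Rightarrow> ('q, 'e) tvec \<Rightarrow> 'f"
  assumes Psi_field: "smooth_vfield_on L (points L) (\<Psi> \<eta>)"
    and Psi_linear: "u \<in> points L \<Longrightarrow> linear (\<lambda>\<eta>. \<Psi> \<eta> u d)"
    and Phi_Psi: "u \<in> points L \<Longrightarrow> \<Phi> u (\<Psi> \<eta> u) = \<eta>"
    and Psi_Phi: "u \<in> points L \<Longrightarrow> X \<in> tspace L u \<Longrightarrow> \<Psi> (\<Phi> u X) u = X"
    and Phi_smooth: "smooth_vfield_on L U Y \<Longrightarrow> c \<in> L \<Longrightarrow>
      smooth_on (coord c ` (U \<inter> cdom c)) (\<lambda>x. \<Phi> (cinv c x) (Y (cinv c x)))"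
begin

text \<open>The endomorphism \<open>\<Lambda>(\<gamma>'(t))\<close>, that is, the matrix of the connection along a curve.\<close>

abbreviation along :: "(real \<Rightarrow> 'q) \<Rightarrow> real \<Rightarrow> 'f \<Rightarrow> 'f" where
  "along \<gamma> t \<eta> \<equiv> \<Phi> (\<gamma> t) (D (\<gamma> t) (velocity L \<gamma> t) (\<Psi> \<eta>))"

lemma Psi_in_tspace: "u \<in> points L \<Longrightarrow> \<Psi> \<eta> u \<in> tspace L u"
  using smooth_vfieldD(2)[OF Psi_field] .

lemma Psi_tadd: "u \<in> points L \<Longrightarrow> \<Psi> (\<eta> + \<zeta>) u = tadd (\<Psi> \<eta> u) (\<Psi> \<zeta> u)"
  unfolding tadd_def using linear_add[OF Psi_linear] by blast

lemma Psi_tscale: "u \<in> points L \<Longrightarrow> \<Psi> (r *\<^sub>R \<eta>) u = tscale r (\<Psi> \<eta> u)"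
  unfolding tscale_def using linear_scale[OF Psi_linear] by blast

lemma Phi_tadd:
  assumes "u \<in> points L" "X \<in> tspace L u" "Y \<in> tspace L u"
  shows "\<Phi> u (tadd X Y) = \<Phi> u X + \<Phi> u Y"
proof -
  have "tadd X Y = \<Psi> (\<Phi> u X + \<Phi> u Y) u"
    using Psi_tadd[OF assms(1)] Psi_Phi[OF assms(1,2)] Psi_Phi[OF assms(1,3)] by simp
  then show ?thesis using Phi_Psi[OF assms(1)] by simp
qed

lemma Phi_tscale:
  assumes "u \<in> points L" "X \<in> tspace L u"
  shows "\<Phi> u (tscale r X) = r *\<^sub>R \<Phi> u X"
proof -
  have "tscale r X = \<Psi> (r *\<^sub>R \<Phi> u X) u"
    using Psi_tscale[OF assms(1)] Psi_Phi[OF assms] by simp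
  then show ?thesis using Phi_Psi[OF assms(1)] by simp
qed

lemma Phi_tzero: "u \<in> points L \<Longrightarrow> \<Phi> u tzero = 0"
  using Phi_tscale[OF _ tzero_in_tspace, of u 0] by (simp add: tscale_def tzero_def)

lemma Phi_tsum:
  assumes "finite I" "u \<in> points L" "\<And>i. i \<in> I \<Longrightarrow> E i \<in> tspace L u"
  shows "\<Phi> u (tsum I f E) = (\<Sum>i\<in>I. f i *\<^sub>R \<Phi> u (E i))"
  using assms(1,3)
  by (induction I rule: finite_induct)
    (simp_all add: tsum_empty tsum_insert Phi_tzero[OF assms(2)] Phi_tadd[OF assms(2)] Phi_tscale[OF assms(2)]
      tscale_in_tspace tsum_in_tspace)

lemma conn_Psi_linear:
  assumes "u \<in> points L" "X \<in> tspace L u"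
  shows "linear (\<lambda>\<eta>. \<Phi> u (D u X (\<Psi> \<eta>)))"
proof (rule linearI)
  fix \<eta> \<zeta> :: 'f and r :: real
  have "D u X (\<Psi> (\<eta> + \<zeta>)) = D u X (\<lambda>q. tadd (\<Psi> \<eta> q) (\<Psi> \<zeta> q))"
    by (rule conn_cong[OF Psi_field smooth_vfield_tadd[OF Psi_field Psi_field] Psi_tadd assms])
  also have "\<dots> = tadd (D u X (\<Psi> \<eta>)) (D u X (\<Psi> \<zeta>))" by (rule conn_tadd[OF Psi_field Psi_field assms])
  finally show "\<Phi> u (D u X (\<Psi> (\<eta> + \<zeta>))) = \<Phi> u (D u X (\<Psi> \<eta>)) + \<Phi> u (D u X (\<Psi> \<zeta>))"
    using Phi_tadd[OF assms(1) conn_in_tspace[OF Psi_field assms] conn_in_tspace[OF Psi_field assms]] by simp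
  have "D u X (\<Psi> (r *\<^sub>R \<eta>)) = D u X (\<lambda>q. tscale r (\<Psi> \<eta> q))"
    by (rule conn_cong[OF Psi_field smooth_vfield_tscale[OF smooth_fun_const[OF openin_points] Psi_field]
          Psi_tscale assms])
  also have "\<dots> = tscale r (D u X (\<Psi> \<eta>))" by (rule conn_scale_const[OF Psi_field assms])
  finally show "\<Phi> u (D u X (\<Psi> (r *\<^sub>R \<eta>))) = r *\<^sub>R \<Phi> u (D u X (\<Psi> \<eta>))"
    using Phi_tscale[OF assms(1) conn_in_tspace[OF Psi_field assms]] by simp
qed

text \<open>The covariant derivative of \<open>V = \<Psi>(f)\<close> along \<open>\<gamma>\<close> is \<open>\<Psi>(f' + \<Lambda>(\<gamma>') f)\<close>. The sum on the left is the
  covariant derivative written in the chart \<open>c\<close>, as in the definition of a parallel field. The proof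
  differentiates the components of \<open>\<Psi>\<close> in the chart along the curve; the resulting derivative of
  \<open>\<Psi>\<close> in the direction \<open>\<gamma>'\<close> and the Christoffel term make up \<open>\<nabla>\<Psi>\<close>.\<close>

lemma covariant_derivative_along_curve:
  assumes "smooth_curve_on L J \<gamma>" "t \<in> J" "c \<in> L" "\<gamma> t \<in> cdom c"
    and V: "\<And>s. s \<in> J \<Longrightarrow> V s = \<Psi> (f s) (\<gamma> s)"
    and f: "(f has_vector_derivative f') (at t)"
  shows "\<exists>w. ((\<lambda>s. V s c) has_vector_derivative w) (at t) \<and>
    w + D (\<gamma> t) (velocity L \<gamma> t) (const_field L c (V t c)) c =
      \<Psi> (f' + along \<gamma> t (f t)) (\<gamma> t) c"
proof -
  let ?u = "\<gamma> t" and ?X = "velocity L \<gamma> t" and ?T = "J \<inter> \<gamma> -` cdom c"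
  let ?\<psi> = "\<lambda>\<eta> x. \<Psi> \<eta> (cinv c x) c"
  let ?d\<psi> = "\<lambda>\<eta>. frechet_derivative (?\<psi> \<eta>) (at (coord c ?u))"
  have u: "?u \<in> points L" "?X \<in> tspace L ?u"
    using smooth_curve_point[OF assms(1,2)] velocity_in_tspace[OF assms(1,2)] .
  have x0: "coord c ?u \<in> coord c ` (points L \<inter> cdom c)" using u assms by auto
  have \<psi>: "(?\<psi> \<eta> has_derivative ?d\<psi> \<eta>) (at (coord c ?u))" for \<eta>
    by (rule smooth_on_has_derivative[OF smooth_vfieldD(3)[OF Psi_field assms(3)] x0])
  have \<psi>_sum: "\<Psi> \<eta> q c = (\<Sum>b\<in>Basis. (\<eta> \<bullet> b) *\<^sub>R \<Psi> b q c)" if "q \<in> points L" for \<eta> q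
    by (rule linear_basis_expansion[OF Psi_linear[OF that]])
  have d\<psi>_sum: "?d\<psi> \<eta> h = (\<Sum>b\<in>Basis. (\<eta> \<bullet> b) *\<^sub>R ?d\<psi> b h)" for \<eta> h
  proof -
    have "((\<lambda>x. \<Sum>b\<in>Basis. (\<eta> \<bullet> b) *\<^sub>R ?\<psi> b x) has_derivative
        (\<lambda>h. \<Sum>b\<in>Basis. (\<eta> \<bullet> b) *\<^sub>R ?d\<psi> b h)) (at (coord c ?u))"
      by (intro has_derivative_sum has_derivative_scaleR_right \<psi>)
    then have "(?\<psi> \<eta> has_derivative (\<lambda>h. \<Sum>b\<in>Basis. (\<eta> \<bullet> b) *\<^sub>R ?d\<psi> b h)) (at (coord c ?u))"
      by (rule has_derivative_transform_within_open[OF _ openin_coord[OF openin_points assms(3)] x0])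
        (use \<psi>_sum assms(3) in auto)
    from frechet_derivative_eqI[OF this] show ?thesis by (rule fun_cong)
  qed
  have x: "(coord c \<circ> \<gamma> has_derivative (\<lambda>h. h *\<^sub>R ?X c)) (at t)"
    using velocity_has_vector_derivative[OF assms(1,3,2,4)] by (simp add: has_vector_derivative_def)
  have \<psi>x: "((\<lambda>s. ?\<psi> b (coord c (\<gamma> s))) has_vector_derivative ?d\<psi> b (?X c)) (at t)" for b
  proof -
    have "(?\<psi> b \<circ> (coord c \<circ> \<gamma>) has_derivative ?d\<psi> b \<circ> (\<lambda>h. h *\<^sub>R ?X c)) (at t)"
      by (rule diff_chain_at[OF x]) (use \<psi> in simp)
    then show ?thesis
      by (simp add: has_vector_derivative_def o_def linear_scale[OF has_derivative_linear[OF \<psi>]])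
  qed
  have fb: "((\<lambda>s. f s \<bullet> b) has_real_derivative f' \<bullet> b) (at t)" for b
    using has_derivative_inner_left[OF f[unfolded has_vector_derivative_def], of b]
    by (simp add: has_field_derivative_def mult_commute_abs)
  let ?w = "\<Sum>b\<in>Basis. (f t \<bullet> b) *\<^sub>R ?d\<psi> b (?X c) + (f' \<bullet> b) *\<^sub>R ?\<psi> b (coord c ?u)"
  have "((\<lambda>s. \<Sum>b\<in>Basis. (f s \<bullet> b) *\<^sub>R ?\<psi> b (coord c (\<gamma> s))) has_vector_derivative ?w) (at t)"
    by (intro has_vector_derivative_sum has_vector_derivative_scaleR fb \<psi>x)
  then have "((\<lambda>s. V s c) has_vector_derivative ?w) (at t)"
    by (rule has_vector_derivative_transform_within_open[OF _ smooth_curve_chart(1)[OF assms(1,3)]])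
      (use assms(2-4) V \<psi>_sum smooth_curve_point[OF assms(1)] in auto)
  moreover have "?w = ?d\<psi> (f t) (?X c) + \<Psi> f' ?u c"
    unfolding sum.distrib d\<psi>_sum[symmetric] using \<psi>_sum[OF u(1), of f'] assms(3,4) by simp
  moreover have "D ?u ?X (\<Psi> (f t)) c = ?d\<psi> (f t) (?X c) + D ?u ?X (const_field L c (V t c)) c"
    using conn_in_chart[OF Psi_field u(1) assms(3,4) u(2), of "f t"] V[OF assms(2)] by simp
  moreover have "\<Psi> (\<Phi> ?u (D ?u ?X (\<Psi> (f t)))) ?u = D ?u ?X (\<Psi> (f t))"
    by (rule Psi_Phi[OF u(1) conn_in_tspace[OF Psi_field u]])
  ultimately show ?thesis
    by (intro exI[of _ ?w]) (simp add: linear_add[OF Psi_linear[OF u(1)]])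
qed

lemma parallel_along_Psi:
  assumes "smooth_curve_on L J \<gamma>"
    "\<And>t. t \<in> J \<Longrightarrow> (f has_vector_derivative - along \<gamma> t (f t)) (at t)"
  shows "parallel_along L D J \<gamma> (\<lambda>t. \<Psi> (f t) (\<gamma> t))"
  unfolding parallel_along_def
proof (intro ballI conjI impI)
  fix t assume t: "t \<in> J"
  show "\<Psi> (f t) (\<gamma> t) \<in> tspace L (\<gamma> t)" by (rule Psi_in_tspace[OF smooth_curve_point[OF assms(1) t]])
  fix c assume c: "c \<in> L" "\<gamma> t \<in> cdom c"
  obtain w where w: "((\<lambda>s. \<Psi> (f s) (\<gamma> s) c) has_vector_derivative w) (at t)"
    "w + D (\<gamma> t) (velocity L \<gamma> t) (const_field L c (\<Psi> (f t) (\<gamma> t) c)) c = 0"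
    using covariant_derivative_along_curve[OF assms(1) t c refl assms(2)[OF t]]
      linear_0[OF Psi_linear[OF smooth_curve_point[OF assms(1) t]]] by auto
  show "(\<lambda>s. \<Psi> (f s) (\<gamma> s) c) differentiable (at t)"
    using w(1) differentiableI_vector by blast
  show "vector_derivative (\<lambda>s. \<Psi> (f s) (\<gamma> s) c) (at t) +
      D (\<gamma> t) (velocity L \<gamma> t) (const_field L c (\<Psi> (f t) (\<gamma> t) c)) c = 0"
    using w vector_derivative_at by metis
qed

text \<open>A parallel field is differentiable in charts by definition; its coefficient function inherits this
  from the smoothness of \<open>\<Phi>\<close>, and then the formula for the covariant derivative along the curve
  applies.\<close>

lemma parallel_coefficients:
  assumes "smooth_curve_on L J \<gamma>" "parallel_along L D J \<gamma> V" "t \<in> J"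
  shows "((\<lambda>s. \<Phi> (\<gamma> s) (V s)) has_vector_derivative
    - along \<gamma> t (\<Phi> (\<gamma> t) (V t))) (at t)"
proof -
  have V: "V s \<in> tspace L (\<gamma> s)" if "s \<in> J" for s
    using assms(2) that by (simp add: parallel_along_def)
  note pt = smooth_curve_point[OF assms(1)]
  obtain c where c: "c \<in> L" "\<gamma> t \<in> cdom c" using pt[OF assms(3)] by (auto simp: points_def)
  let ?f = "\<lambda>s. \<Phi> (\<gamma> s) (V s)" and ?T = "J \<inter> \<gamma> -` cdom c"
  let ?\<phi> = "\<lambda>b x. \<Phi> (cinv c x) (const_field L c b (cinv c x))"
  have T: "open ?T" "t \<in> ?T" using smooth_curve_chart(1)[OF assms(1) c(1)] assms(3) c(2) by auto
  have Vc: "(\<lambda>s. V s c) differentiable (at t)"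
    using assms(2,3) c by (simp add: parallel_along_def)
  have "(\<lambda>s. \<Sum>b\<in>Basis. (V s c \<bullet> b) *\<^sub>R ?\<phi> b ((coord c \<circ> \<gamma>) s)) differentiable (at t)"
  proof (intro differentiable_sum differentiable_scaleR ballI finite_Basis)
    fix b :: 'e
    show "(\<lambda>s. V s c \<bullet> b) differentiable (at t)"
      using Vc unfolding differentiable_def by (elim exE) (rule exI, rule has_derivative_inner_left)
    have "smooth_on (coord c ` cdom c) (?\<phi> b)"
      using Phi_smooth[OF smooth_vfield_const_field[OF c(1)] c(1)] by simp
    then have "?\<phi> b differentiable (at ((coord c \<circ> \<gamma>) t))"
      by (rule smooth_on_differentiable) (use c in auto)
    moreover have "coord c \<circ> \<gamma> differentiable (at t)"
      by (rule smooth_on_differentiable[OF smooth_curve_chart(2)[OF assms(1) c(1)] T(2)])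
    ultimately show "(\<lambda>s. ?\<phi> b ((coord c \<circ> \<gamma>) s)) differentiable (at t)"
      using differentiable_chain_at[of "coord c \<circ> \<gamma>" t "?\<phi> b"] by (simp add: o_def)
  qed
  moreover have "(\<Sum>b\<in>Basis. (V s c \<bullet> b) *\<^sub>R ?\<phi> b ((coord c \<circ> \<gamma>) s)) = ?f s" if s: "s \<in> ?T" for s
  proof -
    have s': "s \<in> J" "\<gamma> s \<in> cdom c" using s by auto
    have "?f s = \<Phi> (\<gamma> s) (tsum Basis (\<lambda>b. V s c \<bullet> b) (\<lambda>b. const_field L c b (\<gamma> s)))"
      using tspace_expansion[OF V[OF s'(1)] c(1) s'(2)] by simp
    also have "\<dots> = (\<Sum>b\<in>Basis. (V s c \<bullet> b) *\<^sub>R \<Phi> (\<gamma> s) (const_field L c b (\<gamma> s)))"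
      by (rule Phi_tsum[OF finite_Basis pt[OF s'(1)] const_field_in_tspace[OF c(1) s'(2)]])
    finally show ?thesis using c(1) s'(2) by simp
  qed
  ultimately have "?f differentiable (at t)"
    by (rule differentiable_cong_open[OF T, rotated])
  then obtain f' where f': "(?f has_vector_derivative f') (at t)"
    using vector_derivative_works by blast
  let ?G = "along \<gamma> t (?f t)"
  obtain w where w: "((\<lambda>s. V s c) has_vector_derivative w) (at t)"
    "w + D (\<gamma> t) (velocity L \<gamma> t) (const_field L c (V t c)) c = \<Psi> (f' + ?G) (\<gamma> t) c"
    using covariant_derivative_along_curve[OF assms(1,3) c, of V ?f f'] Psi_Phi[OF pt V] f' by auto
  have "vector_derivative (\<lambda>s. V s c) (at t) + D (\<gamma> t) (velocity L \<gamma> t) (const_field L c (V t c)) c = 0"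
    using assms(2,3) c by (simp add: parallel_along_def)
  then have "\<Psi> (f' + ?G) (\<gamma> t) c = tzero c"
    using w vector_derivative_at[OF w(1)] by (simp add: tzero_def)
  then have "\<Psi> (f' + ?G) (\<gamma> t) = tzero"
    using tspace_eqI[OF Psi_in_tspace tzero_in_tspace c] pt[OF assms(3)] by blast
  then have "f' + ?G = 0"
    using Phi_Psi[OF pt[OF assms(3)]] Phi_tzero[OF pt[OF assms(3)]] by metis
  then have "f' = - ?G" by (simp add: eq_neg_iff_add_eq_0)
  then show ?thesis using f' by simp
qed

text \<open>In a chart, \<open>\<Lambda>(\<gamma>') \<eta>\<close> is a combination of smooth functions along the curve whose coefficients are the
  components of the velocity.\<close>

lemma connection_coefficients_continuous:
  assumes "smooth_curve_on L J \<gamma>"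
  shows "continuous_on J (\<lambda>t. along \<gamma> t \<eta>)"
proof (intro continuous_at_imp_continuous_on ballI)
  fix t0 assume t0: "t0 \<in> J"
  note pt = smooth_curve_point[OF assms(1)]
  obtain c where c: "c \<in> L" "\<gamma> t0 \<in> cdom c" using pt[OF t0] by (auto simp: points_def)
  let ?T = "J \<inter> \<gamma> -` cdom c"
  have T: "open ?T" "t0 \<in> ?T" using smooth_curve_chart(1)[OF assms(1) c(1)] t0 c(2) by auto
  have Psi_c: "smooth_vfield_on L (cdom c) (\<Psi> \<eta>)"
    by (rule smooth_vfield_subset[OF Psi_field openin_cdom[OF c(1)] cdom_subset_points[OF c(1)]])
  let ?H = "\<lambda>b x. \<Phi> (cinv c x) (D (cinv c x) (const_field L c b (cinv c x)) (\<Psi> \<eta>))"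
  have H: "continuous_on (coord c ` cdom c) (?H b)" for b
    using smooth_on_continuous_on[OF Phi_smooth[OF conn_smooth[OF Psi_c smooth_vfield_const_field[OF c(1)]] c(1)]]
    by simp
  have x: "continuous_on ?T (coord c \<circ> \<gamma>)"
    by (rule smooth_on_continuous_on[OF smooth_curve_chart(2)[OF assms(1) c(1)]])
  have Hx: "continuous_on ?T (\<lambda>t. ?H b ((coord c \<circ> \<gamma>) t))" for b
    by (rule continuous_on_compose2[OF H x]) auto
  have "continuous_on ?T (\<lambda>t. frechet_derivative (coord c \<circ> \<gamma>) (at t) 1)"
    by (rule smooth_on_continuous_on[OF smooth_on_frechet_derivative[OF smooth_curve_chart(2)[OF assms(1) c(1)]]])
  moreover have "frechet_derivative (coord c \<circ> \<gamma>) (at t) 1 = velocity L \<gamma> t c" if "t \<in> ?T" for t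
    using velocity_has_vector_derivative[OF assms(1) c(1), of t] that
      frechet_derivative_eqI[of "coord c \<circ> \<gamma>" _ t] by (simp add: has_vector_derivative_def)
  ultimately have vel: "continuous_on ?T (\<lambda>t. velocity L \<gamma> t c)"
    by (rule continuous_on_eq)
  have "continuous_on ?T (\<lambda>t. \<Sum>b\<in>Basis. (velocity L \<gamma> t c \<bullet> b) *\<^sub>R ?H b ((coord c \<circ> \<gamma>) t))"
    by (intro continuous_on_sum continuous_on_scaleR continuous_on_inner continuous_on_const vel Hx)
  moreover have "(\<Sum>b\<in>Basis. (velocity L \<gamma> t c \<bullet> b) *\<^sub>R ?H b ((coord c \<circ> \<gamma>) t)) =
      along \<gamma> t \<eta>" if t: "t \<in> ?T" for t
  proof -
    have t': "t \<in> J" "\<gamma> t \<in> cdom c" using t by auto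
    have E: "const_field L c b (\<gamma> t) \<in> tspace L (\<gamma> t)" for b
      by (rule const_field_in_tspace[OF c(1) t'(2)])
    have "D (\<gamma> t) (velocity L \<gamma> t) (\<Psi> \<eta>) =
        D (\<gamma> t) (tsum Basis (\<lambda>b. velocity L \<gamma> t c \<bullet> b) (\<lambda>b. const_field L c b (\<gamma> t))) (\<Psi> \<eta>)"
      using tspace_expansion[OF velocity_in_tspace[OF assms(1) t'(1)] c(1) t'(2)] by simp
    also have "\<dots> = tsum Basis (\<lambda>b. velocity L \<gamma> t c \<bullet> b) (\<lambda>b. D (\<gamma> t) (const_field L c b (\<gamma> t)) (\<Psi> \<eta>))"
      by (rule conn_tsum_vector[OF finite_Basis Psi_field pt[OF t'(1)] E])
    finally have "along \<gamma> t \<eta> =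
        \<Phi> (\<gamma> t) (tsum Basis (\<lambda>b. velocity L \<gamma> t c \<bullet> b) (\<lambda>b. D (\<gamma> t) (const_field L c b (\<gamma> t)) (\<Psi> \<eta>)))"
      by simp
    also have "\<dots> = (\<Sum>b\<in>Basis. (velocity L \<gamma> t c \<bullet> b) *\<^sub>R
        \<Phi> (\<gamma> t) (D (\<gamma> t) (const_field L c b (\<gamma> t)) (\<Psi> \<eta>)))"
      by (rule Phi_tsum[OF finite_Basis pt[OF t'(1)] conn_in_tspace[OF Psi_field pt[OF t'(1)] E]])
    finally show ?thesis using c(1) t'(2) by simp
  qed
  ultimately have "continuous_on ?T (\<lambda>t. along \<gamma> t \<eta>)"
    by (rule continuous_on_eq)
  then show "isCont (\<lambda>t. along \<gamma> t \<eta>) t0"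
    using T continuous_on_eq_continuous_at by blast
qed

text \<open>From left to right the condition on the connection is the derivative at time \<open>0\<close> of the invariance
  along a curve with prescribed velocity. From right to left, \<open>P f\<close> satisfies the homogeneous linear
  equation \<open>(P f)' = - P \<Lambda>(\<gamma>') (P f)\<close>, because \<open>P \<Lambda>(\<gamma>')\<close> vanishes on \<open>f - P f\<close>.\<close>

theorem transport_preserves_iff:
  fixes P :: "'f \<Rightarrow> 'f"
  assumes P: "linear P" "\<And>\<eta>. P (P \<eta>) = P \<eta>"
  shows "transport_preserves L D (\<lambda>u. {X \<in> tspace L u. P (\<Phi> u X) = 0}) \<longleftrightarrow>
    (\<forall>u\<in>points L. \<forall>X\<in>tspace L u. \<forall>\<eta>. P \<eta> = 0 \<longrightarrow> P (\<Phi> u (D u X (\<Psi> \<eta>))) = 0)"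
    (is "?transport \<longleftrightarrow> ?coeff")
proof
  assume tr: ?transport
  show ?coeff
  proof (intro ballI allI impI)
    fix u X \<eta> assume u: "u \<in> points L" and X: "X \<in> tspace L u" and \<eta>: "P \<eta> = 0"
    obtain J0 \<gamma> where \<gamma>: "smooth_curve_on L J0 \<gamma>" "0 \<in> J0" "\<gamma> 0 = u" "velocity L \<gamma> 0 = X"
      using ex_smooth_curve[OF u X] by blast
    let ?G = "\<lambda>t \<eta>. - along \<gamma> t \<eta>"
    have J0: "open J0" using \<gamma>(1) by (simp add: smooth_curve_on_def)
    have lin: "linear (?G t)" if "t \<in> J0" for t
      by (rule linear_compose_neg[OF conn_Psi_linear[OF smooth_curve_point[OF \<gamma>(1) that]
              velocity_in_tspace[OF \<gamma>(1) that]]])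
    have cont: "continuous_on J0 (\<lambda>t. ?G t y)" for y
      by (intro continuous_on_minus connection_coefficients_continuous[OF \<gamma>(1)])
    obtain \<delta> f where f: "\<delta> > 0" "{0 - \<delta><..<0 + \<delta>} \<subseteq> J0" "f 0 = \<eta>"
      "\<And>t. t \<in> {0 - \<delta><..<0 + \<delta>} \<Longrightarrow> (f has_vector_derivative ?G t (f t)) (at t)"
      using linear_ode_local_solution[OF J0 \<gamma>(2) lin cont] by blast
    let ?J = "{- \<delta><..<\<delta>}"
    have curve: "smooth_curve_on L ?J \<gamma>"
      by (rule smooth_curve_subset[OF \<gamma>(1)]) (use f in auto)
    have par: "parallel_along L D ?J \<gamma> (\<lambda>t. \<Psi> (f t) (\<gamma> t))"
      by (rule parallel_along_Psi[OF curve]) (use f(4) in auto)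
    have 0: "0 \<in> ?J" using f(1) by simp
    have Pf: "P (f t) = 0" if t: "t \<in> ?J" for t
    proof -
      have "parallel_transport L D ?J \<gamma> 0 t (\<Psi> (f 0) (\<gamma> 0)) (\<Psi> (f t) (\<gamma> t))"
        unfolding parallel_transport_def using par 0 t by blast
      moreover have "\<Psi> (f 0) (\<gamma> 0) \<in> {X \<in> tspace L (\<gamma> 0). P (\<Phi> (\<gamma> 0) X) = 0}"
        using \<eta> f(3) \<gamma>(3) u Psi_in_tspace Phi_Psi by simp
      ultimately have "\<Psi> (f t) (\<gamma> t) \<in> {X \<in> tspace L (\<gamma> t). P (\<Phi> (\<gamma> t) X) = 0}"
        using tr curve unfolding transport_preserves_def by blast
      then show ?thesis using Phi_Psi[OF smooth_curve_point[OF curve t]] by simp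
    qed
    have bl: "bounded_linear P" using P(1) linear_conv_bounded_linear by blast
    have "(f has_vector_derivative ?G 0 (f 0)) (at 0)" using f(4) 0 by simp
    then have "((\<lambda>t. P (f t)) has_vector_derivative P (?G 0 (f 0))) (at 0)"
      by (rule bounded_linear.has_vector_derivative[OF bl])
    moreover have "((\<lambda>t. P (f t)) has_vector_derivative 0) (at 0)"
      by (rule has_vector_derivative_transform_within_open[OF has_vector_derivative_const, of ?J])
        (use Pf 0 in auto)
    ultimately have "P (?G 0 (f 0)) = 0" using vector_derivative_unique_at by blast
    then show "P (\<Phi> u (D u X (\<Psi> \<eta>))) = 0"
      using f(3) \<gamma>(3,4) linear_neg[OF P(1)] by simp
  qed
next
  assume co: ?coeff
  show ?transport
    unfolding transport_preserves_def
  proof (intro allI impI)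
    fix J \<gamma> s t v w
    assume curve: "smooth_curve_on L J \<gamma>" and pt: "parallel_transport L D J \<gamma> s t v w"
      and v: "v \<in> {X \<in> tspace L (\<gamma> s). P (\<Phi> (\<gamma> s) X) = 0}"
    obtain V where V: "parallel_along L D J \<gamma> V" "V s = v" "V t = w" and st: "s \<in> J" "t \<in> J"
      using pt unfolding parallel_transport_def by blast
    let ?G = "\<lambda>t \<eta>. P (along \<gamma> t \<eta>)"
    let ?f = "\<lambda>s. \<Phi> (\<gamma> s) (V s)"
    have bl: "bounded_linear P" using P(1) linear_conv_bounded_linear by blast
    have seg: "closed_segment s t \<subseteq> J"
      using curve st unfolding smooth_curve_on_def by (simp add: closed_segment_subset is_interval_convex)
    have lin: "linear (?G \<tau>)" if "\<tau> \<in> J" for \<tau>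
      using linear_compose[OF conn_Psi_linear[OF smooth_curve_point[OF curve that]
              velocity_in_tspace[OF curve that]] P(1)] by (simp add: o_def)
    have cont: "continuous_on (closed_segment s t) (\<lambda>\<tau>. ?G \<tau> y)" for y
      by (rule continuous_on_subset[OF bounded_linear.continuous_on[OF bl
              connection_coefficients_continuous[OF curve]] seg])
    obtain K where K: "\<And>\<tau> y. \<tau> \<in> closed_segment s t \<Longrightarrow> norm (?G \<tau> y) \<le> K * norm y"
    proof (rule linear_family_bounded[OF compact_segment _ cont])
      show "linear (?G \<tau>)" if "\<tau> \<in> closed_segment s t" for \<tau> using lin seg that by blast
    qed (rule that, assumption)
    have step: "?G \<tau> (?f \<tau>) = ?G \<tau> (P (?f \<tau>))" if "\<tau> \<in> J" for \<tau>
    proof -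
      have "P (?f \<tau> - P (?f \<tau>)) = 0" using P(2) by (simp add: linear_diff[OF P(1)])
      then have "?G \<tau> (?f \<tau> - P (?f \<tau>)) = 0"
        using co smooth_curve_point[OF curve that] velocity_in_tspace[OF curve that] by blast
      then show ?thesis by (simp add: linear_diff[OF lin[OF that]])
    qed
    have "P (?f t) = 0"
    proof (rule norm_derivative_bound_imp_zero[where g = "\<lambda>\<tau>. P (?f \<tau>)" and s = s and K = K
          and g' = "\<lambda>\<tau>. - ?G \<tau> (P (?f \<tau>))"])
      fix \<tau> assume \<tau>: "\<tau> \<in> closed_segment s t"
      then have J: "\<tau> \<in> J" using seg by blast
      show "((\<lambda>\<tau>. P (?f \<tau>)) has_vector_derivative - ?G \<tau> (P (?f \<tau>))) (at \<tau>)"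
        using bounded_linear.has_vector_derivative[OF bl parallel_coefficients[OF curve V(1) J]]
        by (simp add: linear_neg[OF P(1)] step[OF J, symmetric])
      show "norm (- ?G \<tau> (P (?f \<tau>))) \<le> K * norm (P (?f \<tau>))" using K[OF \<tau>] by simp
    next
      show "P (?f s) = 0" using v V(2) by simp
    qed
    moreover have "w \<in> tspace L (\<gamma> t)" using V(1,3) st by (auto simp: parallel_along_def)
    ultimately show "w \<in> {X \<in> tspace L (\<gamma> t). P (\<Phi> (\<gamma> t) X) = 0}" using V(3) by simp
  qed
qed

end

section \<open>The frame bundle\<close>

subsection \<open>Matrices\<close>

lemma invertible_matrix_inv:
  fixes g :: "real^'n^'n"
  assumes "invertible g"
  shows "g ** matrix_inv g = mat 1" "matrix_inv g ** g = mat 1"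
proof -
  have "g ** matrix_inv g = mat 1 \<and> matrix_inv g ** g = mat 1"
    unfolding matrix_inv_def by (rule someI_ex) (use assms in \<open>simp add: invertible_def\<close>)
  then show "g ** matrix_inv g = mat 1" "matrix_inv g ** g = mat 1" by auto
qed

lemma invertible_matrix_inv_vector:
  fixes g :: "real^'n^'n"
  assumes "invertible g"
  shows "g *v (matrix_inv g *v x) = x" "matrix_inv g *v (g *v x) = x"
  using invertible_matrix_inv[OF assms] by (simp_all add: matrix_vector_mul_assoc)

lemma open_invertible: "open {g :: real^'n^'n. invertible g}"
proof -
  have "continuous_on UNIV (\<lambda>g :: real^'n^'n. det g)"
    unfolding det_def by (intro continuous_intros)
  moreover have "open (- {0 :: real})" by (rule open_Compl) simp
  ultimately have "open ((\<lambda>g :: real^'n^'n. det g) -` (- {0}))" by (intro open_vimage)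
  then show ?thesis by (simp add: invertible_det_nz vimage_def)
qed

lemma bounded_bilinear_matrix_mult:
  "bounded_bilinear (\<lambda>(A :: real^'m^'n) (B :: real^'k^'m). A ** B)"
  unfolding bilinear_conv_bounded_bilinear[symmetric] bilinear_def
  by (auto intro!: linearI simp: matrix_add_ldistrib scalar_matrix_assoc matrix_scalar_ac)
    (simp_all add: matrix_matrix_mult_def vec_eq_iff sum.distrib algebra_simps)

lemma bounded_bilinear_matrix_vector_mult:
  "bounded_bilinear (\<lambda>(A :: real^'m^'n) (x :: real^'m). A *v x)"
  unfolding bilinear_conv_bounded_bilinear[symmetric] bilinear_def
  by (auto intro!: linearI simp: algebra_simps matrix_vector_mult_add_rdistrib scaleR_matrix_vector_assoc)

lemma smooth_on_matrix:
  fixes f :: "'a::euclidean_space \<Rightarrow> real^'m \<Rightarrow> real^'n"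
  assumes "open S" "\<And>v. smooth_on S (\<lambda>x. f x v)"
  shows "smooth_on S (\<lambda>x. matrix (f x))"
proof (rule smooth_on_componentwise[OF assms(1)])
  fix b :: "real^'m^'n" assume "b \<in> Basis"
  then obtain i j where b: "b = axis i (axis j 1)"
    by (auto simp: Basis_vec_def)
  have "matrix (f x) \<bullet> b = f x (axis j 1) \<bullet> axis i 1" for x
    by (simp add: b inner_axis matrix_def)
  then show "smooth_on S (\<lambda>x. matrix (f x) \<bullet> b)"
    using smooth_on_bounded_linear[OF assms(1) bounded_linear_inner_left assms(2)] by simp
qed

subsection \<open>Charts of the frame bundle\<close>

locale frame_base = manifold_atlas M for M :: "('p, real^'n) atlas"
begin

abbreviation LM :: "(('p, 'n) frame, 'n fmodel) atlas" where "LM \<equiv> frame_bundle M"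

abbreviation \<theta> :: "('p, 'n) frame \<Rightarrow> ('p, 'n) ltvec \<Rightarrow> real^'n" where "\<theta> \<equiv> canonical_form M"

abbreviation (input) fc :: "('p, real^'n) chart \<Rightarrow> (('p, 'n) frame, 'n fmodel) chart" where
  "fc c \<equiv> frame_chart M c"

definition frame_mat :: "('p, real^'n) chart \<Rightarrow> ('p, 'n) frame \<Rightarrow> real^'n^'n" where
  "frame_mat c w = matrix (\<lambda>\<xi>. snd w \<xi> c)"

text \<open>The inverse of the frame chart: the frame with matrix \<open>g\<close> over the point with coordinates \<open>x\<close>.\<close>

definition frame_of :: "('p, real^'n) chart \<Rightarrow> 'n fmodel \<Rightarrow> ('p, 'n) frame" where
  "frame_of c z = (cinv c (fst z), \<lambda>\<xi>. const_field M c (snd z *v \<xi>) (cinv c (fst z)))"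

lemma cdom_fc: "cdom (fc c) = {w \<in> frames M. fst w \<in> cdom c}"
  by (simp add: frame_chart_def)

lemma coord_fc: "coord (fc c) w = (coord c (fst w), frame_mat c w)"
  by (simp add: frame_chart_def frame_mat_def)

lemma frame_base_point: "w \<in> frames M \<Longrightarrow> fst w \<in> points M"
  by (auto simp: frames_def)

lemma frame_in_tspace: "w \<in> frames M \<Longrightarrow> snd w \<xi> \<in> tspace M (fst w)"
  unfolding frames_def bij_betw_def by auto

lemma frame_inj: "w \<in> frames M \<Longrightarrow> inj (snd w)"
  unfolding frames_def bij_betw_def by auto

lemma frame_linear: "w \<in> frames M \<Longrightarrow> linear (\<lambda>\<xi>. snd w \<xi> c)"
  unfolding frames_def case_prod_beta mem_Collect_eq by blast

lemma frame_inv: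
  assumes "w \<in> frames M"
  shows "inv (snd w) (snd w \<xi>) = \<xi>" "v \<in> tspace M (fst w) \<Longrightarrow> snd w (inv (snd w) v) = v"
proof -
  show "inv (snd w) (snd w \<xi>) = \<xi>" using frame_inj[OF assms] by simp
  assume "v \<in> tspace M (fst w)"
  then have "v \<in> range (snd w)" using assms unfolding frames_def bij_betw_def by auto
  then show "snd w (inv (snd w) v) = v" by (rule f_inv_into_f)
qed

lemma frame_mat_apply: "w \<in> frames M \<Longrightarrow> snd w \<xi> c = frame_mat c w *v \<xi>"
  using matrix_works[of "\<lambda>\<xi>. snd w \<xi> c"] frame_linear[of w c]
  by (simp add: frame_mat_def linear_matrix_vector_mul_eq)

lemma frame_mat_invertible:
  assumes "w \<in> frames M" "c \<in> M" "fst w \<in> cdom c"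
  shows "invertible (frame_mat c w)"
proof -
  have "inj ((*v) (frame_mat c w))"
  proof (rule injI)
    fix \<xi> \<eta> assume "frame_mat c w *v \<xi> = frame_mat c w *v \<eta>"
    then have "snd w \<xi> c = snd w \<eta> c" using frame_mat_apply[OF assms(1)] by simp
    then have "snd w \<xi> = snd w \<eta>"
      using tspace_eqI[OF frame_in_tspace[OF assms(1)] frame_in_tspace[OF assms(1)] assms(2,3)] by simp
    then show "\<xi> = \<eta>" using frame_inj[OF assms(1)] by (simp add: inj_eq)
  qed
  then show ?thesis using matrix_left_invertible_injective invertible_left_inverse by blast
qed

lemma frame_of_frame:
  assumes "c \<in> M" "x \<in> coord c ` cdom c" "invertible g"
  shows "frame_of c (x, g) \<in> frames M" "frame_mat c (frame_of c (x, g)) = g"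
proof -
  let ?p = "cinv c x" and ?u = "\<lambda>\<xi>. const_field M c (g *v \<xi>) (cinv c x)"
  have p: "?p \<in> cdom c" using cinv_in[OF assms(2)] .
  have u: "?u \<xi> c = g *v \<xi>" for \<xi> by (rule const_field_chart[OF assms(1) p])
  show "frame_mat c (frame_of c (x, g)) = g"
    unfolding frame_mat_def frame_of_def by (simp add: u)
  have "linear (\<lambda>\<xi>. ?u \<xi> d)" for d
    using linear_compose[OF matrix_vector_mul_linear[of g] const_field_linear[OF assms(1) p, of d]]
    by (simp add: o_def)
  moreover have "bij_betw ?u UNIV (tspace M ?p)"
  proof (rule bij_betwI[where g = "\<lambda>v. matrix_inv g *v v c"])
    show "?u \<in> UNIV \<rightarrow> tspace M ?p" using const_field_in_tspace[OF assms(1) p] by auto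
    show "matrix_inv g *v ?u \<xi> c = \<xi>" for \<xi> unfolding u by (rule invertible_matrix_inv_vector[OF assms(3)])
    show "?u (matrix_inv g *v v c) = v" if "v \<in> tspace M ?p" for v
      unfolding invertible_matrix_inv_vector(1)[OF assms(3)] by (rule const_field_unique[OF that assms(1) p])
  qed simp
  ultimately show "frame_of c (x, g) \<in> frames M"
    using p cdom_subset_points[OF assms(1)] unfolding frames_def frame_of_def by auto
qed

lemma frame_of_coord:
  assumes "c \<in> M" "w \<in> frames M" "fst w \<in> cdom c"
  shows "frame_of c (coord (fc c) w) = w"
proof (rule prod_eqI)
  show "fst (frame_of c (coord (fc c) w)) = fst w" using assms by (simp add: frame_of_def coord_fc)
  have "const_field M c (frame_mat c w *v \<xi>) (fst w) = snd w \<xi>" for \<xi>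
    using const_field_unique[OF frame_in_tspace[OF assms(2)] assms(1,3), of \<xi>]
    by (simp add: frame_mat_apply[OF assms(2)])
  then show "snd (frame_of c (coord (fc c) w)) = snd w"
    using assms by (simp add: frame_of_def coord_fc)
qed

lemma coord_fc_image:
  assumes "c \<in> M" "W \<subseteq> cdom c"
  shows "coord (fc c) ` {w \<in> frames M. fst w \<in> W} = (coord c ` W) \<times> {g. invertible g}"
proof
  show "coord (fc c) ` {w \<in> frames M. fst w \<in> W} \<subseteq> (coord c ` W) \<times> {g. invertible g}"
  proof (rule image_subsetI)
    fix w assume w: "w \<in> {w \<in> frames M. fst w \<in> W}"
    then have "invertible (frame_mat c w)" using frame_mat_invertible[of w c] assms by auto
    then show "coord (fc c) w \<in> (coord c ` W) \<times> {g. invertible g}" using w by (simp add: coord_fc)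
  qed
  show "(coord c ` W) \<times> {g. invertible g} \<subseteq> coord (fc c) ` {w \<in> frames M. fst w \<in> W}"
  proof clarify
    fix p g assume p: "p \<in> W" and g: "invertible (g :: real^'n^'n)"
    then have x: "coord c p \<in> coord c ` cdom c" using assms by auto
    have "coord (fc c) (frame_of c (coord c p, g)) = (coord c p, g)"
      using frame_of_frame(2)[OF assms(1) x g] p assms by (auto simp: coord_fc frame_of_def)
    moreover have "fst (frame_of c (coord c p, g)) = p" using assms p by (auto simp: frame_of_def)
    ultimately show "(coord c p, g) \<in> coord (fc c) ` {w \<in> frames M. fst w \<in> W}"
      using frame_of_frame(1)[OF assms(1) x g] p by force
  qed
qed

lemma fc_inj: "c \<in> M \<Longrightarrow> inj_on (coord (fc c)) (cdom (fc c))"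
  by (rule inj_on_inverseI[where g = "frame_of c"]) (auto simp: cdom_fc frame_of_coord)

lemma cinv_fc:
  assumes "c \<in> M" "x \<in> coord c ` cdom c" "invertible g"
  shows "cinv (fc c) (x, g) = frame_of c (x, g)"
proof -
  have "(x, g) \<in> coord (fc c) ` cdom (fc c)"
    using coord_fc_image[OF assms(1) subset_refl] assms(2,3) by (simp add: cdom_fc)
  then obtain w where w: "w \<in> cdom (fc c)" "coord (fc c) w = (x, g)" by auto
  then have "cinv (fc c) (x, g) = w"
    using fc_inj[OF assms(1)] by (metis cinv_def inv_into_f_f)
  also have "w = frame_of c (x, g)" using frame_of_coord[OF assms(1), of w] w by (auto simp: cdom_fc)
  finally show ?thesis .
qed

text \<open>The change of frame coordinates is \<open>(x, g) \<mapsto> (\<phi>(x), D\<phi>(x) g)\<close>, so it is smooth, and linear in \<open>g\<close>.\<close>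

lemma transition_fc:
  assumes "c \<in> M" "d \<in> M" "x \<in> coord c ` (cdom c \<inter> cdom d)" "invertible g"
  shows "(coord (fc d) \<circ> cinv (fc c)) (x, g) =
    ((coord d \<circ> cinv c) x, matrix (frechet_derivative (coord d \<circ> cinv c) (at x)) ** g)"
proof -
  obtain p where p: "x = coord c p" "p \<in> cdom c" "p \<in> cdom d" using assms(3) by auto
  have "(\<lambda>\<xi>. const_field M c (g *v \<xi>) p d) = jac c d p \<circ> (\<lambda>\<xi>. g *v \<xi>)"
    using assms p by (auto simp: const_field_def)
  then have "frame_mat d (frame_of c (x, g)) = matrix (jac c d p) ** g"
    using assms(1) p by (simp add: frame_mat_def frame_of_def
        matrix_compose[OF matrix_vector_mul_linear jac_linear[OF assms(1,2) p(2,3)]])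
  then show ?thesis
    using cinv_fc[OF assms(1) _ assms(4), of x] assms(1) p by (auto simp: coord_fc frame_of_def)
qed

lemma fc_overlap: "cdom (fc c) \<inter> cdom (fc d) = {w \<in> frames M. fst w \<in> cdom c \<inter> cdom d}"
  by (auto simp: cdom_fc)

lemma open_coord_fc_overlap:
  "c \<in> M \<Longrightarrow> d \<in> M \<Longrightarrow> open (coord (fc c) ` (cdom (fc c) \<inter> cdom (fc d)))"
  unfolding fc_overlap using coord_fc_image[of c "cdom c \<inter> cdom d"]
  by (simp add: open_Times open_coord_overlap open_invertible)

lemma smooth_atlas_frame_bundle: "smooth_atlas LM"
  unfolding smooth_atlas_def
proof (intro conjI ballI)
  fix e assume "e \<in> LM"
  then obtain c where c: "c \<in> M" "e = fc c" by (auto simp: frame_bundle_def)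
  show "inj_on (coord e) (cdom e)" using fc_inj c by simp
  show "open (coord e ` cdom e)" using open_coord_fc_overlap[OF c(1,1)] c(2) by simp
  fix e' assume "e' \<in> LM"
  then obtain d where d: "d \<in> M" "e' = fc d" by (auto simp: frame_bundle_def)
  let ?S = "coord e ` (cdom e \<inter> cdom e')"
  show op: "open ?S" using open_coord_fc_overlap[OF c(1) d(1)] c d by simp
  let ?U = "coord c ` (cdom c \<inter> cdom d)"
  have S: "?S = ?U \<times> {g. invertible g}"
    using coord_fc_image[OF c(1), of "cdom c \<inter> cdom d"] c d by (simp add: fc_overlap)
  have U: "open ?U" by (rule open_coord_overlap[OF c(1) d(1)])
  have f: "smooth_on ?S fst" by (rule smooth_on_bounded_linear_self[OF bounded_linear_fst])
  have s: "smooth_on ?S snd" by (rule smooth_on_bounded_linear_self[OF bounded_linear_snd])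
  note tr = smooth_transition[OF c(1) d(1)]
  have "smooth_on ?S (\<lambda>z. ((coord d \<circ> cinv c) (fst z),
      matrix (frechet_derivative (coord d \<circ> cinv c) (at (fst z))) ** snd z))"
    by (intro smooth_on_Pair[OF op] smooth_on_bilinear[OF bounded_bilinear_matrix_mult op _ s]
        smooth_on_compose[OF tr f op U] smooth_on_matrix[OF op]
        smooth_on_compose[OF smooth_on_frechet_derivative[OF tr] f op U]) (auto simp: S)
  then show "smooth_on ?S (coord e' \<circ> cinv e)"
  proof (rule smooth_on_cong[OF op, rotated])
    fix z assume "z \<in> ?S"
    then have "z \<in> ?U \<times> {g. invertible g}" using S by simp
    then show "((coord d \<circ> cinv c) (fst z), matrix (frechet_derivative (coord d \<circ> cinv c) (at (fst z))) ** snd z) =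
        (coord e' \<circ> cinv e) z"
      using transition_fc[OF c(1) d(1), of "fst z" "snd z"] unfolding c(2) d(2)
      by (simp only: mem_Times_iff mem_Collect_eq prod.collapse)
  qed
qed

lemma points_frame_bundle: "points LM = frames M"
  using frame_base_point by (fastforce simp: points_def frame_bundle_def cdom_fc)

end

sublocale frame_base \<subseteq> L: manifold_atlas "frame_bundle M"
  by standard (rule smooth_atlas_frame_bundle)

context frame_base
begin

lemma fc_in: "c \<in> M \<Longrightarrow> fc c \<in> LM"
  by (simp add: frame_bundle_def)

lemma coord_fc_dom: "c \<in> M \<Longrightarrow> coord (fc c) ` cdom (fc c) = (coord c ` cdom c) \<times> {g. invertible g}"
  using coord_fc_image[of c "cdom c"] by (simp add: cdom_fc)

lemma ex_chart_frame:
  assumes "u \<in> frames M"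
  obtains c where "c \<in> M" "fst u \<in> cdom c" "u \<in> cdom (fc c)"
  using frame_base_point[OF assms] assms by (auto simp: points_def cdom_fc)

lemma in_cdom_fc: "u \<in> cdom (fc c) \<Longrightarrow> u \<in> frames M \<and> fst u \<in> cdom c"
  by (simp add: cdom_fc)

lemma ltspace_eqI:
  assumes "u \<in> cdom (fc c)" "c \<in> M" "X \<in> tspace LM u" "Y \<in> tspace LM u"
    "X (fc c) = Y (fc c)"
  shows "X = Y"
  by (rule L.tspace_eqI[OF assms(3,4) fc_in[OF assms(2)] assms(1,5)])

text \<open>In frame coordinates \<open>\<pi>\<close> is \<open>(x, g) \<mapsto> x\<close>, so \<open>\<pi>\<^sub>*\<close> forgets the matrix component of a vector.\<close>

lemma proj_chart_change:
  assumes "u \<in> frames M" "X \<in> tspace LM u" "c \<in> M" "fst u \<in> cdom c" "d \<in> M" "fst u \<in> cdom d"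
  shows "proj M u X d = jac c d (fst u) (fst (X (fc c)))"
proof -
  have u: "u \<in> cdom (fc c)" using assms by (simp add: cdom_fc)
  have "((coord d \<circ> cinv c) \<circ> fst has_derivative jac c d (fst u) \<circ> fst) (at (coord (fc c) u))"
    by (rule diff_chain_at[OF bounded_linear_imp_has_derivative[OF bounded_linear_fst]])
      (use jac_has_derivative[OF assms(3,5,4,6)] in \<open>simp add: coord_fc\<close>)
  then have "((coord d \<circ> fst) \<circ> cinv (fc c) has_derivative jac c d (fst u) \<circ> fst) (at (coord (fc c) u))"
  proof (rule has_derivative_transform_within_open[OF _ open_coord_fc_overlap[OF assms(3,3)]])
    show "coord (fc c) u \<in> coord (fc c) ` (cdom (fc c) \<inter> cdom (fc c))" using u by blast
    fix z assume "z \<in> coord (fc c) ` (cdom (fc c) \<inter> cdom (fc c))"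
    then obtain w where w: "w \<in> cdom (fc c)" "z = coord (fc c) w" by blast
    have "cinv (fc c) z = w" using L.cinv_coord[OF fc_in[OF assms(3)] w(1)] w(2) by simp
    then show "((coord d \<circ> cinv c) \<circ> fst) z = ((coord d \<circ> fst) \<circ> cinv (fc c)) z"
      using w assms(3) by (simp add: coord_fc cdom_fc)
  qed
  from L.deriv_along_chart[OF fc_in[OF assms(3)] u assms(2) this]
  show ?thesis using assms(5,6) by (simp add: proj_def pushforward_def)
qed

lemma proj_chart:
  assumes "u \<in> frames M" "X \<in> tspace LM u" "c \<in> M" "fst u \<in> cdom c"
  shows "proj M u X c = fst (X (fc c))"
  using proj_chart_change[OF assms assms(3,4)] jac_self[OF assms(3,4)] by simp

lemma proj_in_tspace:
  assumes "u \<in> frames M" "X \<in> tspace LM u"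
  shows "proj M u X \<in> tspace M (fst u)"
proof (rule tspaceI)
  show "proj M u X c = 0" if "\<not> (c \<in> M \<and> fst u \<in> cdom c)" for c
    using that by (auto simp: proj_def pushforward_def)
  show "proj M u X d = jac c d (fst u) (proj M u X c)"
    if "c \<in> M" "d \<in> M" "fst u \<in> cdom c" "fst u \<in> cdom d" for c d
    using proj_chart_change[OF assms that(1,3,2,4)] proj_chart[OF assms that(1,3)] by simp
qed

lemma inv_frame_chart:
  assumes "u \<in> frames M" "v \<in> tspace M (fst u)" "c \<in> M" "fst u \<in> cdom c"
  shows "inv (snd u) v = matrix_inv (frame_mat c u) *v v c"
proof -
  have "v c = frame_mat c u *v inv (snd u) v"
    using frame_inv(2)[OF assms(1,2)] frame_mat_apply[OF assms(1)] by metis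
  then show ?thesis using invertible_matrix_inv_vector(2)[OF frame_mat_invertible[OF assms(1,3,4)]] by simp
qed

lemma canonical_form_chart:
  assumes "u \<in> frames M" "X \<in> tspace LM u" "c \<in> M" "fst u \<in> cdom c"
  shows "\<theta> u X = matrix_inv (frame_mat c u) *v fst (X (fc c))"
  unfolding canonical_form_def
  using inv_frame_chart[OF assms(1) proj_in_tspace[OF assms(1,2)] assms(3,4)] proj_chart[OF assms] by simp

lemma frame_canonical_form:
  "u \<in> frames M \<Longrightarrow> X \<in> tspace LM u \<Longrightarrow> snd u (\<theta> u X) = proj M u X"
  unfolding canonical_form_def by (rule frame_inv(2)[OF _ proj_in_tspace])

lemma canonical_form_tadd:
  assumes "u \<in> frames M" "X \<in> tspace LM u" "Y \<in> tspace LM u"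
  shows "\<theta> u (tadd X Y) = \<theta> u X + \<theta> u Y"
proof -
  obtain c where c: "c \<in> M" "fst u \<in> cdom c" using ex_chart_frame[OF assms(1)] by blast
  show ?thesis
    using canonical_form_chart[OF assms(1) _ c] assms L.tadd_in_tspace[OF assms(2,3)]
    by (simp add: tadd_def matrix_vector_right_distrib)
qed

lemma canonical_form_tscale:
  assumes "u \<in> frames M" "X \<in> tspace LM u"
  shows "\<theta> u (tscale r X) = r *\<^sub>R \<theta> u X"
proof -
  obtain c where c: "c \<in> M" "fst u \<in> cdom c" using ex_chart_frame[OF assms(1)] by blast
  show ?thesis
    using canonical_form_chart[OF assms(1) _ c] assms L.tscale_in_tspace[OF assms(2)]
    by (simp add: tscale_def matrix_vector_mult_scaleR)
qed

text \<open>Since \<open>u\<close> is injective, \<open>\<theta>(X) = u\<^sup>-\<^sup>1 \<pi>\<^sub>*X\<close> vanishes only if \<open>\<pi>\<^sub>*X\<close> does.\<close>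

lemma vertical_iff:
  "u \<in> frames M \<Longrightarrow> X \<in> vertical M u \<longleftrightarrow> X \<in> tspace LM u \<and> \<theta> u X = 0"
proof -
  assume u: "u \<in> frames M"
  have z: "snd u 0 = tzero" using linear_0[OF frame_linear[OF u]] by (auto simp: tzero_def)
  show ?thesis
    unfolding vertical_def using frame_canonical_form[OF u] z frame_inv(1)[OF u]
    by (metis (mono_tags, lifting) mem_Collect_eq canonical_form_def)
qed

subsection \<open>Fundamental fields\<close>

lemma fundamental_chart:
  assumes "u \<in> frames M" "c \<in> M" "fst u \<in> cdom c"
  shows "fundamental M A u (fc c) = (0, frame_mat c u ** A)"
proof -
  have "coord (fc c) (right_act g u) = (coord c (fst u), frame_mat c u ** g)" for g
  proof -
    have "(\<lambda>\<xi>. snd u (g *v \<xi>) c) = (\<lambda>\<xi>. (frame_mat c u ** g) *v \<xi>)"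
      by (simp add: frame_mat_apply[OF assms(1)] matrix_vector_mul_assoc)
    then have "matrix (\<lambda>\<xi>. snd u (g *v \<xi>) c) = frame_mat c u ** g" by simp
    then show ?thesis by (simp add: frame_chart_def right_act_def)
  qed
  moreover have "((\<lambda>g. (coord c (fst u), frame_mat c u ** g)) has_derivative
      (\<lambda>A. (0, frame_mat c u ** A))) (at (mat 1))"
    by (intro has_derivative_Pair has_derivative_const bounded_linear_imp_has_derivative
        bounded_bilinear.bounded_linear_right[OF bounded_bilinear_matrix_mult])
  ultimately have "frechet_derivative (\<lambda>g. coord (fc c) (right_act g u)) (at (mat 1)) =
      (\<lambda>A. (0, frame_mat c u ** A))"
    by (intro frechet_derivative_eqI) simp
  then show ?thesis using assms fc_in by (simp add: fundamental_def cdom_fc)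
qed

text \<open>The matrix component \<open>g A\<close> of \<open>A\<^sup>*\<close> transforms like a tangent vector because the change of
  coordinates multiplies \<open>g\<close> from the left.\<close>

lemma fundamental_in_tspace:
  assumes "u \<in> frames M"
  shows "fundamental M A u \<in> tspace LM u"
proof (rule L.tspaceI)
  show "fundamental M A u e = 0" if "\<not> (e \<in> LM \<and> u \<in> cdom e)" for e
    using that by (auto simp: fundamental_def)
  fix e e' assume e: "e \<in> LM" "e' \<in> LM" "u \<in> cdom e" "u \<in> cdom e'"
  obtain c d where c: "c \<in> M" "e = fc c" "fst u \<in> cdom c" and d: "d \<in> M" "e' = fc d" "fst u \<in> cdom d"
    using e by (auto simp: frame_bundle_def cdom_fc)
  let ?x = "coord c (fst u)" and ?U = "frame_mat c u" and ?J = "matrix (jac c d (fst u))"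
  have U: "invertible ?U" by (rule frame_mat_invertible[OF assms c(1,3)])
  have J: "frame_mat d u = ?J ** ?U"
    using transition_fc[OF c(1) d(1) _ U, of ?x] L.cinv_coord[OF fc_in[OF c(1)], of u] c d e
    by (auto simp: coord_fc)
  have "((\<lambda>g. (?x, g)) has_derivative (\<lambda>b. (0, b))) (at ?U)"
    by (intro has_derivative_Pair has_derivative_const has_derivative_ident)
  moreover have "(coord e' \<circ> cinv e has_derivative L.jac e e' u) (at (?x, ?U))"
    using L.jac_has_derivative[OF e] c by (simp add: coord_fc)
  ultimately have "((coord e' \<circ> cinv e) \<circ> (\<lambda>g. (?x, g)) has_derivative L.jac e e' u \<circ> (\<lambda>b. (0, b))) (at ?U)"
    by (rule diff_chain_at)
  \<comment> \<open>Only the restriction of the change of coordinates to the fibre over the point is differentiated.\<close>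
  then have "((\<lambda>g. ((coord d \<circ> cinv c) ?x, ?J ** g)) has_derivative L.jac e e' u \<circ> (\<lambda>b. (0, b))) (at ?U)"
    by (rule has_derivative_transform_within_open[OF _ open_invertible])
      (use U c d transition_fc[OF c(1) d(1), of ?x] in \<open>auto simp del: o_apply simp: o_apply[of _ "\<lambda>g. (?x, g)"]\<close>)
  moreover have "((\<lambda>g. ((coord d \<circ> cinv c) ?x, ?J ** g)) has_derivative (\<lambda>b. (0, ?J ** b))) (at ?U)"
    by (intro has_derivative_Pair has_derivative_const bounded_linear_imp_has_derivative
        bounded_bilinear.bounded_linear_right[OF bounded_bilinear_matrix_mult])
  ultimately have "L.jac e e' u \<circ> (\<lambda>b. (0, b)) = (\<lambda>b. (0, ?J ** b))"
    by (rule has_derivative_unique)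
  then have "L.jac e e' u (0, b) = (0, ?J ** b)" for b by (metis comp_apply)
  then show "fundamental M A u e' = L.jac e e' u (fundamental M A u e)"
    using fundamental_chart[OF assms c(1,3)] fundamental_chart[OF assms d(1,3)] c(2) d(2) J
    by (simp add: matrix_mul_assoc)
qed

lemma smooth_on_fst: "smooth_on S fst" and smooth_on_snd: "smooth_on S snd"
  by (rule smooth_on_bounded_linear_self[OF bounded_linear_fst],
      rule smooth_on_bounded_linear_self[OF bounded_linear_snd])

lemma cinv_fc_facts:
  assumes "c \<in> M" "z \<in> coord (fc c) ` cdom (fc c)"
  shows "cinv (fc c) z \<in> frames M" "fst (cinv (fc c) z) = cinv c (fst z)"
    "fst (cinv (fc c) z) \<in> cdom c" "frame_mat c (cinv (fc c) z) = snd z" "cinv (fc c) z \<in> cdom (fc c)"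
    "invertible (snd z)"
proof -
  obtain w where w: "w \<in> frames M" "fst w \<in> cdom c" "z = coord (fc c) w"
    using assms(2) by (auto simp: cdom_fc)
  have "cinv (fc c) z = w" using L.cinv_coord[OF fc_in[OF assms(1)], of w] w by (simp add: cdom_fc)
  then show "cinv (fc c) z \<in> frames M" "fst (cinv (fc c) z) = cinv c (fst z)"
    "fst (cinv (fc c) z) \<in> cdom c" "frame_mat c (cinv (fc c) z) = snd z" "cinv (fc c) z \<in> cdom (fc c)"
    "invertible (snd z)"
    using w assms(1) frame_mat_invertible[OF w(1) assms(1) w(2)] by (auto simp: coord_fc cdom_fc)
qed

lemma frames_Int_cdom: "frames M \<inter> cdom (fc c) = cdom (fc c)"
  by (auto simp: cdom_fc)

lemma open_coord_fc: "c \<in> M \<Longrightarrow> open (coord (fc c) ` cdom (fc c))"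
  using open_coord_fc_overlap[of c c] by simp

lemma smooth_vfield_framesI:
  assumes "\<And>u. u \<in> frames M \<Longrightarrow> X u \<in> tspace LM u"
    "\<And>c. c \<in> M \<Longrightarrow> smooth_on (coord (fc c) ` cdom (fc c)) (\<lambda>z. X (cinv (fc c) z) (fc c))"
  shows "smooth_vfield_on LM (frames M) X"
  unfolding smooth_vfield_on_def
proof (intro conjI ballI)
  show "openin (mtop LM) (frames M)" using L.openin_points by (simp add: points_frame_bundle)
  show "X u \<in> tspace LM u" if "u \<in> frames M" for u using assms(1)[OF that] .
  fix e assume "e \<in> LM"
  then obtain c where c: "c \<in> M" "e = fc c" by (auto simp: frame_bundle_def)
  show "smooth_on (coord e ` (frames M \<inter> cdom e)) (\<lambda>x. X (cinv e x) e)"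
    using assms(2)[OF c(1)] unfolding c(2) frames_Int_cdom .
qed

lemma smooth_vfield_fundamental:
  "smooth_vfield_on LM (frames M) (fundamental M A)"
proof (rule smooth_vfield_framesI[OF fundamental_in_tspace])
  fix c assume c: "c \<in> M"
  let ?S = "coord (fc c) ` cdom (fc c)"
  have S: "open ?S" by (rule open_coord_fc[OF c])
  have "smooth_on ?S (\<lambda>z. (0, snd z ** A))"
    by (intro smooth_on_Pair[OF S] smooth_on_const smooth_on_snd
        smooth_on_bilinear[OF bounded_bilinear_matrix_mult S])
  then show "smooth_on ?S (\<lambda>z. fundamental M A (cinv (fc c) z) (fc c))"
  proof (rule smooth_on_cong[OF S, rotated])
    show "(0, snd z ** A) = fundamental M A (cinv (fc c) z) (fc c)" if "z \<in> ?S" for z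
      using fundamental_chart[OF cinv_fc_facts(1)[OF c that] c cinv_fc_facts(3)[OF c that]]
        cinv_fc_facts(4)[OF c that] by simp
  qed
qed

end

section \<open>The parallelism defined by a connection form\<close>

locale frame_connection = frame_base M + base: manifold_connection M Dt
  for M :: "('p, real^'n) atlas" and Dt +
  fixes \<omega> :: "('p, 'n) gl_form"
  assumes form: "is_connection_form M Dt \<omega>"
begin

abbreviation B :: "real^'n \<Rightarrow> (('p, 'n) frame, 'n fmodel) vfield" where "B \<equiv> std_horizontal M \<omega>"

lemma form_tadd:
  "u \<in> frames M \<Longrightarrow> X \<in> tspace LM u \<Longrightarrow> Y \<in> tspace LM u \<Longrightarrow> \<omega> u (tadd X Y) = \<omega> u X + \<omega> u Y"
  using form unfolding is_connection_form_def Let_def by (elim conjE) blast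

lemma form_tscale:
  "u \<in> frames M \<Longrightarrow> X \<in> tspace LM u \<Longrightarrow> \<omega> u (tscale r X) = r *\<^sub>R \<omega> u X"
  using form unfolding is_connection_form_def Let_def by (elim conjE) blast

lemma form_fundamental: "u \<in> frames M \<Longrightarrow> \<omega> u (fundamental M A u) = A"
  using form unfolding is_connection_form_def Let_def by (elim conjE) blast

lemma form_smooth:
  assumes "smooth_vfield_on LM U X" "c \<in> M"
  shows "smooth_on (coord (fc c) ` (U \<inter> cdom (fc c))) (\<lambda>z. \<omega> (cinv (fc c) z) (X (cinv (fc c) z)))"
proof -
  have "smooth_map_on LM U std_atlas (\<lambda>u. \<omega> u (X u))"
    using form assms(1) unfolding is_connection_form_def Let_def by (elim conjE) blast
  then show ?thesis using fc_in[OF assms(2)] unfolding L.smooth_fun_iff by blast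
qed

lemma form_horizontal_derivative:
  assumes "u \<in> frames M" "Z \<in> horizontal M \<omega> u" "smooth_vfield_on M (points M) Y"
  shows "Dt (fst u) (proj M u Z) Y = snd u (deriv_along LM u Z (\<lambda>w. inv (snd w) (Y (fst w))))"
  using form assms frame_base_point[OF assms(1)] unfolding is_connection_form_def Let_def
  by (elim conjE) blast

lemma tdiff_eq: "tdiff X Y = tadd X (tscale (- 1) Y)"
  by (simp add: tdiff_def tadd_def tscale_def)

lemma form_tdiff:
  "u \<in> frames M \<Longrightarrow> X \<in> tspace LM u \<Longrightarrow> Y \<in> tspace LM u \<Longrightarrow> \<omega> u (tdiff X Y) = \<omega> u X - \<omega> u Y"
  by (simp add: tdiff_eq form_tadd form_tscale L.tscale_in_tspace)

lemma canonical_form_tdiff: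
  "u \<in> frames M \<Longrightarrow> X \<in> tspace LM u \<Longrightarrow> Y \<in> tspace LM u \<Longrightarrow>
    \<theta> u (tdiff X Y) = \<theta> u X - \<theta> u Y"
  by (simp add: tdiff_eq canonical_form_tadd canonical_form_tscale L.tscale_in_tspace)

lemma canonical_form_fundamental:
  assumes "u \<in> frames M"
  shows "\<theta> u (fundamental M A u) = 0"
proof -
  obtain c where c: "c \<in> M" "fst u \<in> cdom c" "u \<in> cdom (fc c)" using ex_chart_frame[OF assms] .
  show ?thesis
    using canonical_form_chart[OF assms fundamental_in_tspace[OF assms] c(1,2)]
      fundamental_chart[OF assms c(1,2)] by simp
qed

lemma fundamental_zero:
  assumes "u \<in> frames M"
  shows "fundamental M 0 u = tzero"
proof -
  obtain c where c: "c \<in> M" "fst u \<in> cdom c" "u \<in> cdom (fc c)" using ex_chart_frame[OF assms] .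
  show ?thesis
    by (rule ltspace_eqI[OF c(3,1) fundamental_in_tspace[OF assms] L.tzero_in_tspace])
      (simp add: fundamental_chart[OF assms c(1,2)] tzero_def zero_prod_def)
qed

lemma fundamental_of_chart_vector:
  assumes "c \<in> M" "u \<in> cdom (fc c)" "X \<in> tspace LM u" "X (fc c) = (0, b)"
  shows "X = fundamental M (matrix_inv (frame_mat c u) ** b) u"
proof (rule ltspace_eqI[OF assms(2,1,3)])
  have u: "u \<in> frames M" "fst u \<in> cdom c" using in_cdom_fc[OF assms(2)] by auto
  show "fundamental M (matrix_inv (frame_mat c u) ** b) u \<in> tspace LM u"
    by (rule fundamental_in_tspace[OF u(1)])
  show "X (fc c) = fundamental M (matrix_inv (frame_mat c u) ** b) u (fc c)"
    using fundamental_chart[OF u(1) assms(1) u(2)] assms(4)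
      invertible_matrix_inv(1)[OF frame_mat_invertible[OF u(1) assms(1) u(2)]]
    by (simp add: matrix_mul_assoc)
qed

text \<open>A vertical vector has the form \<open>(0, b)\<close> in frame coordinates, and \<open>b = g (g\<^sup>-\<^sup>1 b)\<close> is the matrix
  component of the fundamental field of \<open>g\<^sup>-\<^sup>1 b\<close>.\<close>

lemma vertical_eq_fundamental:
  assumes "u \<in> frames M" "X \<in> tspace LM u" "\<theta> u X = 0"
  shows "X = fundamental M (\<omega> u X) u"
proof -
  obtain c where c: "c \<in> M" "fst u \<in> cdom c" "u \<in> cdom (fc c)" using ex_chart_frame[OF assms(1)] .
  have "frame_mat c u *v (matrix_inv (frame_mat c u) *v fst (X (fc c))) = 0"
    using canonical_form_chart[OF assms(1,2) c(1,2)] assms(3) by simp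
  then have "fst (X (fc c)) = 0"
    using invertible_matrix_inv_vector(1)[OF frame_mat_invertible[OF assms(1) c(1,2)]] by simp
  then have "X (fc c) = (0, snd (X (fc c)))" by (simp add: prod_eq_iff)
  then have X: "X = fundamental M (matrix_inv (frame_mat c u) ** snd (X (fc c))) u"
    by (rule fundamental_of_chart_vector[OF c(1,3) assms(2)])
  then have "\<omega> u X = matrix_inv (frame_mat c u) ** snd (X (fc c))"
    using form_fundamental[OF assms(1)] by metis
  then show ?thesis using X by simp
qed

text \<open>The difference of the two vectors is vertical, hence fundamental, and \<open>\<omega>\<close> detects fundamental
  vectors.\<close>

lemma forms_determine:
  assumes "u \<in> frames M" "X \<in> tspace LM u" "Y \<in> tspace LM u"
    "\<omega> u X = \<omega> u Y" "\<theta> u X = \<theta> u Y"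
  shows "X = Y"
proof -
  have "tdiff X Y = fundamental M (\<omega> u (tdiff X Y)) u"
    by (rule vertical_eq_fundamental[OF assms(1) L.tdiff_in_tspace[OF assms(2,3)]])
      (simp add: canonical_form_tdiff[OF assms(1-3)] assms(5))
  then have "tdiff X Y = tzero"
    using form_tdiff[OF assms(1-3)] assms(4) fundamental_zero[OF assms(1)] by simp
  then show ?thesis by (auto simp: tdiff_def tzero_def fun_eq_iff)
qed

lemma std_horizontal_eqI:
  assumes "u \<in> frames M" "X \<in> tspace LM u" "\<omega> u X = 0" "\<theta> u X = \<xi>"
  shows "B \<xi> u = X"
  unfolding std_horizontal_def
proof (rule the_equality)
  show "X \<in> horizontal M \<omega> u \<and> \<theta> u X = \<xi>" using assms by (simp add: horizontal_def)
  show "Y = X" if "Y \<in> horizontal M \<omega> u \<and> \<theta> u Y = \<xi>" for Y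
    by (rule forms_determine[OF assms(1) _ assms(2)]) (use that assms in \<open>auto simp: horizontal_def\<close>)
qed

text \<open>A horizontal vector over a given one arises from any vector over it, here one with vanishing matrix
  component, by subtracting the vertical vector on which \<open>\<omega>\<close> takes the same value.\<close>

lemma std_horizontal_explicit:
  fixes \<xi> :: "real^'n"
  assumes "c \<in> M" "u \<in> cdom (fc c)"
  defines "X \<equiv> const_field LM (fc c) (frame_mat c u *v \<xi>, 0) u"
  shows "B \<xi> u = tdiff X (fundamental M (\<omega> u X) u)"
    "B \<xi> u \<in> tspace LM u" "\<omega> u (B \<xi> u) = 0"
    "\<theta> u (B \<xi> u) = \<xi>"
proof -
  have u: "u \<in> frames M" "fst u \<in> cdom c" using in_cdom_fc[OF assms(2)] by auto
  note U = frame_mat_invertible[OF u(1) assms(1) u(2)]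
  have X: "X \<in> tspace LM u" unfolding X_def by (rule L.const_field_in_tspace[OF fc_in[OF assms(1)] assms(2)])
  have Xc: "X (fc c) = (frame_mat c u *v \<xi>, 0)"
    unfolding X_def by (rule L.const_field_chart[OF fc_in[OF assms(1)] assms(2)])
  note F = fundamental_in_tspace[OF u(1), of "\<omega> u X"]
  let ?B = "tdiff X (fundamental M (\<omega> u X) u)"
  have B: "?B \<in> tspace LM u" by (rule L.tdiff_in_tspace[OF X F])
  have B1: "\<omega> u ?B = 0" by (simp add: form_tdiff[OF u(1) X F] form_fundamental[OF u(1)])
  have B2: "\<theta> u ?B = \<xi>"
    by (simp add: canonical_form_tdiff[OF u(1) X F] canonical_form_fundamental[OF u(1)]
        canonical_form_chart[OF u(1) X assms(1) u(2)] Xc invertible_matrix_inv_vector(2)[OF U])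
  have eq: "B \<xi> u = ?B" by (rule std_horizontal_eqI[OF u(1) B B1 B2])
  then show "B \<xi> u = ?B" "B \<xi> u \<in> tspace LM u"
    "\<omega> u (B \<xi> u) = 0" "\<theta> u (B \<xi> u) = \<xi>"
    using B B1 B2 by simp_all
qed

lemma std_horizontal_in_tspace: "u \<in> frames M \<Longrightarrow> B \<xi> u \<in> tspace LM u"
  using std_horizontal_explicit(2) ex_chart_frame by metis

lemma form_std_horizontal: "u \<in> frames M \<Longrightarrow> \<omega> u (B \<xi> u) = 0"
  using std_horizontal_explicit(3) ex_chart_frame by metis

lemma canonical_form_std_horizontal: "u \<in> frames M \<Longrightarrow> \<theta> u (B \<xi> u) = \<xi>"
  using std_horizontal_explicit(4) ex_chart_frame by metis

lemma hor_eq: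
  assumes "u \<in> frames M" "X \<in> tspace LM u"
  shows "hor M \<omega> u X = B (\<theta> u X) u"
  unfolding hor_def
proof (rule the_equality)
  let ?B = "B (\<theta> u X) u"
  note B = std_horizontal_in_tspace[OF assms(1), of "\<theta> u X"]
  show "?B \<in> horizontal M \<omega> u \<and> tdiff X ?B \<in> vertical M u"
    using B form_std_horizontal[OF assms(1)] canonical_form_std_horizontal[OF assms(1)]
      vertical_iff[OF assms(1)] L.tdiff_in_tspace[OF assms(2) B] canonical_form_tdiff[OF assms B]
    by (simp add: horizontal_def)
  fix Y assume "Y \<in> horizontal M \<omega> u \<and> tdiff X Y \<in> vertical M u"
  then have Y: "Y \<in> tspace LM u" "\<omega> u Y = 0" "\<theta> u (tdiff X Y) = 0"
    using vertical_iff[OF assms(1)] by (auto simp: horizontal_def)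
  then have "\<theta> u Y = \<theta> u X"
    using canonical_form_tdiff[OF assms Y(1)] by simp
  then show "Y = ?B" using std_horizontal_eqI[OF assms(1) Y(1,2)] by simp
qed

lemma ver_eq:
  assumes "u \<in> frames M" "X \<in> tspace LM u"
  shows "ver M \<omega> u X = fundamental M (\<omega> u X) u"
proof -
  note B = std_horizontal_in_tspace[OF assms(1), of "\<theta> u X"]
  have "ver M \<omega> u X = fundamental M (\<omega> u (ver M \<omega> u X)) u"
    by (rule vertical_eq_fundamental[OF assms(1)])
      (simp_all add: ver_def hor_eq[OF assms] L.tdiff_in_tspace[OF assms(2) B]
        canonical_form_tdiff[OF assms B] canonical_form_std_horizontal[OF assms(1)])
  moreover have "\<omega> u (ver M \<omega> u X) = \<omega> u X"
    by (simp add: ver_def hor_eq[OF assms] form_tdiff[OF assms B] form_std_horizontal[OF assms(1)])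
  ultimately show ?thesis by simp
qed

lemma hlift_eq:
  assumes "u \<in> frames M" "Y (fst u) \<in> tspace M (fst u)"
  shows "hlift M \<omega> Y u = B (inv (snd u) (Y (fst u))) u"
proof -
  have "proj M u X = Y (fst u) \<longleftrightarrow> \<theta> u X = inv (snd u) (Y (fst u))"
    if "X \<in> tspace LM u" for X
    using frame_canonical_form[OF assms(1) that] frame_inv(2)[OF assms(1,2)]
    unfolding canonical_form_def by metis
  then have "(X \<in> horizontal M \<omega> u \<and> proj M u X = Y (fst u)) \<longleftrightarrow>
      (X \<in> horizontal M \<omega> u \<and> \<theta> u X = inv (snd u) (Y (fst u)))" for X
    by (auto simp: horizontal_def)
  then show ?thesis by (simp add: hlift_def std_horizontal_def)
qed

subsection \<open>Smoothness\<close>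

text \<open>The form \<open>\<omega>\<close> itself inverts matrices: its value on the vertical vector \<open>(0, b)\<close> at \<open>(x, g)\<close> is
  \<open>g\<^sup>-\<^sup>1 b\<close>. So smoothness of the inversion is part of the smoothness of \<open>\<omega>\<close>.\<close>

lemma smooth_on_matrix_inv:
  assumes "c \<in> M"
  shows "smooth_on (coord (fc c) ` cdom (fc c)) (\<lambda>z. matrix_inv (snd z))"
proof (rule smooth_on_cong[OF open_coord_fc[OF assms]])
  let ?E = "const_field LM (fc c) (0, mat 1)"
  show "smooth_on (coord (fc c) ` cdom (fc c)) (\<lambda>z. \<omega> (cinv (fc c) z) (?E (cinv (fc c) z)))"
    using form_smooth[OF L.smooth_vfield_const_field[OF fc_in[OF assms]] assms] by simp
  fix z assume "z \<in> coord (fc c) ` cdom (fc c)"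
  note z = cinv_fc_facts[OF assms this]
  let ?u = "cinv (fc c) z"
  have "?E ?u = fundamental M (matrix_inv (frame_mat c ?u) ** mat 1) ?u"
    by (rule fundamental_of_chart_vector[OF assms z(5) L.const_field_in_tspace[OF fc_in[OF assms] z(5)]
          L.const_field_chart[OF fc_in[OF assms] z(5)]])
  then show "\<omega> ?u (?E ?u) = matrix_inv (snd z)" using form_fundamental[OF z(1)] z(4) by simp
qed

text \<open>In frame coordinates \<open>B(\<xi>)\<close> is \<open>(g \<xi>, - g \<omega>(g \<xi>, 0))\<close>. For fixed \<open>b\<close> the function \<open>\<omega>(b, 0)\<close> is
  smooth, and the argument \<open>g \<xi>\<close> is handled by linearity.\<close>

lemma smooth_vfield_std_horizontal: "smooth_vfield_on LM (frames M) (B \<xi>)"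
proof (rule smooth_vfield_framesI[OF std_horizontal_in_tspace])
  fix c assume c: "c \<in> M"
  let ?S = "coord (fc c) ` cdom (fc c)"
  let ?E = "\<lambda>b. const_field LM (fc c) (b, 0)"
  let ?h = "\<lambda>b z. \<omega> (cinv (fc c) z) (?E b (cinv (fc c) z))"
  have S: "open ?S" by (rule open_coord_fc[OF c])
  have h: "smooth_on ?S (?h b)" for b
    using form_smooth[OF L.smooth_vfield_const_field[OF fc_in[OF c]] c] by simp
  have g\<xi>: "smooth_on ?S (\<lambda>z. snd z *v \<xi>)"
    by (intro smooth_on_bilinear[OF bounded_bilinear_matrix_vector_mult S] smooth_on_snd smooth_on_const)
  have "smooth_on ?S (\<lambda>z. (snd z *v \<xi>, - (snd z ** (\<Sum>b\<in>Basis. ((snd z *v \<xi>) \<bullet> b) *\<^sub>R ?h b z))))"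
    by (intro smooth_on_Pair[OF S] g\<xi> smooth_on_bounded_linear[OF S bounded_linear_minus[OF bounded_linear_ident]]
        smooth_on_bilinear[OF bounded_bilinear_matrix_mult S] smooth_on_snd smooth_on_sum[OF S]
        smooth_on_scaleR[OF S] smooth_on_bounded_linear[OF S bounded_linear_inner_left] h)
  then show "smooth_on ?S (\<lambda>z. B \<xi> (cinv (fc c) z) (fc c))"
  proof (rule smooth_on_cong[OF S, rotated])
    fix z assume "z \<in> ?S"
    note z = cinv_fc_facts[OF c this]
    let ?u = "cinv (fc c) z"
    note E = L.const_field_in_tspace[OF fc_in[OF c] z(5)]
    have "linear (\<lambda>b. \<omega> ?u (?E b ?u))"
    proof (rule linearI)
      fix a b :: "real^'n" and r :: real
      have "?E (a + b) ?u = tadd (?E a ?u) (?E b ?u)"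
        using linear_add[OF L.const_field_linear[OF fc_in[OF c] z(5)], where ?b1.0 = "(a, 0)" and ?b2.0 = "(b, 0)"]
        by (simp add: tadd_def fun_eq_iff)
      then show "\<omega> ?u (?E (a + b) ?u) = \<omega> ?u (?E a ?u) + \<omega> ?u (?E b ?u)"
        using form_tadd[OF z(1) E E] by simp
      have "?E (r *\<^sub>R a) ?u = tscale r (?E a ?u)"
        using linear_scale[OF L.const_field_linear[OF fc_in[OF c] z(5)], where r = r and b = "(a, 0)"]
        by (simp add: tscale_def fun_eq_iff)
      then show "\<omega> ?u (?E (r *\<^sub>R a) ?u) = r *\<^sub>R \<omega> ?u (?E a ?u)"
        using form_tscale[OF z(1) E] by simp
    qed
    from linear_basis_expansion[OF this, of "snd z *v \<xi>"]
    have sum: "(\<Sum>b\<in>Basis. ((snd z *v \<xi>) \<bullet> b) *\<^sub>R ?h b z) = \<omega> ?u (?E (snd z *v \<xi>) ?u)" by simp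
    have "B \<xi> ?u (fc c) =
        ?E (snd z *v \<xi>) ?u (fc c) - fundamental M (\<omega> ?u (?E (snd z *v \<xi>) ?u)) ?u (fc c)"
      using std_horizontal_explicit(1)[OF c z(5), of \<xi>] z(4) by (simp add: tdiff_def)
    also have "\<dots> = (snd z *v \<xi>, - (snd z ** \<omega> ?u (?E (snd z *v \<xi>) ?u)))"
      using L.const_field_chart[OF fc_in[OF c] z(5)] fundamental_chart[OF z(1) c z(3)] z(4) by simp
    finally show "(snd z *v \<xi>, - (snd z ** (\<Sum>b\<in>Basis. ((snd z *v \<xi>) \<bullet> b) *\<^sub>R ?h b z))) =
        B \<xi> ?u (fc c)"
      by (simp only: sum)
  qed
qed

subsection \<open>The components of a vector field\<close>

text \<open>The equivariant function on the frame bundle that corresponds to a field on the base.\<close>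

definition components :: "('p, real^'n) vfield \<Rightarrow> ('p, 'n) frame \<Rightarrow> real^'n" where
  "components Y w = inv (snd w) (Y (fst w))"

lemma smooth_on_components:
  assumes Y: "smooth_vfield_on M (points M) Y" and c: "c \<in> M"
  shows "smooth_on (coord (fc c) ` cdom (fc c)) (\<lambda>z. components Y (cinv (fc c) z))"
proof -
  let ?S = "coord (fc c) ` cdom (fc c)"
  have S: "open ?S" by (rule open_coord_fc[OF c])
  have pc: "points M \<inter> cdom c = cdom c" using cdom_subset_points[OF c] by blast
  have y: "smooth_on (coord c ` cdom c) (\<lambda>x. Y (cinv c x) c)"
    using smooth_vfieldD(3)[OF Y c] pc by simp
  have "smooth_on ?S (\<lambda>z. matrix_inv (snd z) *v Y (cinv c (fst z)) c)"
    by (rule smooth_on_bilinear[OF bounded_bilinear_matrix_vector_mult S smooth_on_matrix_inv[OF c]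
          smooth_on_compose[OF y smooth_on_fst S open_coord_dom[OF c]]])
      (auto simp: coord_fc_dom[OF c])
  then show ?thesis
  proof (rule smooth_on_cong[OF S, rotated])
    fix z assume "z \<in> ?S"
    note z = cinv_fc_facts[OF c this]
    have "components Y (cinv (fc c) z) =
        matrix_inv (frame_mat c (cinv (fc c) z)) *v Y (fst (cinv (fc c) z)) c"
      unfolding components_def
      by (rule inv_frame_chart[OF z(1) smooth_vfieldD(2)[OF Y frame_base_point[OF z(1)]] c z(3)])
    then show "matrix_inv (snd z) *v Y (cinv c (fst z)) c = components Y (cinv (fc c) z)"
      by (simp add: z(2,4))
  qed
qed

lemma components_has_derivative:
  assumes "smooth_vfield_on M (points M) Y" "c \<in> M" "u \<in> cdom (fc c)"
  shows "(components Y \<circ> cinv (fc c) has_derivative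
    frechet_derivative (components Y \<circ> cinv (fc c)) (at (coord (fc c) u))) (at (coord (fc c) u))"
  using smooth_on_has_derivative[OF smooth_on_components[OF assms(1,2)], of "coord (fc c) u"] assms(3)
  by (simp add: o_def)

lemma deriv_components:
  assumes "smooth_vfield_on M (points M) Y" "c \<in> M" "u \<in> cdom (fc c)" "X \<in> tspace LM u"
  shows "deriv_along LM u X (components Y) =
    frechet_derivative (components Y \<circ> cinv (fc c)) (at (coord (fc c) u)) (X (fc c))"
  by (rule L.deriv_along_chart[OF fc_in[OF assms(2)] assms(3,4) components_has_derivative[OF assms(1-3)]])

lemma smooth_fun_components:
  assumes "smooth_vfield_on M (points M) Y"
  shows "smooth_map_on LM (frames M) std_atlas (\<lambda>w. components Y w \<bullet> b)"
  unfolding L.smooth_fun_iff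
proof (intro conjI ballI)
  show "openin (mtop LM) (frames M)" using L.openin_points by (simp add: points_frame_bundle)
  fix e assume "e \<in> LM"
  then obtain c where c: "c \<in> M" "e = fc c" by (auto simp: frame_bundle_def)
  show "smooth_on (coord e ` (frames M \<inter> cdom e)) (\<lambda>x. components Y (cinv e x) \<bullet> b)"
    unfolding c(2) frames_Int_cdom
    by (rule smooth_on_bounded_linear[OF open_coord_fc[OF c(1)] bounded_linear_inner_left
          smooth_on_components[OF assms c(1)]])
qed

lemma deriv_components_inner:
  assumes "smooth_vfield_on M (points M) Y" "u \<in> frames M" "X \<in> tspace LM u"
  shows "deriv_along LM u X (\<lambda>w. components Y w \<bullet> b) = deriv_along LM u X (components Y) \<bullet> b"
proof -
  obtain c where c: "c \<in> M" "fst u \<in> cdom c" "u \<in> cdom (fc c)" using ex_chart_frame[OF assms(2)] .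
  have "((\<lambda>w. components Y w \<bullet> b) \<circ> cinv (fc c) has_derivative (\<lambda>h.
      frechet_derivative (components Y \<circ> cinv (fc c)) (at (coord (fc c) u)) h \<bullet> b)) (at (coord (fc c) u))"
    using has_derivative_inner_left[OF components_has_derivative[OF assms(1) c(1,3)], of b]
    by (simp add: o_def)
  from L.deriv_along_chart[OF fc_in[OF c(1)] c(3) assms(3) this] show ?thesis
    using deriv_components[OF assms(1) c(1,3) assms(3)] by simp
qed

text \<open>The infinitesimal form of \<open>f(ug) = g\<^sup>-\<^sup>1 f(u)\<close>. In frame coordinates \<open>g f(x, g)\<close> is the component vector of
  \<open>Y\<close> at \<open>x\<close> and does not depend on \<open>g\<close>; differentiating it in the direction \<open>(0, g A)\<close> gives
  \<open>g A\<^sup>*(f) + g A f = 0\<close>.\<close>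

lemma deriv_components_fundamental:
  assumes Y: "smooth_vfield_on M (points M) Y" and u: "u \<in> frames M"
  shows "deriv_along LM u (fundamental M A u) (components Y) = - (A *v components Y u)"
proof -
  obtain c where c: "c \<in> M" "fst u \<in> cdom c" "u \<in> cdom (fc c)" using ex_chart_frame[OF u] .
  let ?z = "coord (fc c) u" and ?F = "components Y \<circ> cinv (fc c)" and ?U = "frame_mat c u"
  let ?F' = "frechet_derivative ?F (at ?z)" and ?y = "\<lambda>x. Y (cinv c x) c"
  let ?y' = "frechet_derivative ?y (at (coord c (fst u)))"
  have zS: "?z \<in> coord (fc c) ` cdom (fc c)" using c(3) by blast
  have F: "(?F has_derivative ?F') (at ?z)" by (rule components_has_derivative[OF Y c(1,3)])
  have Fu: "?F ?z = components Y u" using L.cinv_coord[OF fc_in[OF c(1)] c(3)] by simp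
  have "(snd has_derivative snd) (at ?z)" by (rule bounded_linear_imp_has_derivative[OF bounded_linear_snd])
  from bounded_bilinear.FDERIV[OF bounded_bilinear_matrix_vector_mult this F]
  have 1: "((\<lambda>z. snd z *v ?F z) has_derivative (\<lambda>h. ?U *v ?F' h + snd h *v components Y u)) (at ?z)"
    unfolding Fu by (simp add: coord_fc)
  have "coord c (fst u) \<in> coord c ` (points M \<inter> cdom c)" using c(2) frame_base_point[OF u] by blast
  then have y: "(?y has_derivative ?y') (at (fst ?z))"
    using smooth_on_has_derivative[OF smooth_vfieldD(3)[OF Y c(1)], of "coord c (fst u)"]
    by (simp add: coord_fc)
  from diff_chain_at[OF bounded_linear_imp_has_derivative[OF bounded_linear_fst] this]
  have "(?y \<circ> fst has_derivative ?y' \<circ> fst) (at ?z)" .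
  then have 2: "((\<lambda>z. snd z *v ?F z) has_derivative ?y' \<circ> fst) (at ?z)"
  proof (rule has_derivative_transform_within_open[OF _ open_coord_fc[OF c(1)] zS])
    fix z assume "z \<in> coord (fc c) ` cdom (fc c)"
    note z = cinv_fc_facts[OF c(1) this]
    let ?w = "cinv (fc c) z"
    have "snd ?w (components Y ?w) = Y (fst ?w)"
      unfolding components_def by (rule frame_inv(2)[OF z(1) smooth_vfieldD(2)[OF Y frame_base_point[OF z(1)]]])
    then have "frame_mat c ?w *v components Y ?w = Y (fst ?w) c"
      using frame_mat_apply[OF z(1)] by metis
    then show "(?y \<circ> fst) z = snd z *v ?F z" using z(2,4) by simp
  qed
  have y'0: "?y' 0 = 0"
    using linear_0[OF has_derivative_linear[OF y]] .
  have "(\<lambda>h. ?U *v ?F' h + snd h *v components Y u) = ?y' \<circ> fst"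
    by (rule has_derivative_unique[OF 1 2])
  then have "?U *v ?F' (0, ?U ** A) + (?U ** A) *v components Y u = 0"
    using y'0 by (auto simp: fun_eq_iff)
  then have "?U *v (?F' (0, ?U ** A) + A *v components Y u) = 0"
    by (simp add: matrix_vector_right_distrib matrix_vector_mul_assoc)
  then have "?F' (0, ?U ** A) + A *v components Y u = 0"
    using invertible_matrix_inv_vector(2)[OF frame_mat_invertible[OF u c(1,2)]]
    by (metis matrix_vector_mult_0_right)
  then show ?thesis
    using deriv_components[OF Y c(1,3) fundamental_in_tspace[OF u]] fundamental_chart[OF u c(1,2)]
    by (simp add: eq_neg_iff_add_eq_0)
qed

lemma vector_decomposition:
  assumes "u \<in> frames M" "X \<in> tspace LM u"
  shows "X = tadd (fundamental M (\<omega> u X) u) (B (\<theta> u X) u)"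
proof -
  note F = fundamental_in_tspace[OF assms(1), of "\<omega> u X"]
  note B = std_horizontal_in_tspace[OF assms(1), of "\<theta> u X"]
  show ?thesis
    by (rule forms_determine[OF assms L.tadd_in_tspace[OF F B]])
      (simp_all add: form_tadd[OF assms(1) F B] canonical_form_tadd[OF assms(1) F B] form_fundamental[OF assms(1)]
        canonical_form_fundamental[OF assms(1)] form_std_horizontal[OF assms(1)]
        canonical_form_std_horizontal[OF assms(1)])
qed

text \<open>The covariant derivative of \<open>Y\<close> in terms of its equivariant function \<open>f\<close>. Both sides depend
  linearly on \<open>Z\<close>. For horizontal \<open>Z\<close> the equation is the property that ties \<open>\<omega>\<close> to the connection of
  the base; for \<open>Z = A\<^sup>*\<close> the left side is zero, and so is \<open>A\<^sup>*(f) + A f\<close>.\<close>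

lemma base_connection_components:
  assumes "u \<in> frames M" "Z \<in> tspace LM u" "smooth_vfield_on M (points M) Y"
  shows "inv (snd u) (Dt (fst u) (proj M u Z) Y) =
    deriv_along LM u Z (components Y) + \<omega> u Z *v components Y u"
proof -
  obtain c where c: "c \<in> M" "fst u \<in> cdom c" "u \<in> cdom (fc c)" using ex_chart_frame[OF assms(1)] .
  let ?V = "fundamental M (\<omega> u Z) u" and ?H = "B (\<theta> u Z) u"
  note V = fundamental_in_tspace[OF assms(1), of "\<omega> u Z"]
  note H = std_horizontal_in_tspace[OF assms(1), of "\<theta> u Z"]
  have lin: "linear (frechet_derivative (components Y \<circ> cinv (fc c)) (at (coord (fc c) u)))"
    by (rule has_derivative_linear[OF components_has_derivative[OF assms(3) c(1,3)]])
  have "deriv_along LM u (tadd ?V ?H) (components Y) =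
      deriv_along LM u ?V (components Y) + deriv_along LM u ?H (components Y)"
    unfolding deriv_components[OF assms(3) c(1,3) V] deriv_components[OF assms(3) c(1,3) H]
      deriv_components[OF assms(3) c(1,3) L.tadd_in_tspace[OF V H]]
    by (simp add: tadd_def linear_add[OF lin])
  then have "deriv_along LM u Z (components Y) =
      - (\<omega> u Z *v components Y u) + deriv_along LM u ?H (components Y)"
    using vector_decomposition[OF assms(1,2)] deriv_components_fundamental[OF assms(3,1)] by simp
  moreover have "proj M u Z = proj M u ?H"
    using frame_canonical_form[OF assms(1,2)] frame_canonical_form[OF assms(1) H]
      canonical_form_std_horizontal[OF assms(1)] by simp
  moreover have "Dt (fst u) (proj M u ?H) Y = snd u (deriv_along LM u ?H (components Y))"
    using form_horizontal_derivative[OF assms(1) _ assms(3), of ?H] H form_std_horizontal[OF assms(1)]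
    by (simp add: horizontal_def components_def[abs_def])
  ultimately show ?thesis using frame_inv(1)[OF assms(1)] by simp
qed

end

section \<open>Bases\<close>

lemma basis_family_expansion:
  fixes a :: "nat \<Rightarrow> 'v::real_vector"
  assumes "basis_family m a"
  shows "\<exists>!f. (\<forall>i. i \<notin> {1..m} \<longrightarrow> f i = 0) \<and> v = (\<Sum>i\<in>{1..m}. f i *\<^sub>R a i)"
proof -
  let ?I = "{1..m}"
  have inj: "inj_on a ?I" and ind: "independent (a ` ?I)" and sp: "span (a ` ?I) = UNIV"
    using assms by (auto simp: basis_family_def)
  have "v \<in> range (\<lambda>k. \<Sum>w\<in>a ` ?I. k w *\<^sub>R w)"
    using span_finite[of "a ` ?I"] sp by simp
  then obtain k where "v = (\<Sum>w\<in>a ` ?I. k w *\<^sub>R w)" by blast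
  then have v: "v = (\<Sum>i\<in>?I. k (a i) *\<^sub>R a i)" by (simp only: sum.reindex[OF inj] o_def)
  show ?thesis
  proof (rule ex_ex1I)
    show "\<exists>f. (\<forall>i. i \<notin> ?I \<longrightarrow> f i = 0) \<and> v = (\<Sum>i\<in>?I. f i *\<^sub>R a i)"
      by (rule exI[of _ "\<lambda>i. if i \<in> ?I then k (a i) else 0"]) (simp add: v)
    fix f g
    assume f: "(\<forall>i. i \<notin> ?I \<longrightarrow> f i = 0) \<and> v = (\<Sum>i\<in>?I. f i *\<^sub>R a i)"
      and g: "(\<forall>i. i \<notin> ?I \<longrightarrow> g i = 0) \<and> v = (\<Sum>i\<in>?I. g i *\<^sub>R a i)"
    let ?h = "\<lambda>w. f (inv_into ?I a w) - g (inv_into ?I a w)"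
    have "(\<Sum>w\<in>a ` ?I. ?h w *\<^sub>R w) = (\<Sum>i\<in>?I. (f i - g i) *\<^sub>R a i)"
      unfolding sum.reindex[OF inj] o_def by (rule sum.cong) (simp_all only: inv_into_f_f[OF inj])
    also have "\<dots> = 0"
      using f g by (simp add: scaleR_diff_left sum_subtractf)
    finally have s: "(\<Sum>w\<in>a ` ?I. ?h w *\<^sub>R w) = 0" .
    have eq: "f i = g i" if i: "i \<in> ?I" for i
    proof -
      have "?h (a i) = 0" by (rule independentD[OF ind _ subset_refl s]) (use i in auto)
      then show ?thesis by (simp only: inv_into_f_f[OF inj i] right_minus_eq)
    qed
    show "f = g"
    proof
      show "f i = g i" for i using eq f g by (cases "i \<in> ?I") auto
    qed
  qed
qed

lemma frame_coeff_eq_0_iff: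
  assumes "is_frame N I E" "p \<in> points N" "w \<in> tspace N p"
  shows "(\<forall>i\<in>I. frame_coeff I E p w i = 0) \<longleftrightarrow> w = tzero"
proof -
  let ?P = "\<lambda>f. (\<forall>i. i \<notin> I \<longrightarrow> f i = 0) \<and> w = tsum I f (\<lambda>i. E i p)"
  have ex: "\<exists>!f. ?P f" using assms unfolding is_frame_def by blast
  have c: "?P (frame_coeff I E p w)" unfolding frame_coeff_def by (rule theI'[OF ex])
  show ?thesis
  proof
    assume z: "\<forall>i\<in>I. frame_coeff I E p w i = 0"
    have "w = tsum I (frame_coeff I E p w) (\<lambda>i. E i p)" using c by blast
    also have "\<dots> = tzero" using z by (simp add: tsum_def tzero_def)
    finally show "w = tzero" .
  next
    assume "w = tzero"
    then have "?P (\<lambda>i. 0)" by (simp add: tsum_def tzero_def)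
    then have "frame_coeff I E p w = (\<lambda>i. 0)" unfolding frame_coeff_def by (rule the1_equality[OF ex])
    then show "\<forall>i\<in>I. frame_coeff I E p w i = 0" by simp
  qed
qed

text \<open>The basis of \<open>gl(n) \<times> \<real>\<^sup>n\<close> that corresponds to the frame on the frame bundle, with the same indices.\<close>

definition product_basis ::
  "(nat \<Rightarrow> real^'n^'n) \<Rightarrow> (nat \<Rightarrow> real^'n) \<Rightarrow> nat + nat \<Rightarrow> (real^'n^'n) \<times> (real^'n)" where
  "product_basis A \<xi> = case_sum (\<lambda>i. (A i, 0)) (\<lambda>j. (0, \<xi> j))"

lemma finite_lindex: "finite (lindex TYPE('n::finite))"
  by (simp add: lindex_def)

lemma sum_product_basis:
  "(\<Sum>a\<in>lindex TYPE('n). f a *\<^sub>R product_basis A \<xi> a) =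
    (\<Sum>i\<in>{1..CARD('n)^2}. f (Inl i) *\<^sub>R A i, \<Sum>j\<in>{1..CARD('n)}. f (Inr j) *\<^sub>R \<xi> j)"
  for A :: "nat \<Rightarrow> real^'n^'n"
proof -
  have "(\<Sum>a\<in>lindex TYPE('n). f a *\<^sub>R product_basis A \<xi> a) =
    (\<Sum>i\<in>{1..CARD('n)^2}. (f (Inl i) *\<^sub>R A i, 0)) + (\<Sum>j\<in>{1..CARD('n)}. (0, f (Inr j) *\<^sub>R \<xi> j))"
    unfolding lindex_def by (subst sum.Plus) (simp_all add: product_basis_def o_def)
  then show ?thesis by (simp add: prod_eq_iff fst_sum snd_sum)
qed

lemma product_basis_expansion:
  fixes A :: "nat \<Rightarrow> real^'n^'n"
  assumes "basis_family (CARD('n)^2) A" "basis_family CARD('n) \<xi>"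
  shows "\<exists>!f. (\<forall>a. a \<notin> lindex TYPE('n) \<longrightarrow> f a = 0) \<and>
    \<zeta> = (\<Sum>a\<in>lindex TYPE('n). f a *\<^sub>R product_basis A \<xi> a)"
proof -
  let ?P = "\<lambda>g. (\<forall>i. i \<notin> {1..CARD('n)^2} \<longrightarrow> g i = 0) \<and> fst \<zeta> = (\<Sum>i\<in>{1..CARD('n)^2}. g i *\<^sub>R A i)"
  let ?Q = "\<lambda>h. (\<forall>j. j \<notin> {1..CARD('n)} \<longrightarrow> h j = 0) \<and> snd \<zeta> = (\<Sum>j\<in>{1..CARD('n)}. h j *\<^sub>R \<xi> j)"
  have in_l: "Inl i \<in> lindex TYPE('n) \<longleftrightarrow> i \<in> {1..CARD('n)^2}"
    "Inr j \<in> lindex TYPE('n) \<longleftrightarrow> j \<in> {1..CARD('n)}" for i j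
    by (auto simp: lindex_def)
  have iff: "(\<forall>a. a \<notin> lindex TYPE('n) \<longrightarrow> f a = 0) \<and>
      \<zeta> = (\<Sum>a\<in>lindex TYPE('n). f a *\<^sub>R product_basis A \<xi> a) \<longleftrightarrow> ?P (f \<circ> Inl) \<and> ?Q (f \<circ> Inr)" for f
    unfolding sum_product_basis split_sum_all in_l prod_eq_iff fst_conv snd_conv comp_apply by blast
  note P = basis_family_expansion[OF assms(1), of "fst \<zeta>"]
    and Q = basis_family_expansion[OF assms(2), of "snd \<zeta>"]
  obtain g where g: "?P g" using ex1_implies_ex[OF P] by (elim exE)
  obtain h where h: "?Q h" using ex1_implies_ex[OF Q] by (elim exE)
  show ?thesis unfolding iff
  proof (rule ex1I[of _ "case_sum g h"])
    have "case_sum g h \<circ> Inl = g" "case_sum g h \<circ> Inr = h" by (simp_all add: fun_eq_iff)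
    then show "?P (case_sum g h \<circ> Inl) \<and> ?Q (case_sum g h \<circ> Inr)" using g h by simp
    fix f assume f: "?P (f \<circ> Inl) \<and> ?Q (f \<circ> Inr)"
    have "f \<circ> Inl = g"
      by (rule trans[OF the1_equality[of ?P, OF P conjunct1[OF f], symmetric] the1_equality[of ?P, OF P g]])
    moreover have "f \<circ> Inr = h"
      by (rule trans[OF the1_equality[of ?Q, OF Q conjunct2[OF f], symmetric] the1_equality[of ?Q, OF Q h]])
    ultimately show "f = case_sum g h" by (auto simp: fun_eq_iff split: sum.split)
  qed
qed

lemma bilinear_zero_on_bases:
  fixes A :: "nat \<Rightarrow> real^'n^'n" and T :: "(real^'n^'n) \<times> (real^'n) \<Rightarrow> 'w::real_vector \<Rightarrow> 'g::real_vector"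
  assumes "basis_family (CARD('n)^2) A" "basis_family CARD('n) \<xi>" "span S = UNIV"
    and lin: "\<And>y. linear (\<lambda>\<zeta>. T \<zeta> y)" "\<And>\<zeta>. linear (T \<zeta>)"
    and zero: "\<And>a y. a \<in> lindex TYPE('n) \<Longrightarrow> y \<in> S \<Longrightarrow> T (product_basis A \<xi> a) y = 0"
  shows "T \<zeta> y = 0"
proof (rule linear_eq_0_on_span[OF lin(2)])
  show "y \<in> span S" using assms(3) by simp
  fix x assume x: "x \<in> S"
  obtain f where "\<zeta> = (\<Sum>a\<in>lindex TYPE('n). f a *\<^sub>R product_basis A \<xi> a)"
    using product_basis_expansion[OF assms(1,2), of \<zeta>] by blast
  then have "T \<zeta> x = (\<Sum>a\<in>lindex TYPE('n). f a *\<^sub>R T (product_basis A \<xi> a) x)"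
    by (simp add: linear_sum[OF lin(1)] linear_scale[OF lin(1)])
  also have "\<dots> = 0" using zero x by simp
  finally show "T \<zeta> x = 0" .
qed

section \<open>Connections on the frame bundle\<close>

context frame_connection
begin

text \<open>The field \<open>A\<^sup>* + B(\<xi>)\<close>: together with \<open>frame_forms\<close> below, this is the parallelism of the frame
  bundle.\<close>

definition frame_field :: "(real^'n^'n) \<times> (real^'n) \<Rightarrow> (('p, 'n) frame, 'n fmodel) vfield" where
  "frame_field \<eta> = (\<lambda>u. tadd (fundamental M (fst \<eta>) u) (B (snd \<eta>) u))"

definition frame_forms :: "('p, 'n) frame \<Rightarrow> ('p, 'n) ltvec \<Rightarrow> (real^'n^'n) \<times> (real^'n)" where
  "frame_forms u X = (\<omega> u X, \<theta> u X)"

lemma frame_field_in_tspace: "u \<in> frames M \<Longrightarrow> frame_field \<eta> u \<in> tspace LM u"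
  unfolding frame_field_def
  by (intro L.tadd_in_tspace fundamental_in_tspace std_horizontal_in_tspace)

lemma frame_forms_field: "u \<in> frames M \<Longrightarrow> frame_forms u (frame_field \<eta> u) = \<eta>"
  by (simp add: frame_field_def frame_forms_def form_tadd canonical_form_tadd fundamental_in_tspace
      std_horizontal_in_tspace form_fundamental form_std_horizontal canonical_form_fundamental
      canonical_form_std_horizontal)

lemma frame_field_forms: "u \<in> frames M \<Longrightarrow> X \<in> tspace LM u \<Longrightarrow> frame_field (frame_forms u X) u = X"
  using vector_decomposition by (simp add: frame_field_def frame_forms_def)

lemma frame_field_eqI:
  assumes "u \<in> frames M" "X \<in> tspace LM u" "frame_forms u X = \<eta>"
  shows "frame_field \<eta> u = X"
  using frame_field_forms[OF assms(1,2)] assms(3) by simp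

lemma frame_field_fundamental: "u \<in> frames M \<Longrightarrow> frame_field (A, 0) u = fundamental M A u"
  by (rule frame_field_eqI)
    (simp_all add: fundamental_in_tspace frame_forms_def form_fundamental canonical_form_fundamental)

lemma frame_field_std_horizontal: "u \<in> frames M \<Longrightarrow> frame_field (0, \<xi>) u = B \<xi> u"
  by (rule frame_field_eqI)
    (simp_all add: std_horizontal_in_tspace frame_forms_def form_std_horizontal canonical_form_std_horizontal)

lemma frame_forms_tadd:
  "u \<in> frames M \<Longrightarrow> X \<in> tspace LM u \<Longrightarrow> Y \<in> tspace LM u \<Longrightarrow>
    frame_forms u (tadd X Y) = frame_forms u X + frame_forms u Y"
  by (simp add: frame_forms_def form_tadd canonical_form_tadd)

lemma frame_forms_tscale:
  "u \<in> frames M \<Longrightarrow> X \<in> tspace LM u \<Longrightarrow> frame_forms u (tscale r X) = r *\<^sub>R frame_forms u X"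
  by (simp add: frame_forms_def form_tscale canonical_form_tscale)

lemma frame_field_linear:
  assumes "u \<in> frames M"
  shows "linear (\<lambda>\<eta>. frame_field \<eta> u d)"
proof (rule linearI)
  fix \<eta> \<zeta> :: "(real^'n^'n) \<times> (real^'n)" and r :: real
  note F = frame_field_in_tspace[OF assms]
  have "frame_field (\<eta> + \<zeta>) u = tadd (frame_field \<eta> u) (frame_field \<zeta> u)"
    by (rule frame_field_eqI[OF assms L.tadd_in_tspace[OF F F]])
      (simp add: frame_forms_tadd[OF assms F F] frame_forms_field[OF assms])
  then show "frame_field (\<eta> + \<zeta>) u d = frame_field \<eta> u d + frame_field \<zeta> u d"
    by (simp add: tadd_def)
  have "frame_field (r *\<^sub>R \<eta>) u = tscale r (frame_field \<eta> u)"
    by (rule frame_field_eqI[OF assms L.tscale_in_tspace[OF F]])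
      (simp add: frame_forms_tscale[OF assms F] frame_forms_field[OF assms])
  then show "frame_field (r *\<^sub>R \<eta>) u d = r *\<^sub>R frame_field \<eta> u d"
    by (simp add: tscale_def)
qed

lemma smooth_vfield_frame_field: "smooth_vfield_on LM (frames M) (frame_field \<eta>)"
  unfolding frame_field_def
  by (rule L.smooth_vfield_tadd[OF smooth_vfield_fundamental smooth_vfield_std_horizontal])

text \<open>In frame coordinates \<open>\<theta>\<close> is \<open>(a, b) \<mapsto> g\<^sup>-\<^sup>1 a\<close>, so its smoothness rests on that of the inversion.\<close>

lemma smooth_on_frame_forms:
  assumes "smooth_vfield_on LM U Y" "e \<in> LM"
  shows "smooth_on (coord e ` (U \<inter> cdom e)) (\<lambda>x. frame_forms (cinv e x) (Y (cinv e x)))"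
proof -
  obtain c where c: "c \<in> M" "e = fc c" using assms(2) by (auto simp: frame_bundle_def)
  let ?S = "coord (fc c) ` (U \<inter> cdom (fc c))"
  have S: "open ?S" by (rule L.openin_coord[OF L.smooth_vfieldD(1)[OF assms(1)] fc_in[OF c(1)]])
  have sub: "?S \<subseteq> coord (fc c) ` cdom (fc c)" by blast
  have Yc: "smooth_on ?S (\<lambda>z. Y (cinv (fc c) z) (fc c))"
    by (rule L.smooth_vfieldD(3)[OF assms(1) fc_in[OF c(1)]])
  have "smooth_on ?S (\<lambda>z. matrix_inv (snd z) *v fst (Y (cinv (fc c) z) (fc c)))"
    by (rule smooth_on_bilinear[OF bounded_bilinear_matrix_vector_mult S
          smooth_on_subset[OF smooth_on_matrix_inv[OF c(1)] sub]
          smooth_on_bounded_linear[OF S bounded_linear_fst Yc]])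
  then have \<theta>: "smooth_on ?S (\<lambda>z. \<theta> (cinv (fc c) z) (Y (cinv (fc c) z)))"
  proof (rule smooth_on_cong[OF S, rotated])
    fix z assume z: "z \<in> ?S"
    note zf = cinv_fc_facts[OF c(1) subsetD[OF sub z]]
    have "cinv (fc c) z \<in> U" using z fc_in[OF c(1)] by auto
    then show "matrix_inv (snd z) *v fst (Y (cinv (fc c) z) (fc c)) =
        \<theta> (cinv (fc c) z) (Y (cinv (fc c) z))"
      using canonical_form_chart[OF zf(1) L.smooth_vfieldD(2)[OF assms(1)] c(1) zf(3)] zf(4) by simp
  qed
  show ?thesis
    unfolding c(2) frame_forms_def by (rule smooth_on_Pair[OF S form_smooth[OF assms(1) c(1)] \<theta>])
qed

text \<open>In each tangent space the frame is the image of a basis under the isomorphism of the parallelism.\<close>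

lemma is_frame_lframe:
  assumes "basis_family (CARD('n)^2) A" "basis_family CARD('n) \<xi>"
  shows "is_frame LM (lindex TYPE('n)) (lframe M \<omega> A \<xi>)"
  unfolding is_frame_def points_frame_bundle
proof (intro conjI ballI finite_lindex)
  show "smooth_vfield_on LM (frames M) (lframe M \<omega> A \<xi> a)" for a
    by (cases a) (simp_all add: lframe_def smooth_vfield_fundamental smooth_vfield_std_horizontal)
  fix u w assume u: "u \<in> frames M" and w: "w \<in> tspace LM u"
  have l: "lframe M \<omega> A \<xi> a u = frame_field (product_basis A \<xi> a) u" for a
    by (cases a)
      (simp_all add: lframe_def product_basis_def frame_field_fundamental[OF u] frame_field_std_horizontal[OF u])
  have t: "tsum (lindex TYPE('n)) f (\<lambda>a. lframe M \<omega> A \<xi> a u) =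
      frame_field (\<Sum>a\<in>lindex TYPE('n). f a *\<^sub>R product_basis A \<xi> a) u" for f
    by (simp add: fun_eq_iff tsum_def l linear_sum[OF frame_field_linear[OF u]]
        linear_scale[OF frame_field_linear[OF u]])
  have "w = tsum (lindex TYPE('n)) f (\<lambda>a. lframe M \<omega> A \<xi> a u) \<longleftrightarrow>
      frame_forms u w = (\<Sum>a\<in>lindex TYPE('n). f a *\<^sub>R product_basis A \<xi> a)" for f
  proof (intro iffI)
    let ?s = "\<Sum>a\<in>lindex TYPE('n). f a *\<^sub>R product_basis A \<xi> a"
    show "frame_forms u w = ?s" if "w = tsum (lindex TYPE('n)) f (\<lambda>a. lframe M \<omega> A \<xi> a u)"
      unfolding that t by (rule frame_forms_field[OF u])
    show "w = tsum (lindex TYPE('n)) f (\<lambda>a. lframe M \<omega> A \<xi> a u)" if "frame_forms u w = ?s"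
      unfolding t that[symmetric] by (rule frame_field_forms[OF u w, symmetric])
  qed
  then show "\<exists>!f. (\<forall>i. i \<notin> lindex TYPE('n) \<longrightarrow> f i = 0) \<and>
      w = tsum (lindex TYPE('n)) f (\<lambda>a. lframe M \<omega> A \<xi> a u)"
    using product_basis_expansion[OF assms, of "frame_forms u w"] by simp
qed

lemma hor_eq_iff:
  assumes "u \<in> frames M" "X \<in> tspace LM u"
  shows "hor M \<omega> u X = B \<xi> u \<longleftrightarrow> \<theta> u X = \<xi>"
  using hor_eq[OF assms] canonical_form_std_horizontal[OF assms(1)] by metis

lemma std_horizontal_zero: "u \<in> frames M \<Longrightarrow> B 0 u = tzero"
  using frame_field_std_horizontal[of u 0] frame_field_fundamental[of u 0] fundamental_zero[of u] by simp

lemma hor_eq_tzero_iff: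
  "u \<in> frames M \<Longrightarrow> X \<in> tspace LM u \<Longrightarrow> hor M \<omega> u X = tzero \<longleftrightarrow> \<theta> u X = 0"
  using hor_eq_iff[of u X 0] std_horizontal_zero by simp

lemma ver_eq_tzero_iff:
  assumes "u \<in> frames M" "X \<in> tspace LM u"
  shows "ver M \<omega> u X = tzero \<longleftrightarrow> \<omega> u X = 0"
  using ver_eq[OF assms] form_fundamental[OF assms(1)] fundamental_zero[OF assms(1)] by metis

lemma hor_in_tspace: "u \<in> frames M \<Longrightarrow> X \<in> tspace LM u \<Longrightarrow> hor M \<omega> u X \<in> tspace LM u"
  by (simp add: hor_eq std_horizontal_in_tspace)

lemma ver_in_tspace: "u \<in> frames M \<Longrightarrow> X \<in> tspace LM u \<Longrightarrow> ver M \<omega> u X \<in> tspace LM u"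
  by (simp add: ver_eq fundamental_in_tspace)

end

locale lifted_connection = frame_connection M Dt \<omega>
  for M :: "('p, real^'n) atlas" and Dt and \<omega> +
  fixes D :: "(('p, 'n) frame, 'n fmodel) conn"
  assumes lifted: "linear_connection (frame_bundle M) D"

sublocale lifted_connection \<subseteq> par: parallelization LM D frame_field frame_forms
proof (intro parallelization.intro parallelization_axioms.intro manifold_connection.intro
    manifold_connection_axioms.intro L.manifold_atlas_axioms)
  show "linear_connection LM D" by (rule lifted)
  show "smooth_vfield_on LM (points LM) (frame_field \<eta>)" for \<eta>
    unfolding points_frame_bundle by (rule smooth_vfield_frame_field)
  show "linear (\<lambda>\<eta>. frame_field \<eta> u d)" if "u \<in> points LM" for u d
    using that unfolding points_frame_bundle by (rule frame_field_linear)
qed (simp_all only: points_frame_bundle frame_forms_field frame_field_forms smooth_on_frame_forms)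

context lifted_connection
begin

lemma conn_field_in_tspace:
  "smooth_vfield_on LM (frames M) Y \<Longrightarrow> u \<in> frames M \<Longrightarrow> X \<in> tspace LM u \<Longrightarrow> D u X Y \<in> tspace LM u"
  by (rule par.conn_in_tspace)

lemma conn_fundamental:
  assumes "u \<in> frames M" "X \<in> tspace LM u"
  shows "D u X (fundamental M A) = D u X (frame_field (A, 0))"
  by (rule par.conn_cong[OF smooth_vfield_fundamental smooth_vfield_frame_field _ assms])
    (simp add: frame_field_fundamental)

lemma conn_std_horizontal:
  assumes "u \<in> frames M" "X \<in> tspace LM u"
  shows "D u X (B \<xi>) = D u X (frame_field (0, \<xi>))"
  by (rule par.conn_cong[OF smooth_vfield_std_horizontal smooth_vfield_frame_field _ assms])
    (simp add: frame_field_std_horizontal)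

lemma conn_argument_linear:
  assumes "u \<in> frames M" "X \<in> tspace LM u"
  shows "linear (\<lambda>\<eta>. frame_forms u (D u X (frame_field \<eta>)))"
  by (rule par.conn_Psi_linear) (use assms in \<open>simp_all add: points_frame_bundle\<close>)

lemma conn_direction_linear:
  assumes "u \<in> frames M"
  shows "linear (\<lambda>\<zeta>. frame_forms u (D u (frame_field \<zeta> u) (frame_field \<eta>)))"
proof (rule linearI)
  note F = frame_field_in_tspace[OF assms] and S = smooth_vfield_frame_field[of \<eta>]
  note DF = conn_field_in_tspace[OF S assms F]
  fix \<zeta> \<zeta>' :: "(real^'n^'n) \<times> (real^'n)" and r :: real
  have "frame_field (\<zeta> + \<zeta>') u = tadd (frame_field \<zeta> u) (frame_field \<zeta>' u)"
    by (rule par.Psi_tadd) (simp add: points_frame_bundle assms)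
  then show "frame_forms u (D u (frame_field (\<zeta> + \<zeta>') u) (frame_field \<eta>)) =
      frame_forms u (D u (frame_field \<zeta> u) (frame_field \<eta>)) +
      frame_forms u (D u (frame_field \<zeta>' u) (frame_field \<eta>))"
    by (simp add: par.conn_tadd_vector[OF S assms F F] frame_forms_tadd[OF assms DF DF])
  have "frame_field (r *\<^sub>R \<zeta>) u = tscale r (frame_field \<zeta> u)"
    by (rule par.Psi_tscale) (simp add: points_frame_bundle assms)
  then show "frame_forms u (D u (frame_field (r *\<^sub>R \<zeta>) u) (frame_field \<eta>)) =
      r *\<^sub>R frame_forms u (D u (frame_field \<zeta> u) (frame_field \<eta>))"
    by (simp add: par.conn_tscale_vector[OF S assms F] frame_forms_tscale[OF assms DF])
qed

lemma lframe_eq: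
  "u \<in> frames M \<Longrightarrow> lframe M \<omega> A \<xi> a u = frame_field (product_basis A \<xi> a) u"
  by (cases a)
    (simp_all add: lframe_def product_basis_def frame_field_fundamental frame_field_std_horizontal)

subsection \<open>The special condition\<close>

lemma smooth_vfield_hlift:
  assumes "smooth_vfield_on M (points M) Y"
  shows "smooth_vfield_on LM (frames M) (\<lambda>w. tsum Basis (\<lambda>b. components Y w \<bullet> b) (\<lambda>b. B b w))"
    and "w \<in> frames M \<Longrightarrow> tsum Basis (\<lambda>b. components Y w \<bullet> b) (\<lambda>b. B b w) = hlift M \<omega> Y w"
proof -
  have "openin (mtop LM) (frames M)" using L.openin_points by (simp add: points_frame_bundle)
  then show "smooth_vfield_on LM (frames M)
      (\<lambda>w. tsum Basis (\<lambda>b. components Y w \<bullet> b) (\<lambda>b. B b w))"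
    by (intro L.smooth_vfield_tsum smooth_fun_components[OF assms] smooth_vfield_std_horizontal finite_Basis)
  assume w: "w \<in> frames M"
  have lin: "linear (\<lambda>\<xi>. B \<xi> w d)" for d
    using linear_compose[OF _ frame_field_linear[OF w, of d], of "\<lambda>\<xi>. (0, \<xi>)"]
    by (simp add: o_def frame_field_std_horizontal[OF w] linearI)
  have "hlift M \<omega> Y w = B (components Y w) w"
    unfolding components_def by (rule hlift_eq[of w Y, OF w smooth_vfieldD(2)[OF assms frame_base_point[OF w]]])
  moreover have "B (components Y w) w d =
      tsum Basis (\<lambda>b. components Y w \<bullet> b) (\<lambda>b. B b w) d" for d
    unfolding tsum_def by (rule linear_basis_expansion[OF lin])
  ultimately show "tsum Basis (\<lambda>b. components Y w \<bullet> b) (\<lambda>b. B b w) = hlift M \<omega> Y w"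
    by (simp add: fun_eq_iff)
qed

text \<open>The Leibniz rule for \<open>Y\<^sup>h = \<Sum>\<^sub>b f\<^sub>b B(b)\<close>, where \<open>f\<close> is the equivariant function of \<open>Y\<close> and \<open>b\<close> runs
  through the standard basis.\<close>

lemma canonical_form_conn_hlift:
  assumes Y: "smooth_vfield_on M (points M) Y" and u: "u \<in> frames M" and Z: "Z \<in> tspace LM u"
  shows "D u Z (hlift M \<omega> Y) \<in> tspace LM u"
    "\<theta> u (D u Z (hlift M \<omega> Y)) = deriv_along LM u Z (components Y) +
      \<theta> u (D u Z (B (components Y u)))"
proof -
  note B = smooth_vfield_std_horizontal and Bu = std_horizontal_in_tspace[OF u]
  have S: "smooth_vfield_on LM (frames M) (hlift M \<omega> Y)"
    by (rule L.smooth_vfield_cong[OF smooth_vfield_hlift[OF Y]])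
  show "D u Z (hlift M \<omega> Y) \<in> tspace LM u" by (rule conn_field_in_tspace[OF S u Z])
  have op: "openin (mtop LM) (frames M)" using L.openin_points by (simp add: points_frame_bundle)
  have DB: "D u Z (B b) \<in> tspace LM u" for b by (rule conn_field_in_tspace[OF B u Z])
  have "D u Z (hlift M \<omega> Y) =
      D u Z (\<lambda>w. tsum Basis (\<lambda>b. components Y w \<bullet> b) (\<lambda>b. B b w))"
    by (rule par.conn_cong[OF S smooth_vfield_hlift(1)[OF Y] _ u Z]) (simp add: smooth_vfield_hlift(2)[OF Y])
  also have "\<dots> = tadd
      (tsum Basis (\<lambda>b. deriv_along LM u Z (\<lambda>w. components Y w \<bullet> b)) (\<lambda>b. B b u))
      (tsum Basis (\<lambda>b. components Y u \<bullet> b) (\<lambda>b. D u Z (B b)))"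
    by (rule par.conn_tsum[OF finite_Basis op u Z smooth_fun_components[OF Y] B])
  finally have D: "D u Z (hlift M \<omega> Y) = tadd
      (tsum Basis (\<lambda>b. deriv_along LM u Z (components Y) \<bullet> b) (\<lambda>b. B b u))
      (tsum Basis (\<lambda>b. components Y u \<bullet> b) (\<lambda>b. D u Z (B b)))"
    by (simp only: deriv_components_inner[OF Y u Z])
  have \<theta>_tsum: "\<theta> u (tsum Basis f E) = (\<Sum>b\<in>Basis. f b *\<^sub>R \<theta> u (E b))"
    if "\<And>b. E b \<in> tspace LM u" for f and E :: "real^'n \<Rightarrow> ('p, 'n) ltvec"
  proof -
    have "frame_forms u (tsum Basis f E) = (\<Sum>b\<in>Basis. f b *\<^sub>R frame_forms u (E b))"
      by (rule par.Phi_tsum) (use u that in \<open>simp_all add: points_frame_bundle\<close>)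
    from arg_cong[OF this, of snd] show ?thesis by (simp add: frame_forms_def snd_sum)
  qed
  have lin: "linear (\<lambda>\<xi>. \<theta> u (D u Z (B \<xi>)))"
  proof -
    have "linear (snd \<circ> (\<lambda>\<eta>. frame_forms u (D u Z (frame_field \<eta>))) \<circ> (\<lambda>\<xi>. (0, \<xi>)))"
      by (intro linear_compose conn_argument_linear[OF u Z] linear_snd) (rule linearI; simp)
    then show ?thesis by (simp add: o_def frame_forms_def conn_std_horizontal[OF u Z])
  qed
  show "\<theta> u (D u Z (hlift M \<omega> Y)) = deriv_along LM u Z (components Y) +
      \<theta> u (D u Z (B (components Y u)))"
    unfolding D
    by (simp add: canonical_form_tadd[OF u] L.tsum_in_tspace[OF finite_Basis] Bu DB \<theta>_tsum
        canonical_form_std_horizontal[OF u] euclidean_representation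
        linear_basis_expansion[OF lin, symmetric])
qed

text \<open>Both sides of the special condition contain the derivative of the equivariant function of \<open>Y\<close>, and
  the remaining terms depend only on its value at \<open>u\<close>. This value is arbitrary because every tangent
  vector extends to a global field.\<close>

lemma special_lift_condition_iff:
  assumes "Hausdorff_space (mtop M)"
  shows "special_lift_condition M Dt \<omega> D \<longleftrightarrow> (\<forall>u\<in>frames M. \<forall>Z\<in>tspace LM u. \<forall>\<xi>.
    \<theta> u (D u Z (B \<xi>)) = \<omega> u Z *v \<xi>)"
proof -
  have key: "proj M u (D u Z (hlift M \<omega> Y)) = Dt (fst u) (proj M u Z) Y \<longleftrightarrow>
      \<theta> u (D u Z (B (components Y u))) = \<omega> u Z *v components Y u"
    if Y: "smooth_vfield_on M (points M) Y" and u: "u \<in> frames M" and Z: "Z \<in> tspace LM u" for Y u Z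
  proof -
    have t: "Dt (fst u) (proj M u Z) Y \<in> tspace M (fst u)"
      by (rule base.conn_in_tspace[OF Y frame_base_point[OF u] proj_in_tspace[OF u Z]])
    have "proj M u (D u Z (hlift M \<omega> Y)) = Dt (fst u) (proj M u Z) Y \<longleftrightarrow>
        \<theta> u (D u Z (hlift M \<omega> Y)) = inv (snd u) (Dt (fst u) (proj M u Z) Y)"
      using frame_canonical_form[OF u canonical_form_conn_hlift(1)[OF Y u Z]] frame_inv(2)[OF u t]
      unfolding canonical_form_def by metis
    then show ?thesis
      unfolding canonical_form_conn_hlift(2)[OF Y u Z] base_connection_components[OF u Z Y] by simp
  qed
  show ?thesis
  proof
    assume sp: "special_lift_condition M Dt \<omega> D"
    show "\<forall>u\<in>frames M. \<forall>Z\<in>tspace LM u. \<forall>\<xi>.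
        \<theta> u (D u Z (B \<xi>)) = \<omega> u Z *v \<xi>"
    proof (intro ballI allI)
      fix u Z \<xi> assume u: "u \<in> frames M" and Z: "Z \<in> tspace LM u"
      obtain Y where Y: "smooth_vfield_on M (points M) Y" "Y (fst u) = snd u \<xi>"
        using ex_global_smooth_vfield[OF assms frame_base_point[OF u] frame_in_tspace[OF u]] by blast
      have "components Y u = \<xi>" using Y(2) frame_inv(1)[OF u] by (simp add: components_def)
      then show "\<theta> u (D u Z (B \<xi>)) = \<omega> u Z *v \<xi>"
        using sp key[OF Y(1) u Z] Y(1) u Z unfolding special_lift_condition_def by auto
    qed
  next
    assume "\<forall>u\<in>frames M. \<forall>Z\<in>tspace LM u. \<forall>\<xi>.
        \<theta> u (D u Z (B \<xi>)) = \<omega> u Z *v \<xi>"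
    then show "special_lift_condition M Dt \<omega> D"
      unfolding special_lift_condition_def using key by blast
  qed
qed

subsection \<open>Invariance of the horizontal and of the vertical spaces\<close>

text \<open>A vector is horizontal if its first coefficient in the parallelism vanishes, and the constants with
  vanishing first component correspond to the standard horizontal fields.\<close>

lemma condition_a_iff:
  "condition_a M \<omega> D \<longleftrightarrow>
    (\<forall>u\<in>frames M. \<forall>X\<in>tspace LM u. \<forall>\<xi>. \<omega> u (D u X (B \<xi>)) = 0)"
proof -
  let ?P = "\<lambda>\<eta> :: (real^'n^'n) \<times> (real^'n). (fst \<eta>, 0 :: real^'n)"
  have P: "linear ?P" by (rule linearI) simp_all
  have "condition_a M \<omega> D \<longleftrightarrow>
      transport_preserves LM D (\<lambda>u. {X \<in> tspace LM u. ?P (frame_forms u X) = 0})"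
    unfolding condition_a_def
    by (rule transport_preserves_cong[OF L.manifold_atlas_axioms])
      (auto simp: horizontal_def frame_forms_def zero_prod_def)
  also have "\<dots> \<longleftrightarrow> (\<forall>u\<in>frames M. \<forall>X\<in>tspace LM u. \<forall>\<eta>. ?P \<eta> = 0 \<longrightarrow>
      ?P (frame_forms u (D u X (frame_field \<eta>))) = 0)"
    using par.transport_preserves_iff[OF P] by (simp add: points_frame_bundle)
  also have "\<dots> \<longleftrightarrow> (\<forall>u\<in>frames M. \<forall>X\<in>tspace LM u. \<forall>\<xi>. \<omega> u (D u X (B \<xi>)) = 0)"
    by (simp add: conn_std_horizontal zero_prod_def split_paired_All frame_forms_def)
  finally show ?thesis .
qed

text \<open>As for horizontality, with the two components exchanged.\<close>

lemma condition_b_iff: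
  "condition_b M D \<longleftrightarrow>
    (\<forall>u\<in>frames M. \<forall>X\<in>tspace LM u. \<forall>A. \<theta> u (D u X (fundamental M A)) = 0)"
proof -
  let ?P = "\<lambda>\<eta> :: (real^'n^'n) \<times> (real^'n). (0 :: real^'n^'n, snd \<eta>)"
  have P: "linear ?P" by (rule linearI) simp_all
  have "condition_b M D \<longleftrightarrow>
      transport_preserves LM D (\<lambda>u. {X \<in> tspace LM u. ?P (frame_forms u X) = 0})"
    unfolding condition_b_def
    by (rule transport_preserves_cong[OF L.manifold_atlas_axioms])
      (auto simp: points_frame_bundle vertical_iff frame_forms_def zero_prod_def)
  also have "\<dots> \<longleftrightarrow> (\<forall>u\<in>frames M. \<forall>X\<in>tspace LM u. \<forall>\<eta>. ?P \<eta> = 0 \<longrightarrow>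
      ?P (frame_forms u (D u X (frame_field \<eta>))) = 0)"
    using par.transport_preserves_iff[OF P] by (simp add: points_frame_bundle)
  also have "\<dots> \<longleftrightarrow> (\<forall>u\<in>frames M. \<forall>X\<in>tspace LM u. \<forall>A. \<theta> u (D u X (fundamental M A)) = 0)"
    by (simp add: conn_fundamental zero_prod_def split_paired_All frame_forms_def)
  finally show ?thesis .
qed

subsection \<open>From the frame to all vectors\<close>

text \<open>A bilinear identity for \<open>\<nabla>\<close> holds for all directions and arguments if it holds on the frame. The map
  \<open>E\<close> selects standard horizontal or fundamental fields, \<open>Q\<close> selects the horizontal or the vertical
  component, and \<open>R\<close> is the prescribed value, which is different from zero only for the special
  condition.\<close>

lemma conn_on_frame_iff:
  fixes E :: "'w::real_vector \<Rightarrow> (real^'n^'n) \<times> (real^'n)"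
    and Q :: "(real^'n^'n) \<times> (real^'n) \<Rightarrow> 'g::real_vector"
    and R :: "(real^'n^'n) \<times> (real^'n) \<Rightarrow> 'w \<Rightarrow> 'g"
  assumes "basis_family (CARD('n)^2) A" "basis_family CARD('n) \<xi>" "span S = UNIV"
    and "linear E" "linear Q" "\<And>y. linear (\<lambda>\<zeta>. R \<zeta> y)" "\<And>\<zeta>. linear (R \<zeta>)" and u: "u \<in> frames M"
  shows "(\<forall>a\<in>lindex TYPE('n). \<forall>y\<in>S.
      Q (frame_forms u (D u (lframe M \<omega> A \<xi> a u) (frame_field (E y)))) = R (product_basis A \<xi> a) y) \<longleftrightarrow>
    (\<forall>X\<in>tspace LM u. \<forall>y. Q (frame_forms u (D u X (frame_field (E y)))) = R (frame_forms u X) y)"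
    (is "?on_frame \<longleftrightarrow> ?all")
proof
  let ?T = "\<lambda>\<zeta> y. Q (frame_forms u (D u (frame_field \<zeta> u) (frame_field (E y)))) - R \<zeta> y"
  assume fr: ?on_frame
  have "?T \<zeta> y = 0" for \<zeta> y
  proof (rule bilinear_zero_on_bases[OF assms(1-3), where T = ?T])
    show "linear (\<lambda>\<zeta>. ?T \<zeta> y)" for y
      using linear_compose_sub[OF linear_compose[OF conn_direction_linear[OF u] assms(5)] assms(6)]
      by (simp add: o_def)
    show "linear (?T \<zeta>)" for \<zeta>
      using linear_compose_sub[OF linear_compose[OF assms(4) linear_compose[OF
            conn_argument_linear[OF u frame_field_in_tspace[OF u]] assms(5)]] assms(7)]
      by (simp add: o_def)
    show "?T (product_basis A \<xi> a) y = 0" if "a \<in> lindex TYPE('n)" "y \<in> S" for a y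
      using fr that lframe_eq[OF u] by simp
  qed
  then have T: "?T (frame_forms u X) y = 0" for X y by blast
  show ?all
    using T frame_field_forms[OF u] by (metis eq_iff_diff_eq_0)
next
  assume ?all
  then show ?on_frame
    using frame_field_in_tspace[OF u] frame_forms_field[OF u] lframe_eq[OF u] by metis
qed

text \<open>The coefficients of a vector with respect to a frame all vanish only for the zero vector; \<open>Q\<close>
  extracts the component that \<open>P\<close> projects to.\<close>

lemma coeffs_vanish_iff:
  assumes "basis_family (CARD('n)^2) A" "basis_family CARD('n) \<xi>"
    and "\<And>u X. u \<in> frames M \<Longrightarrow> X \<in> tspace LM u \<Longrightarrow> P u X \<in> tspace LM u"
    and "\<And>u X. u \<in> frames M \<Longrightarrow> X \<in> tspace LM u \<Longrightarrow> P u X = tzero \<longleftrightarrow> Q (frame_forms u X) = 0"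
  shows "coeffs_vanish M \<omega> A \<xi> D P K \<longleftrightarrow> (\<forall>u\<in>frames M. \<forall>a\<in>lindex TYPE('n). \<forall>b\<in>K.
    Q (frame_forms u (D u (lframe M \<omega> A \<xi> a u) (lframe M \<omega> A \<xi> b))) = 0)"
proof -
  have fr: "is_frame LM (lindex TYPE('n)) (lframe M \<omega> A \<xi>)" by (rule is_frame_lframe[OF assms(1,2)])
  have S: "smooth_vfield_on LM (frames M) (lframe M \<omega> A \<xi> a)" for a
    by (cases a) (simp_all add: lframe_def smooth_vfield_fundamental smooth_vfield_std_horizontal)
  have "(\<forall>c\<in>lindex TYPE('n). conn_coeff M \<omega> A \<xi> D P b a c u = 0) \<longleftrightarrow>
      Q (frame_forms u (D u (lframe M \<omega> A \<xi> a u) (lframe M \<omega> A \<xi> b))) = 0" if u: "u \<in> frames M" for a b u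
  proof -
    have t: "D u (lframe M \<omega> A \<xi> a u) (lframe M \<omega> A \<xi> b) \<in> tspace LM u"
      by (rule conn_field_in_tspace[OF S u L.smooth_vfieldD(2)[OF S u]])
    have up: "u \<in> points LM" using u by (simp add: points_frame_bundle)
    show ?thesis
      unfolding conn_coeff_def frame_coeff_eq_0_iff[OF fr up assms(3)[OF u t]] assms(4)[OF u t] ..
  qed
  then show ?thesis unfolding coeffs_vanish_def by blast
qed

end

theorem theorem7:
  fixes M :: "('p, real^'n) atlas"
    and Dt :: "('p, real^'n) conn"
    and \<omega> :: "('p, 'n) gl_form"
    and A :: "nat \<Rightarrow> real^'n^'n"
    and \<xi> :: "nat \<Rightarrow> real^'n"
    and \<Gamma> :: "nat \<Rightarrow> nat \<Rightarrow> nat \<Rightarrow> real"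
    and D :: "(('p, 'n) frame, 'n fmodel) conn"
  assumes "smooth_manifold M"
    and "linear_connection M Dt"
    and "is_connection_form M Dt \<omega>"
    and "basis_family (CARD('n)^2) A"
    and "basis_family CARD('n) \<xi>"
    and "\<forall>i\<in>{1..CARD('n)^2}. \<forall>j\<in>{1..CARD('n)}. A i *v \<xi> j = (\<Sum>k\<in>{1..CARD('n)}. \<Gamma> i j k *\<^sub>R \<xi> k)"
    and "linear_connection (frame_bundle M) D"
  shows
    "is_frame (frame_bundle M) (lindex TYPE('n)) (lframe M \<omega> A \<xi>) \<and>
     (((\<forall>i\<in>{1..CARD('n)}. \<forall>j\<in>{1..CARD('n)}. \<forall>u\<in>frames M.
          hor M \<omega> u (D u (std_horizontal M \<omega> (\<xi> i) u) (std_horizontal M \<omega> (\<xi> j))) = tzero) \<and>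
       (\<forall>i\<in>{1..CARD('n)^2}. \<forall>j\<in>{1..CARD('n)}. \<forall>u\<in>frames M.
          hor M \<omega> u (D u (fundamental M (A i) u) (std_horizontal M \<omega> (\<xi> j))) =
            tsum {1..CARD('n)} (\<Gamma> i j) (\<lambda>k. std_horizontal M \<omega> (\<xi> k) u)))
      \<longleftrightarrow> special_lift_condition M Dt \<omega> D) \<and>
     (coeffs_vanish M \<omega> A \<xi> D (ver M \<omega>) (Inr ` {1..CARD('n)}) \<longleftrightarrow> condition_a M \<omega> D) \<and>
     (coeffs_vanish M \<omega> A \<xi> D (hor M \<omega>) (Inl ` {1..CARD('n)^2}) \<longleftrightarrow> condition_b M D) \<and>
     (coeffs_vanish M \<omega> A \<xi> D (ver M \<omega>) (Inl ` {1..CARD('n)^2}) \<longleftrightarrow> condition_c M \<omega> D)"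
proof -
  interpret lifted_connection M Dt \<omega> D
    using assms(1-3,7)
    by (intro lifted_connection.intro frame_connection.intro frame_base.intro manifold_connection.intro
        manifold_atlas.intro manifold_connection_axioms.intro frame_connection_axioms.intro
        lifted_connection_axioms.intro) (simp_all add: smooth_manifold_def)
  let ?N2 = "{1..CARD('n)^2}" and ?N = "{1..CARD('n)}"
  note bases = assms(4,5)
  have spanA: "span (A ` ?N2) = UNIV" and span\<xi>: "span (\<xi> ` ?N) = UNIV"
    using bases by (auto simp: basis_family_def)
  have linE: "linear (\<lambda>B. (B, 0 :: real^'n))" "linear (\<lambda>x. (0 :: real^'n^'n, x))"
    by (rule linearI; simp)+
  have lin0: "linear (\<lambda>_. 0)" by (rule linearI) simp_all

  have ver0: "ver M \<omega> u X = tzero \<longleftrightarrow> fst (frame_forms u X) = 0"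
    and hor0: "hor M \<omega> u X = tzero \<longleftrightarrow> snd (frame_forms u X) = 0"
    if "u \<in> frames M" "X \<in> tspace (frame_bundle M) u" for u X
    using ver_eq_tzero_iff[OF that] hor_eq_tzero_iff[OF that] by (simp_all add: frame_forms_def)
  have vanish_ver: "coeffs_vanish M \<omega> A \<xi> D (ver M \<omega>) K \<longleftrightarrow> (\<forall>u\<in>frames M. \<forall>a\<in>lindex TYPE('n). \<forall>b\<in>K.
      fst (frame_forms u (D u (lframe M \<omega> A \<xi> a u) (lframe M \<omega> A \<xi> b))) = 0)" for K
    by (rule coeffs_vanish_iff[OF bases ver_in_tspace ver0])
  have vanish_hor: "coeffs_vanish M \<omega> A \<xi> D (hor M \<omega>) K \<longleftrightarrow> (\<forall>u\<in>frames M. \<forall>a\<in>lindex TYPE('n). \<forall>b\<in>K.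
      snd (frame_forms u (D u (lframe M \<omega> A \<xi> a u) (lframe M \<omega> A \<xi> b))) = 0)" for K
    by (rule coeffs_vanish_iff[OF bases hor_in_tspace hor0])
  have lframe_Inl: "lframe M \<omega> A \<xi> (Inl i) = fundamental M (A i)"
    and lframe_Inr: "lframe M \<omega> A \<xi> (Inr j) = std_horizontal M \<omega> (\<xi> j)" for i j
    by (simp_all add: lframe_def)
  have lframe_t: "lframe M \<omega> A \<xi> a u \<in> tspace (frame_bundle M) u" if "u \<in> frames M" for a u
    by (simp add: lframe_eq[OF that] frame_field_in_tspace[OF that])

  have a: "coeffs_vanish M \<omega> A \<xi> D (ver M \<omega>) (Inr ` ?N) \<longleftrightarrow> condition_a M \<omega> D"
  proof -
    have "coeffs_vanish M \<omega> A \<xi> D (ver M \<omega>) (Inr ` ?N) \<longleftrightarrow> (\<forall>u\<in>frames M. \<forall>a\<in>lindex TYPE('n).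
        \<forall>y\<in>\<xi> ` ?N. fst (frame_forms u (D u (lframe M \<omega> A \<xi> a u) (frame_field (0, y)))) = 0)"
      unfolding vanish_ver
      by (simp add: lframe_Inr conn_std_horizontal lframe_t)
    also have "\<dots> \<longleftrightarrow> condition_a M \<omega> D"
      using conn_on_frame_iff[OF bases span\<xi> linE(2) linear_fst lin0 lin0]
      by (simp add: condition_a_iff conn_std_horizontal frame_forms_def)
    finally show ?thesis .
  qed
  have b: "coeffs_vanish M \<omega> A \<xi> D (hor M \<omega>) (Inl ` ?N2) \<longleftrightarrow> condition_b M D"
  proof -
    have "coeffs_vanish M \<omega> A \<xi> D (hor M \<omega>) (Inl ` ?N2) \<longleftrightarrow> (\<forall>u\<in>frames M. \<forall>a\<in>lindex TYPE('n).
        \<forall>y\<in>A ` ?N2. snd (frame_forms u (D u (lframe M \<omega> A \<xi> a u) (frame_field (y, 0)))) = 0)"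
      unfolding vanish_hor
      by (simp add: lframe_Inl conn_fundamental lframe_t)
    also have "\<dots> \<longleftrightarrow> condition_b M D"
      using conn_on_frame_iff[OF bases spanA linE(1) linear_snd lin0 lin0]
      by (simp add: condition_b_iff conn_fundamental frame_forms_def)
    finally show ?thesis .
  qed
  have c: "coeffs_vanish M \<omega> A \<xi> D (ver M \<omega>) (Inl ` ?N2) \<longleftrightarrow> condition_c M \<omega> D"
  proof -
    have "coeffs_vanish M \<omega> A \<xi> D (ver M \<omega>) (Inl ` ?N2) \<longleftrightarrow> (\<forall>u\<in>frames M. \<forall>a\<in>lindex TYPE('n).
        \<forall>y\<in>A ` ?N2. fst (frame_forms u (D u (lframe M \<omega> A \<xi> a u) (frame_field (y, 0)))) = 0)"
      unfolding vanish_ver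
      by (simp add: lframe_Inl conn_fundamental lframe_t)
    also have "\<dots> \<longleftrightarrow> condition_c M \<omega> D"
      using conn_on_frame_iff[OF bases spanA linE(1) linear_fst lin0 lin0]
      by (simp add: condition_c_def conn_fundamental frame_forms_def)
    finally show ?thesis .
  qed

  \<comment> \<open>The equations on the left are the instances of \<open>\<theta>(\<nabla>\<^sub>Z B(x)) = \<omega>(Z) x\<close> with \<open>Z\<close> in the frame and \<open>x\<close> in the
    basis \<open>\<xi>\<close>: on horizontal \<open>Z\<close> the form \<open>\<omega>\<close> vanishes, and on \<open>A\<^sub>i\<^sup>*\<close> its value is \<open>A\<^sub>i\<close>.\<close>
  have special: "((\<forall>i\<in>?N. \<forall>j\<in>?N. \<forall>u\<in>frames M.
        hor M \<omega> u (D u (std_horizontal M \<omega> (\<xi> i) u) (std_horizontal M \<omega> (\<xi> j))) = tzero) \<and>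
      (\<forall>i\<in>?N2. \<forall>j\<in>?N. \<forall>u\<in>frames M.
        hor M \<omega> u (D u (fundamental M (A i) u) (std_horizontal M \<omega> (\<xi> j))) =
          tsum ?N (\<Gamma> i j) (\<lambda>k. std_horizontal M \<omega> (\<xi> k) u)))
      \<longleftrightarrow> special_lift_condition M Dt \<omega> D"
  proof -
    let ?\<theta> = "\<lambda>u X j. snd (frame_forms u (D u X (frame_field (0, \<xi> j))))"
    have DB: "D u X (std_horizontal M \<omega> x) \<in> tspace (frame_bundle M) u"
      if "u \<in> frames M" "X \<in> tspace (frame_bundle M) u" for u X x
      by (rule conn_field_in_tspace[OF smooth_vfield_std_horizontal that])
    have 1: "hor M \<omega> u (D u (std_horizontal M \<omega> (\<xi> i) u) (std_horizontal M \<omega> (\<xi> j))) = tzero \<longleftrightarrow>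
        ?\<theta> u (lframe M \<omega> A \<xi> (Inr i) u) j = fst (product_basis A \<xi> (Inr i)) *v \<xi> j"
      if u: "u \<in> frames M" for u i j
      using hor0[OF u DB[OF u std_horizontal_in_tspace[OF u]]]
        conn_std_horizontal[OF u std_horizontal_in_tspace[OF u]]
      by (simp add: lframe_Inr product_basis_def)
    have 2: "hor M \<omega> u (D u (fundamental M (A i) u) (std_horizontal M \<omega> (\<xi> j))) =
          tsum ?N (\<Gamma> i j) (\<lambda>k. std_horizontal M \<omega> (\<xi> k) u) \<longleftrightarrow>
        ?\<theta> u (lframe M \<omega> A \<xi> (Inl i) u) j = fst (product_basis A \<xi> (Inl i)) *v \<xi> j"
      if u: "u \<in> frames M" and i: "i \<in> ?N2" and j: "j \<in> ?N" for u i j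
    proof -
      have "tsum ?N (\<Gamma> i j) (\<lambda>k. std_horizontal M \<omega> (\<xi> k) u) = std_horizontal M \<omega> (A i *v \<xi> j) u"
      proof
        fix d
        have "frame_field (\<Sum>k\<in>?N. \<Gamma> i j k *\<^sub>R (0 :: real^'n^'n, \<xi> k)) u d =
            (\<Sum>k\<in>?N. \<Gamma> i j k *\<^sub>R frame_field (0, \<xi> k) u d)"
          by (simp only: linear_sum[OF frame_field_linear[OF u]] linear_scale[OF frame_field_linear[OF u]])
        moreover have "(\<Sum>k\<in>?N. \<Gamma> i j k *\<^sub>R (0 :: real^'n^'n, \<xi> k)) = (0, A i *v \<xi> j)"
          using assms(6) i j by (simp add: prod_eq_iff fst_sum snd_sum)
        ultimately show "tsum ?N (\<Gamma> i j) (\<lambda>k. std_horizontal M \<omega> (\<xi> k) u) d =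
            std_horizontal M \<omega> (A i *v \<xi> j) u d"
          by (simp add: tsum_def frame_field_std_horizontal[OF u])
      qed
      then show ?thesis
        using hor_eq_iff[OF u DB[OF u fundamental_in_tspace[OF u]]]
          conn_std_horizontal[OF u fundamental_in_tspace[OF u]]
        by (simp add: lframe_Inl product_basis_def frame_forms_def)
    qed
    have linR: "linear (\<lambda>\<zeta> :: (real^'n^'n) \<times> (real^'n). fst \<zeta> *v y)"
      "linear (\<lambda>y. fst \<zeta> *v y)" for y and \<zeta> :: "(real^'n^'n) \<times> (real^'n)"
      using linear_compose[OF linear_fst bounded_linear.linear[OF bounded_bilinear.bounded_linear_left[OF
              bounded_bilinear_matrix_vector_mult]], of y]
      by (simp_all add: o_def matrix_vector_mul_linear)
    have "special_lift_condition M Dt \<omega> D \<longleftrightarrow> (\<forall>u\<in>frames M. \<forall>X\<in>tspace (frame_bundle M) u. \<forall>y.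
        snd (frame_forms u (D u X (frame_field (0, y)))) = fst (frame_forms u X) *v y)"
      using assms(1) by (simp add: special_lift_condition_iff smooth_manifold_def conn_std_horizontal frame_forms_def)
    also have "\<dots> \<longleftrightarrow> (\<forall>u\<in>frames M. \<forall>a\<in>lindex TYPE('n). \<forall>y\<in>\<xi> ` ?N.
        snd (frame_forms u (D u (lframe M \<omega> A \<xi> a u) (frame_field (0, y)))) = fst (product_basis A \<xi> a) *v y)"
      using conn_on_frame_iff[OF bases span\<xi> linE(2) linear_snd linR] by simp
    also have "\<dots> \<longleftrightarrow> (\<forall>u\<in>frames M. \<forall>a\<in>lindex TYPE('n). \<forall>j\<in>?N.
        ?\<theta> u (lframe M \<omega> A \<xi> a u) j = fst (product_basis A \<xi> a) *v \<xi> j)"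
      by simp
    also have "\<dots> \<longleftrightarrow> (\<forall>u\<in>frames M.
        (\<forall>i\<in>?N2. \<forall>j\<in>?N. ?\<theta> u (lframe M \<omega> A \<xi> (Inl i) u) j = fst (product_basis A \<xi> (Inl i)) *v \<xi> j) \<and>
        (\<forall>i\<in>?N. \<forall>j\<in>?N. ?\<theta> u (lframe M \<omega> A \<xi> (Inr i) u) j = fst (product_basis A \<xi> (Inr i)) *v \<xi> j))"
      unfolding lindex_def Plus_def by blast
    finally show ?thesis using 1 2 by blast
  qed

  show ?thesis using is_frame_lframe[OF bases] special a b c by blast
qed

end
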